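(* Let $n,m\in\mathbb{N}$ and $1<p<n$, and put $p^{\ast}=\frac{pn}{n-p}$. Then for every $\varepsilon>0$ there is a constant $c_{\varepsilon}$ (independent of $u$) such that for every $u\in W^{1,p}(\mathbb{S}^n)$ satisfying $$\int_{\mathbb{S}^n} f|u|^{p^{\ast}}\,d\mu=0\quad\text{for all } f\in\overset{\circ}{\mathcal{P}}_m,$$ one has $$\|u\|_{L^{p^{\ast}}(\mathbb{S}^n)}^p\le\left(\frac{S_{n,p}^p}{\Theta\left(m,\frac{n-p}{n},n\right)}+\varepsilon\right)\|\nabla u\|_{L^p(\mathbb{S}^n)}^p+c_{\varepsilon}\|u\|_{L^p(\mathbb{S}^n)}^p.$$
   Context: $\mathbb{S}^n\subset\mathbb{R}^{n+1}$ is the unit sphere with its standard metric and $\mu$ is the associated (standard) measure; functions are real-valued. $\mathcal{P}_m$ is the set of all polynomials on $\mathbb{R}^{n+1}$ of degree at most $m$, and $\overset{\circ}{\mathcal{P}}_m=\{f\in\mathcal{P}_m:\int_{\mathbb{S}^n}f\,d\mu=0\}$. $S_{n,p}$ is the sharp constant in the Sobolev inequality on $\mathbb{R}^n$, $S_{n,p}=\sup_{\varphi\in C_c^\infty(\mathbb{R}^n)\setminus\{0\}}\frac{\|\varphi\|_{L^{p^{\ast}}}}{\|\nabla\varphi\|_{L^p}}$, whose known value is $$S_{n,p}=\frac1n\left(\frac{n(p-1)}{n-p}\right)^{1-\frac1p}\left(\frac{n!}{\Gamma\left(\frac np\right)\Gamma\left(n+1-\frac np\right)|\mathbb{S}^{n-1}|}\right)^{\frac1n}.$$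 $\mathcal{M}_m^c(\mathbb{S}^n)$ is the set of probability measures $\nu$ on $\mathbb{S}^n$ supported on countably many (finitely or countably infinitely many) points such that $\int_{\mathbb{S}^n}f\,d\nu=0$ for all $f\in\overset{\circ}{\mathcal{P}}_m$ (equivalently, $\frac{1}{|\mathbb{S}^n|}\int_{\mathbb{S}^n}f\,d\mu=\int_{\mathbb{S}^n}f\,d\nu$ for all $f\in\mathcal{P}_m$). For $0<\theta<1$, $$\Theta(m,\theta,n)=\inf\left\{\sum_i\nu_i^{\theta}:\nu\in\mathcal{M}_m^c(\mathbb{S}^n)\text{ is supported on the distinct points }\{\xi_i\}\subset\mathbb{S}^n,\ \nu_i=\nu(\{\xi_i\})\right\}.$$ *)

theory Defs
  imports "HOL-Probability.Probability"
begin

section \<open>Lebesgue spaces\<close>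

definition Lp_space :: "real \<Rightarrow> 'a measure \<Rightarrow> ('a \<Rightarrow> 'b::real_normed_vector) set" where
  "Lp_space p M = {f \<in> borel_measurable M. integrable M (\<lambda>x. norm (f x) powr p)}"

text \<open>Meaningful only for members of \<^const>\<open>Lp_space\<close>: the Bochner integral of a
  non-integrable function is \<open>0\<close>.\<close>

definition Lp_norm :: "real \<Rightarrow> 'a measure \<Rightarrow> ('a \<Rightarrow> 'b::real_normed_vector) \<Rightarrow> real" where
  "Lp_norm p M f = (LINT x|M. norm (f x) powr p) powr (1 / p)"


section \<open>Smooth functions\<close>

primrec Ck :: "nat \<Rightarrow> ('a::real_normed_vector \<Rightarrow> 'b::real_normed_vector) \<Rightarrow> bool" where
  "Ck 0 f \<longleftrightarrow> continuous_on UNIV f"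
| "Ck (Suc k) f \<longleftrightarrow>
     (\<forall>x. f differentiable (at x)) \<and> (\<forall>v. Ck k (\<lambda>x. frechet_derivative f (at x) v))"

definition smooth :: "('a::real_normed_vector \<Rightarrow> 'b::real_normed_vector) \<Rightarrow> bool" where
  "smooth f \<longleftrightarrow> (\<forall>k. Ck k f)"


section \<open>The sharp Sobolev constant on Euclidean space\<close>

definition sobolev_exponent :: "nat \<Rightarrow> real \<Rightarrow> real" where
  "sobolev_exponent n p = p * real n / (real n - p)"

definition gradient :: "(real ^ 'n \<Rightarrow> real) \<Rightarrow> real ^ 'n \<Rightarrow> real ^ 'n" where
  "gradient f x = (\<chi> i. frechet_derivative f (at x) (axis i 1))"

text \<open>The supremum is taken in \<open>real\<close>; for \<open>1 < p < n\<close> the set is nonempty, and bounded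
  above by the Sobolev inequality.\<close>

definition sobolev_const :: "'n::finite itself \<Rightarrow> real \<Rightarrow> real" where
  "sobolev_const (_ :: 'n itself) p =
     Sup {Lp_norm (sobolev_exponent CARD('n) p) lborel \<phi> / Lp_norm p lborel (gradient \<phi>)
       | \<phi> :: real ^ 'n \<Rightarrow> real.
         smooth \<phi> \<and> compact (closure {x. \<phi> x \<noteq> 0}) \<and> \<phi> \<noteq> (\<lambda>x. 0)}"


section \<open>Surface measure and Sobolev space on the unit sphere\<close>

text \<open>The standard surface measure of the unit sphere in its polar-coordinate form: the measure
  of a Borel set \<open>A\<close> is \<open>d\<close> times the Lebesgue measure of the cone
  \<open>{t *\<^sub>R x | 0 < t < 1, x \<in> A}\<close>, where \<open>d\<close> is the dimension of the ambient space. This is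
  the Riemannian volume of the round metric, without normalisation. Recall
  \<open>sgn x = x /\<^sub>R norm x\<close>.\<close>

definition sphere_measure :: "'a::euclidean_space measure" where
  "sphere_measure =
     scale_measure (of_nat DIM('a))
       (distr (restrict_space lborel (ball 0 1 - {0})) (restrict_space borel (sphere 0 1)) sgn)"

text \<open>Smooth vector fields on the sphere are represented by smooth fields on the ambient space
  that are tangent at the points of the sphere. The Riemannian divergence of such a field at \<open>x\<close>
  is the trace of its derivative over the tangent space, that is, the full trace minus the
  contribution of the unit normal \<open>x\<close>; on the sphere it depends only on the values there.\<close>

definition smooth_tangent_field :: "('a::euclidean_space \<Rightarrow> 'a) \<Rightarrow> bool" where
  "smooth_tangent_field X \<longleftrightarrow> smooth X \<and> (\<forall>x\<in>sphere 0 1. X x \<bullet> x = 0)"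

definition sphere_div :: "('a::euclidean_space \<Rightarrow> 'a) \<Rightarrow> 'a \<Rightarrow> real" where
  "sphere_div X x =
     (\<Sum>b\<in>Basis. frechet_derivative X (at x) b \<bullet> b) - frechet_derivative X (at x) x \<bullet> x"

definition has_weak_gradient :: "('a::euclidean_space \<Rightarrow> real) \<Rightarrow> ('a \<Rightarrow> 'a) \<Rightarrow> bool" where
  "has_weak_gradient u G \<longleftrightarrow>
     integrable sphere_measure u \<and> integrable sphere_measure G \<and>
     (AE x in sphere_measure. G x \<bullet> x = 0) \<and>
     (\<forall>X. smooth_tangent_field X \<longrightarrow>
        (LINT x|sphere_measure. u x * sphere_div X x) = - (LINT x|sphere_measure. G x \<bullet> X x))"

text \<open>Functions on the sphere are represented by functions on the ambient space whose values off
  the sphere are irrelevant.\<close>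

definition sphere_W1 :: "real \<Rightarrow> ('a::euclidean_space \<Rightarrow> real) set" where
  "sphere_W1 p =
     {u \<in> Lp_space p sphere_measure. \<exists>G \<in> Lp_space p sphere_measure. has_weak_gradient u G}"

text \<open>Weak gradients are unique up to null sets, so the choice is immaterial under integrals.\<close>

definition weak_gradient :: "('a::euclidean_space \<Rightarrow> real) \<Rightarrow> 'a \<Rightarrow> 'a" where
  "weak_gradient u = (SOME G. has_weak_gradient u G)"


section \<open>Polynomials and the constant Theta\<close>

definition polys :: "nat \<Rightarrow> (real ^ 'k \<Rightarrow> real) set" where
  "polys m = {f. \<exists>c :: ('k \<Rightarrow> nat) \<Rightarrow> real.
     \<forall>x. f x = (\<Sum>\<alpha> | (\<Sum>i\<in>UNIV. \<alpha> i) \<le> m. c \<alpha> * (\<Prod>i\<in>UNIV. (x $ i) ^ \<alpha> i))}"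

definition mean_zero_polys :: "nat \<Rightarrow> (real ^ 'k \<Rightarrow> real) set" where
  "mean_zero_polys m = {f \<in> polys m. (LINT x|sphere_measure. f x) = 0}"

text \<open>A probability measure carried by countably many points is a \<open>pmf\<close>; its distinct atoms
  \<open>\<xi>\<^sub>i\<close> form \<^const>\<open>set_pmf\<close>, with masses \<open>\<nu>\<^sub>i = pmf \<nu> \<xi>\<^sub>i\<close>.\<close>

definition Mc :: "nat \<Rightarrow> (real ^ 'k) pmf set" where
  "Mc m = {\<nu>. set_pmf \<nu> \<subseteq> sphere 0 1 \<and>
     (\<forall>f\<in>mean_zero_polys m. (LINT x|measure_pmf \<nu>. f x) = 0)}"

text \<open>The sums may be infinite for infinitely many atoms, so the infimum is taken in
  \<open>ennreal\<close>. It is finite, as \<^const>\<open>Mc\<close> contains finitely supported measures.\<close>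

definition Theta :: "'k::finite itself \<Rightarrow> nat \<Rightarrow> real \<Rightarrow> real" where
  "Theta (_ :: 'k itself) m \<theta> =
     enn2real (INF \<nu> \<in> (Mc m :: (real ^ 'k) pmf set).
       \<Sum>\<^sub>\<infinity>\<xi>\<in>set_pmf \<nu>. ennreal (pmf \<nu> \<xi> powr \<theta>))"

end

theory Submission
  imports Defs
begin

text \<open>
  Write \<open>s = p n / (n - p)\<close> for the Sobolev exponent, \<open>\<theta> = p / s = (n - p) / n\<close>, and \<open>\<Theta>\<close> for the constant
  \<^const>\<open>Theta\<close>. Cut the sphere into small pieces by functions \<open>\<eta>\<^sub>z \<ge> 0\<close> with
  \<open>(\<Sum>z. \<eta>\<^sub>z) = 1\<close>, the support of \<open>\<eta>\<^sub>z\<close> being a small cap around \<open>z\<close>. A small cap is almost flat, so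
  \<open>\<parallel>\<eta>\<^sub>z u\<parallel>\<^sub>s\<^sup>p\<close> is at most \<open>S\<^sup>p + \<tau>\<close> times the integral of \<open>\<eta>\<^sub>z\<^sup>p |\<nabla>u|\<^sup>p\<close>, up to a multiple of \<open>\<parallel>u\<parallel>\<^sub>p\<^sup>p\<close>,
  where \<open>S\<close> is the Euclidean constant (\<open>local_sobolev_inequality\<close>). Since \<open>(\<Sum>z. \<eta>\<^sub>z\<^sup>p) \<le> 1\<close>, summing over
  \<open>z\<close> gives
  \[ \sum_z \nu_z^\theta \, \|u\|_s^p \le (S^p + \tau) \, \|\nabla u\|_p^p + C \, \|u\|_p^p , \]
  where \<open>\<nu>\<^sub>z\<close> is the integral of \<open>\<eta>\<^sub>z\<^sup>s |u|\<^sup>s\<close> divided by that of \<open>|u|\<^sup>s\<close>. It remains to bound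
  \<open>(\<Sum>z. \<nu>\<^sub>z\<^sup>\<theta>)\<close> below by \<open>\<Theta> - \<tau>\<close>.

  The masses \<open>\<nu>\<^sub>z\<close> at the points \<open>z\<close> almost form a member of \<^const>\<open>Mc\<close>. The constraint on \<open>u\<close> says that
  \<open>|u|\<^sup>s\<close> annihilates the mean-zero polynomials, and these vary little on a small cap, so the
  discrete moments are small. The total mass can be less than \<open>1\<close> only because of the overlaps, where
  \<open>(\<Sum>z. \<eta>\<^sub>z\<^sup>s) < 1\<close>. The overlaps are confined to thin shells around the points \<open>z\<close>, and among many
  disjoint choices of the shell radii one carries little of \<open>|u|\<^sup>s\<close> (\<open>shells_pigeonhole\<close>). Only
  finitely many partitions occur, so the final constant does not depend on \<open>u\<close>.

  An almost admissible measure becomes admissible by adding a small multiple of measures taken from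
  a finite list that does not depend on it (\<open>Theta_stability\<close>). Such a list exists since every small
  vector of moments against an orthonormal basis of the mean-zero polynomials is attained by a finitely supported
  probability measure (\<open>weights_with_prescribed_moments\<close>). The correction has a bounded number of
  atoms of small mass, so it adds little to \<open>(\<Sum>z. \<nu>\<^sub>z\<^sup>\<theta>)\<close>. This replaces a passage to weak limits of
  \<open>|u|\<^sup>s\<close> and \<open>|\<nabla>u|\<^sup>p\<close>, and shows along the way that \<open>\<Theta>\<close> is finite and at least \<open>1\<close>.

  The local inequality rests on the orthogonal projection of a cap to its tangent hyperplane. In this
  chart the surface measure is \<open>dz / sqrt (1 - |z|\<^sup>2)\<close> (\<open>sphere_measure_half\<close>), and smooth test functions
  on the hyperplane lift to tangent fields that are polynomial in the remaining data and have a simple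
  divergence (\<open>sphere_div_test_field\<close>), so weak gradients on the sphere become weak gradients on
  Euclidean space. There the inequality with constant \<open>S\<close> passes from smooth functions to
  weakly differentiable ones by mollification (\<open>sobolev_inequality_weak\<close>). That the
  supremum defining \<open>S\<close> is over a bounded set is the Gagliardo-Nirenberg-Sobolev inequality, proved here by
  integrating along coordinate lines (\<open>grid_lines_inequality\<close>).
\<close>

section \<open>Smooth functions\<close>

lemma Ck_SucI:
  assumes "\<And>x. (f has_derivative D x) (at x)" "\<And>v. Ck k (\<lambda>x. D x v)"
  shows "Ck (Suc k) f"
proof -
  have "frechet_derivative f (at x) = D x" for x
    using frechet_derivative_at[OF assms(1)] by simp
  then show ?thesis using assms by (auto simp: differentiable_def)
qed

lemma Ck_Suc_has_derivative:
  assumes "Ck (Suc k) f"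
  shows "(f has_derivative frechet_derivative f (at x)) (at x)"
  using assms by (simp add: frechet_derivative_works)

lemma Ck_Suc_imp_Ck: "Ck (Suc k) f \<Longrightarrow> Ck k f"
proof (induction k arbitrary: f)
  case 0
  then show ?case
    by (auto simp: differentiable_imp_continuous_within continuous_on_eq_continuous_within)
qed auto

lemma Ck_const [simp]: "Ck k (\<lambda>x. c)"
proof (induction k arbitrary: c)
  case (Suc k)
  show ?case by (rule Ck_SucI[where D="\<lambda>x v. 0"]) (auto simp: Suc.IH)
qed simp

lemma Ck_bounded_linear: "bounded_linear L \<Longrightarrow> Ck k L"
proof (cases k)
  case (Suc j)
  assume L: "bounded_linear L"
  show ?thesis unfolding Suc
    by (rule Ck_SucI[where D="\<lambda>x. L"]) (auto intro: bounded_linear_imp_has_derivative L)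
qed (simp add: linear_continuous_on)

lemma Ck_add:
  assumes "Ck k f" "Ck k g" shows "Ck k (\<lambda>x. f x + g x)"
  using assms
proof (induction k arbitrary: f g)
  case 0 then show ?case by (auto intro: continuous_intros)
next
  case (Suc k)
  show ?case
  proof (rule Ck_SucI)
    show "((\<lambda>x. f x + g x) has_derivative
        (\<lambda>v. frechet_derivative f (at x) v + frechet_derivative g (at x) v)) (at x)" for x
      using Suc.prems by (intro has_derivative_add Ck_Suc_has_derivative)
  qed (use Suc in auto)
qed

lemma Ck_bilinear:
  assumes b: "bounded_bilinear B" and "Ck k f" "Ck k g"
  shows "Ck k (\<lambda>x. B (f x) (g x))"
  using assms(2,3)
proof (induction k arbitrary: f g)
  case 0 then show ?case by (auto intro: bounded_bilinear.continuous_on[OF b])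
next
  case (Suc k)
  show ?case
  proof (rule Ck_SucI)
    show "((\<lambda>x. B (f x) (g x)) has_derivative
        (\<lambda>v. B (f x) (frechet_derivative g (at x) v) + B (frechet_derivative f (at x) v) (g x)))
        (at x)" for x
      using Suc.prems by (intro bounded_bilinear.FDERIV[OF b] Ck_Suc_has_derivative)
    show "Ck k (\<lambda>x. B (f x) (frechet_derivative g (at x) v) + B (frechet_derivative f (at x) v) (g x))"
      for v
      using Suc Ck_Suc_imp_Ck[OF Suc.prems(1)] Ck_Suc_imp_Ck[OF Suc.prems(2)]
      by (intro Ck_add Suc.IH) auto
  qed
qed

lemmas Ck_mult = Ck_bilinear[OF bounded_bilinear_mult]
lemmas Ck_scaleR = Ck_bilinear[OF bounded_bilinear_scaleR]
lemmas Ck_inner = Ck_bilinear[OF bounded_bilinear_inner]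

lemma Ck_minus: "Ck k f \<Longrightarrow> Ck k (\<lambda>x. - f x)"
  using Ck_scaleR[of k "\<lambda>x. -1" f] by simp

lemma Ck_diff: "Ck k f \<Longrightarrow> Ck k g \<Longrightarrow> Ck k (\<lambda>x. f x - g x)"
  using Ck_add[of k f "\<lambda>x. - g x"] Ck_minus[of k g] by simp

lemma Ck_compose_affine:
  assumes "Ck k f" and L: "bounded_linear L"
  shows "Ck k (\<lambda>x. f (L x + a))"
  using assms(1)
proof (induction k arbitrary: f)
  case 0
  have "continuous_on UNIV (\<lambda>x. L x + a)"
    by (intro continuous_on_add linear_continuous_on L continuous_on_const)
  then show ?case
    using 0 by (auto intro: continuous_on_compose2[of UNIV f])
next
  case (Suc k)
  show ?case
  proof (rule Ck_SucI)
    show "((\<lambda>x. f (L x + a)) has_derivative (\<lambda>v. frechet_derivative f (at (L x + a)) (L v))) (at x)"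
      for x
      by (rule has_derivative_compose[where g=f, OF _ Ck_Suc_has_derivative[OF Suc.prems]])
         (auto intro!: derivative_eq_intros bounded_linear_imp_has_derivative L)
  qed (use Suc in auto)
qed

text \<open>Composition is only proved for a real inner function: its derivative in direction
  \<open>v\<close> is then a product of two functions of the base point. For a vector-valued
  inner function the inner derivative would enter as a direction that moves with the point.\<close>

lemma Ck_compose_real:
  fixes f :: "real \<Rightarrow> 'b::real_normed_vector"
  assumes "Ck k f" "Ck k g"
  shows "Ck k (\<lambda>x. f (g x))"
  using assms
proof (induction k arbitrary: f)
  case 0 then show ?case by (auto intro: continuous_on_compose2[of UNIV f])
next
  case (Suc k)
  have lin: "frechet_derivative f (at t) s = s *\<^sub>R frechet_derivative f (at t) 1" for s t
    using linear_scale[OF has_derivative_linear[OF Ck_Suc_has_derivative[OF Suc.prems(1), of t]], of s 1]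
    by simp
  show ?case
  proof (rule Ck_SucI)
    show "((\<lambda>x. f (g x)) has_derivative
      (\<lambda>v. frechet_derivative g (at x) v *\<^sub>R frechet_derivative f (at (g x)) 1)) (at x)" for x
      using has_derivative_compose[OF Ck_Suc_has_derivative[OF Suc.prems(2)]
              Ck_Suc_has_derivative[OF Suc.prems(1)]]
      by (subst (asm) lin) simp
    show "Ck k (\<lambda>x. frechet_derivative g (at x) v *\<^sub>R frechet_derivative f (at (g x)) 1)" for v
      using Suc.prems Ck_Suc_imp_Ck[OF Suc.prems(2)] by (intro Ck_scaleR Suc.IH) auto
  qed
qed

lemma Ck_inverse:
  fixes f :: "'a::real_normed_vector \<Rightarrow> real"
  assumes "Ck k f" "\<And>x. f x \<noteq> 0"
  shows "Ck k (\<lambda>x. inverse (f x))"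
  using assms(1)
proof (induction k)
  case 0 then show ?case using assms(2) by (auto intro: continuous_intros)
next
  case (Suc k)
  show ?case
  proof (rule Ck_SucI)
    show "((\<lambda>x. inverse (f x)) has_derivative
       (\<lambda>v. - (inverse (f x) * frechet_derivative f (at x) v * inverse (f x)))) (at x)" for x
      using assms(2) by (intro Deriv.has_derivative_inverse Ck_Suc_has_derivative[OF Suc.prems])
    show "Ck k (\<lambda>x. - (inverse (f x) * frechet_derivative f (at x) v * inverse (f x)))" for v
      using Suc Ck_Suc_imp_Ck[OF Suc.prems] by (intro Ck_minus Ck_mult) auto
  qed
qed

lemma smooth_const [simp]: "smooth (\<lambda>x. c)"
  and smooth_bounded_linear: "bounded_linear L \<Longrightarrow> smooth L"
  and smooth_add: "smooth f \<Longrightarrow> smooth g \<Longrightarrow> smooth (\<lambda>x. f x + g x)"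
  and smooth_diff: "smooth f \<Longrightarrow> smooth g \<Longrightarrow> smooth (\<lambda>x. f x - g x)"
  and smooth_scaleR: "smooth a \<Longrightarrow> smooth f \<Longrightarrow> smooth (\<lambda>x. a x *\<^sub>R f x)"
  and smooth_compose_affine: "smooth f \<Longrightarrow> bounded_linear L' \<Longrightarrow> smooth (\<lambda>x. f (L' x + c'))"
  unfolding smooth_def
  by (auto intro: Ck_bounded_linear Ck_add Ck_diff Ck_scaleR Ck_compose_affine)

lemma smooth_mult:
  fixes f :: "'a::real_normed_vector \<Rightarrow> 'b::real_normed_algebra"
  shows "smooth f \<Longrightarrow> smooth g \<Longrightarrow> smooth (\<lambda>x. f x * g x)"
  unfolding smooth_def by (auto intro: Ck_mult)

lemma smooth_inner:
  fixes f :: "'a::real_normed_vector \<Rightarrow> 'b::real_inner"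
  shows "smooth f \<Longrightarrow> smooth g \<Longrightarrow> smooth (\<lambda>x. f x \<bullet> g x)"
  unfolding smooth_def by (auto intro: Ck_inner)

lemma smooth_compose_real:
  fixes f :: "real \<Rightarrow> 'b::real_normed_vector"
  shows "smooth f \<Longrightarrow> smooth g \<Longrightarrow> smooth (\<lambda>x. f (g x))"
  unfolding smooth_def by (auto intro: Ck_compose_real)

lemma smooth_inverse:
  fixes f :: "'a::real_normed_vector \<Rightarrow> real"
  shows "smooth f \<Longrightarrow> (\<And>x. f x \<noteq> 0) \<Longrightarrow> smooth (\<lambda>x. inverse (f x))"
  unfolding smooth_def by (auto intro: Ck_inverse)

lemma smooth_ident: "smooth (\<lambda>x. x)"
  by (rule smooth_bounded_linear) (rule bounded_linear_ident)

lemma smooth_real_polynomial_function: "real_polynomial_function f \<Longrightarrow> smooth f"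
  by (induction rule: real_polynomial_function.induct)
     (auto intro: smooth_bounded_linear smooth_add smooth_mult)

lemma smooth_has_derivative:
  "smooth f \<Longrightarrow> (f has_derivative frechet_derivative f (at x)) (at x)"
  unfolding smooth_def by (metis Ck_Suc_has_derivative)

lemma smooth_frechet_derivative: "smooth f \<Longrightarrow> smooth (\<lambda>x. frechet_derivative f (at x) v)"
  unfolding smooth_def by (metis Ck.simps(2))

lemma smooth_continuous_on: "smooth f \<Longrightarrow> continuous_on A f"
  unfolding smooth_def by (metis Ck.simps(1) continuous_on_subset subset_UNIV)

lemma smooth_borel_measurable [measurable_dest]:
  fixes f :: "'a::euclidean_space \<Rightarrow> 'b::euclidean_space"
  shows "smooth f \<Longrightarrow> f \<in> borel_measurable borel"
  by (intro borel_measurable_continuous_onI smooth_continuous_on)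

text \<open>The family \<open>t\<^sup>-\<^sup>k e\<^sup>-\<^sup>1\<^sup>/\<^sup>t\<close>, extended by
  \<open>0\<close>. Carrying the power \<open>k\<close> makes the family closed under
  differentiation up to linear combinations, so smoothness of all members follows by one
  induction.\<close>

definition flat_exp :: "nat \<Rightarrow> real \<Rightarrow> real" where
  "flat_exp k t = (if t > 0 then (1 / t) ^ k * exp (- (1 / t)) else 0)"

lemma flat_exp_has_derivative:
  "(flat_exp k has_real_derivative (flat_exp (k + 2) t - real k * flat_exp (k + 1) t)) (at t)"
proof (cases t "0::real" rule: linorder_cases)
  case less
  have ev: "eventually (\<lambda>s. flat_exp k s = 0) (nhds t)"
    using eventually_nhds_in_open[of "{..<0}" t] less
    by (auto simp: flat_exp_def elim!: eventually_mono)
  have "((\<lambda>s. 0) has_real_derivative 0) (at t)" by simp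
  then show ?thesis
    using DERIV_cong_ev[OF refl ev refl, of 0] less by (auto simp: flat_exp_def[of _ t])
next
  case greater
  have ev: "eventually (\<lambda>s. flat_exp k s = (1 / s) ^ k * exp (- (1 / s))) (nhds t)"
    using eventually_nhds_in_open[of "{0<..}" t] greater
    by (auto simp: flat_exp_def elim!: eventually_mono)
  have "((\<lambda>s. (1 / s) ^ k * exp (- (1 / s))) has_real_derivative
      (flat_exp (k + 2) t - real k * flat_exp (k + 1) t)) (at t)"
    using greater
    apply (auto intro!: derivative_eq_intros simp: flat_exp_def field_simps power2_eq_square)
    apply (cases k)
     apply (auto simp: field_simps)
    done
  then show ?thesis using DERIV_cong_ev[OF refl ev refl] by blast
next
  case equal
  have *: "((\<lambda>h. (flat_exp k h - flat_exp k 0) / (h - 0)) \<longlongrightarrow> 0) (at_right 0)"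
  proof -
    have "((\<lambda>x::real. x ^ (k + 1) / exp x) \<longlongrightarrow> 0) at_top"
      by (rule tendsto_power_div_exp_0)
    then have "((\<lambda>h::real. inverse h ^ (k + 1) / exp (inverse h)) \<longlongrightarrow> 0) (at_right 0)"
      by (rule filterlim_compose[OF _ filterlim_inverse_at_top_right])
    then show ?thesis
      by (rule Lim_transform_eventually)
         (auto simp: eventually_at_right_less flat_exp_def exp_minus field_simps
               intro!: eventually_at_rightI[of 0 1])
  qed
  have "((\<lambda>h. (flat_exp k h - flat_exp k 0) / (h - 0)) \<longlongrightarrow> 0) (at_left 0)"
    by (rule Lim_transform_eventually[OF tendsto_const])
       (auto simp: flat_exp_def intro!: eventually_at_leftI[of "-1"])
  with * have "((\<lambda>h. (flat_exp k h - flat_exp k 0) / (h - 0)) \<longlongrightarrow> 0) (at 0)"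
    by (simp add: filterlim_split_at)
  then show ?thesis unfolding equal
    by (simp add: has_field_derivative_iff flat_exp_def)
qed

lemma smooth_flat_exp: "smooth (flat_exp k)"
  unfolding smooth_def
proof
  fix n show "Ck n (flat_exp k)"
  proof (induction n arbitrary: k)
    case 0
    show ?case
      using flat_exp_has_derivative by (auto intro!: DERIV_continuous_on)
  next
    case (Suc n)
    show ?case
    proof (rule Ck_SucI)
      show "(flat_exp k has_derivative (\<lambda>v. (flat_exp (k + 2) t - real k * flat_exp (k + 1) t) * v)) (at t)"
        for t
        using flat_exp_has_derivative[of k t] by (simp add: has_field_derivative_def)
      show "Ck n (\<lambda>t. (flat_exp (k + 2) t - real k * flat_exp (k + 1) t) * v)" for v
        by (intro Ck_mult Ck_diff Suc.IH Ck_const)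
    qed
  qed
qed

lemma flat_exp_0_pos_iff: "flat_exp 0 t > 0 \<longleftrightarrow> t > 0"
  and flat_exp_nonneg: "flat_exp k t \<ge> 0"
  and flat_exp_0_eq_0_iff: "flat_exp 0 t = 0 \<longleftrightarrow> t \<le> 0"
  by (auto simp: flat_exp_def)

definition smooth_step :: "real \<Rightarrow> real" where
  "smooth_step t = flat_exp 0 (1 - t) * inverse (flat_exp 0 t + flat_exp 0 (1 - t))"

lemma smooth_smooth_step: "smooth smooth_step"
proof -
  have 1: "smooth (\<lambda>t. flat_exp 0 (1 - t))"
    by (intro smooth_compose_real[OF smooth_flat_exp] smooth_diff smooth_const smooth_ident)
  have "flat_exp 0 t + flat_exp 0 (1 - t) \<noteq> 0" for t
    using flat_exp_nonneg[of 0 t] flat_exp_nonneg[of 0 "1 - t"]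
      flat_exp_0_pos_iff[of t] flat_exp_0_pos_iff[of "1 - t"] by linarith
  then show ?thesis
    unfolding smooth_step_def[abs_def]
    by (intro smooth_mult 1 smooth_inverse smooth_add smooth_flat_exp)
qed

lemma smooth_step_eq_1: "t \<le> 0 \<Longrightarrow> smooth_step t = 1"
  and smooth_step_eq_0: "t \<ge> 1 \<Longrightarrow> smooth_step t = 0"
  and smooth_step_nonneg: "smooth_step t \<ge> 0"
  and smooth_step_le_1: "smooth_step t \<le> 1"
proof -
  show "t \<le> 0 \<Longrightarrow> smooth_step t = 1" "t \<ge> 1 \<Longrightarrow> smooth_step t = 0" "smooth_step t \<ge> 0"
    by (auto simp: smooth_step_def flat_exp_def)
  show "smooth_step t \<le> 1"
    using flat_exp_nonneg[of 0 t] flat_exp_nonneg[of 0 "1 - t"]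
    by (simp add: smooth_step_def divide_inverse[symmetric] divide_le_eq_1) linarith
qed

section \<open>Hoelder inequalities for several functions\<close>

text \<open>Real powers on \<^typ>\<open>ennreal\<close> with \<open>x\<^sup>0 = 1\<close>, including
  \<open>0\<^sup>0 = 1\<close> (where \<open>powr\<close> gives \<open>0\<close>): a factor with
  exponent \<open>0\<close> has to disappear from the products below.\<close>

definition epow :: "ennreal \<Rightarrow> real \<Rightarrow> ennreal" where
  "epow x a = (if a = 0 then 1 else if x = \<infinity> then \<infinity> else ennreal (enn2real x powr a))"

lemma epow_0 [simp]: "epow x 0 = 1"
  by (simp add: epow_def)

lemma epow_1 [simp]: "epow x 1 = x"
  by (cases x) (auto simp: epow_def)

lemma epow_ennreal: "0 \<le> x \<Longrightarrow> a \<noteq> 0 \<Longrightarrow> epow (ennreal x) a = ennreal (x powr a)"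
  by (simp add: epow_def)

lemma epow_zero: "a \<noteq> 0 \<Longrightarrow> epow 0 a = 0"
  by (simp add: epow_def)

lemma epow_measurable [measurable]: "f \<in> borel_measurable M \<Longrightarrow> (\<lambda>x. epow (f x) a) \<in> borel_measurable M"
  by (cases "a = 0") (simp_all add: epow_def)

lemma epow_add: "0 \<le> a \<Longrightarrow> 0 \<le> b \<Longrightarrow> epow x (a + b) = epow x a * epow x b"
  by (cases x) (auto simp: epow_def powr_add ennreal_mult ennreal_top_mult ennreal_mult_top)

lemma epow_of_nat_mult: "0 \<le> a \<Longrightarrow> epow x (real k * a) = epow x a ^ k"
  by (induction k) (auto simp: algebra_simps epow_add)

lemma epow_mult: "0 \<le> a \<Longrightarrow> epow (x * y) a = epow x a * epow y a"
  by (cases x; cases y)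
     (auto simp: epow_def powr_mult ennreal_mult ennreal_top_mult ennreal_mult_top
       enn2real_mult ennreal_mult_eq_top_iff)

lemma epow_mono: "0 \<le> a \<Longrightarrow> x \<le> y \<Longrightarrow> epow x a \<le> epow y a"
  by (cases x; cases y) (auto simp: epow_def powr_mono2 ennreal_le_iff2 top_unique)

lemma weighted_AM_GM:
  fixes l x :: "'i \<Rightarrow> real"
  assumes "finite I" "\<And>i. i \<in> I \<Longrightarrow> 0 < l i" "(\<Sum>i\<in>I. l i) = 1" "\<And>i. i \<in> I \<Longrightarrow> 0 \<le> x i"
  shows "(\<Prod>i\<in>I. x i powr l i) \<le> (\<Sum>i\<in>I. l i * x i)"
proof (cases "\<exists>i\<in>I. x i = 0")
  case True
  then have "(\<Prod>i\<in>I. x i powr l i) = 0"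
    using assms(1) by (auto intro!: prod_zero)
  moreover have "0 \<le> (\<Sum>i\<in>I. l i * x i)"
    using assms by (intro sum_nonneg mult_nonneg_nonneg) (auto simp: less_imp_le)
  ultimately show ?thesis by linarith
next
  case False
  then have pos: "x i > 0" if "i \<in> I" for i using assms(4)[OF that] that by force
  have ne: "I \<noteq> {}" using assms(3) by auto
  have "(\<Sum>i\<in>I. l i * ln (x i)) \<le> ln (\<Sum>i\<in>I. l i *\<^sub>R x i)"
    using concave_on_sum[OF assms(1) ne ln_concave, of l x] assms(2,3) pos
    by (auto simp: less_imp_le)
  moreover have "(\<Sum>i\<in>I. l i * x i) > 0"
    using assms(1,2) ne pos by (intro sum_pos) auto
  ultimately have "exp (\<Sum>i\<in>I. l i * ln (x i)) \<le> (\<Sum>i\<in>I. l i * x i)"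
    by (simp add: ln_ge_iff)
  also have "exp (\<Sum>i\<in>I. l i * ln (x i)) = (\<Prod>i\<in>I. x i powr l i)"
  proof -
    have "x i powr l i = exp (l i * ln (x i))" if "i \<in> I" for i
      using pos[OF that] by (simp add: powr_def)
    then show ?thesis using assms(1) by (simp add: exp_sum)
  qed
  finally show ?thesis .
qed

lemma weighted_AM_GM_ennreal:
  fixes x :: "'i \<Rightarrow> ennreal"
  assumes "finite I" "\<And>i. i \<in> I \<Longrightarrow> 0 < l i" "(\<Sum>i\<in>I. l i) = 1"
  shows "(\<Prod>i\<in>I. epow (x i) (l i)) \<le> (\<Sum>i\<in>I. ennreal (l i) * x i)"
proof (cases "\<exists>i\<in>I. x i = \<infinity>")
  case True
  then have "(\<Sum>i\<in>I. ennreal (l i) * x i) = \<infinity>"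
    using assms(1,2) by (force simp: ennreal_mult_top)
  then show ?thesis by (simp add: top_unique)
next
  case False
  then have *: "x i = ennreal (enn2real (x i))" if "i \<in> I" for i
    using that by (cases "x i") auto
  have "(\<Prod>i\<in>I. epow (x i) (l i)) = (\<Prod>i\<in>I. ennreal (enn2real (x i) powr l i))"
  proof (rule prod.cong[OF refl])
    fix i assume "i \<in> I"
    with False assms(2)[of i] show "epow (x i) (l i) = ennreal (enn2real (x i) powr l i)"
      by (simp add: epow_def)
  qed
  also have "\<dots> = ennreal (\<Prod>i\<in>I. enn2real (x i) powr l i)"
    by (rule prod_ennreal) auto
  also have "\<dots> \<le> ennreal (\<Sum>i\<in>I. l i * enn2real (x i))"
    using assms by (intro ennreal_leI weighted_AM_GM) auto
  also have "\<dots> = (\<Sum>i\<in>I. ennreal (l i * enn2real (x i)))"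
    using assms by (intro sum_ennreal[symmetric]) (auto simp: less_imp_le)
  also have "\<dots> = (\<Sum>i\<in>I. ennreal (l i) * x i)"
    using assms(2) * by (intro sum.cong) (auto simp: ennreal_mult less_imp_le)
  finally show ?thesis .
qed

text \<open>After normalising each \<open>f i\<close> to integral \<open>1\<close>, the weighted
  inequality between the arithmetic and the geometric mean holds pointwise and can be
  integrated. Factors of exponent \<open>0\<close> and vanishing or infinite integrals are split
  off before.\<close>

lemma nn_integral_Holder:
  fixes f :: "'i \<Rightarrow> 'a \<Rightarrow> ennreal"
  assumes fin: "finite I" and l: "\<And>i. i \<in> I \<Longrightarrow> 0 \<le> l i" "(\<Sum>i\<in>I. l i) = 1"
    and f [measurable]: "\<And>i. i \<in> I \<Longrightarrow> f i \<in> borel_measurable M"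
  shows "(\<integral>\<^sup>+x. (\<Prod>i\<in>I. epow (f i x) (l i)) \<partial>M) \<le> (\<Prod>i\<in>I. epow (\<integral>\<^sup>+x. f i x \<partial>M) (l i))"
proof -
  define J where "J = {i\<in>I. l i \<noteq> 0}"
  have J12: "finite J" "J \<subseteq> I"
    using fin by (auto simp: J_def)
  have J3: "0 < l i" if "i \<in> J" for i
    using that l(1)[of i] by (simp add: J_def)
  note J = J12 J3
  have sumJ: "(\<Sum>i\<in>J. l i) = 1"
    using sum.mono_neutral_right[OF fin J(2), of l] l(2) by (simp add: J_def)
  have prodJ: "(\<Prod>i\<in>I. epow (x i) (l i)) = (\<Prod>i\<in>J. epow (x i) (l i))" for x
    by (rule prod.mono_neutral_right[OF fin J(2)]) (simp add: J_def)
  define A where "A i = (\<integral>\<^sup>+x. f i x \<partial>M)" for i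
  have meas: "\<And>i. i \<in> J \<Longrightarrow> f i \<in> borel_measurable M" using f J by auto
  show ?thesis
  proof (cases "\<exists>i\<in>J. A i = 0")
    case True
    then obtain i where i: "i \<in> J" "A i = 0" by auto
    then have "AE x in M. f i x = 0"
      using meas by (auto simp: A_def nn_integral_0_iff_AE)
    moreover have "epow 0 (l i) = 0"
      using J3[OF i(1)] by (simp add: epow_zero)
    ultimately have "AE x in M. (\<Prod>i\<in>J. epow (f i x) (l i)) = 0"
      by (auto elim!: eventually_mono intro!: prod_zero J12(1) bexI[OF _ i(1)])
    then have "(\<integral>\<^sup>+x. (\<Prod>i\<in>J. epow (f i x) (l i)) \<partial>M) = (\<integral>\<^sup>+x. 0 \<partial>M)"
      by (rule nn_integral_cong_AE)
    then show ?thesis by (simp add: prodJ)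
  next
    case no0: False
    have nz: "epow (A i) (l i) \<noteq> 0" if "i \<in> J" for i
      using no0 that J(3)[OF that] by (cases "A i") (auto simp: epow_def)
    show ?thesis
    proof (cases "\<exists>i\<in>J. A i = \<infinity>")
      case True
      then obtain i where i: "i \<in> J" "A i = \<infinity>" by auto
      have "epow (A i) (l i) = \<infinity>" using i J(3)[of i] by (simp add: epow_def)
      then have "(\<Prod>i\<in>J. epow (A i) (l i)) = \<infinity>"
        using i nz J(1) by (auto simp: ennreal_prod_eq_top intro!: bexI[OF _ i(1)])
      then show ?thesis
        by (simp add: prodJ A_def top_unique)
    next
      case False
      have A: "A i = ennreal (enn2real (A i))" "enn2real (A i) > 0" if "i \<in> J" for i
        using no0 False that by (cases "A i"; force)+
      define g where "g i x = ennreal (inverse (enn2real (A i))) * f i x" for i x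
      have inv: "A i * ennreal (inverse (enn2real (A i))) = 1" if i: "i \<in> J" for i
      proof -
        obtain a where a: "A i = ennreal a" "a > 0"
          using A[OF i] by blast
        then show ?thesis by (simp add: ennreal_mult[symmetric])
      qed
      have fg: "f i x = A i * g i x" if "i \<in> J" for i x
        using inv[OF that] by (simp only: g_def mult.assoc[symmetric] mult_1)
      have [measurable]: "g i \<in> borel_measurable M" if "i \<in> J" for i
        unfolding g_def using meas[OF that] by measurable
      have gint: "(\<integral>\<^sup>+x. g i x \<partial>M) = 1" if "i \<in> J" for i
      proof -
        have "(\<integral>\<^sup>+x. g i x \<partial>M) = ennreal (inverse (enn2real (A i))) * A i"
          unfolding g_def A_def using meas[OF that] by (simp add: nn_integral_cmult)
        also have "\<dots> = 1"
          using inv[OF that] by (simp only: mult.commute)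
        finally show ?thesis .
      qed
      have "(\<integral>\<^sup>+x. (\<Prod>i\<in>J. epow (f i x) (l i)) \<partial>M)
          = (\<integral>\<^sup>+x. (\<Prod>i\<in>J. epow (A i) (l i)) * (\<Prod>i\<in>J. epow (g i x) (l i)) \<partial>M)"
        using J(3) by (intro nn_integral_cong)
          (auto simp: fg epow_mult less_imp_le prod.distrib cong: prod.cong)
      also have "\<dots> \<le> (\<integral>\<^sup>+x. (\<Prod>i\<in>J. epow (A i) (l i)) * (\<Sum>i\<in>J. ennreal (l i) * g i x) \<partial>M)"
        using J sumJ by (intro nn_integral_mono mult_left_mono weighted_AM_GM_ennreal) auto
      also have "\<dots> = (\<Prod>i\<in>J. epow (A i) (l i)) * (\<Sum>i\<in>J. ennreal (l i) * (\<integral>\<^sup>+x. g i x \<partial>M))"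
        by (simp add: nn_integral_cmult nn_integral_sum)
      also have "(\<Sum>i\<in>J. ennreal (l i) * (\<integral>\<^sup>+x. g i x \<partial>M)) = (\<Sum>i\<in>J. ennreal (l i))"
        by (simp add: gint)
      also have "\<dots> = 1"
        using J(3) sumJ by (subst sum_ennreal) (auto simp: less_imp_le)
      finally show ?thesis by (simp add: prodJ A_def)
    qed
  qed
qed

text \<open>A strengthening of the Loomis-Whitney inequality for a single function, in the form that
  admits induction over the set of coordinates. In the step for a new coordinate
  \<open>j\<close>, the line integral in direction \<open>j\<close> is constant along
  \<open>j\<close>; Hoelder in the variable \<open>j\<close> for the remaining factors, whose
  exponents sum to \<open>1\<close>, leaves the same expression for the function integrated over
  \<open>j\<close>, with one coordinate fewer. For \<open>q = 1 / (n - 1)\<close> in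
  \<open>n\<close> coordinates the first factor disappears.\<close>

lemma grid_lines_inequality:
  fixes f :: "('i \<Rightarrow> real) \<Rightarrow> ennreal"
  assumes "finite I" "0 \<le> q" "(real (card I) - 1) * q \<le> 1"
    and "f \<in> borel_measurable (Pi\<^sub>M I (\<lambda>_. lborel))"
  shows "(\<integral>\<^sup>+x. epow (f x) (1 - (real (card I) - 1) * q)
            * (\<Prod>i\<in>I. epow (\<integral>\<^sup>+t. f (x(i := t)) \<partial>lborel) q) \<partial>Pi\<^sub>M I (\<lambda>_. lborel))
         \<le> epow (\<integral>\<^sup>+x. f x \<partial>Pi\<^sub>M I (\<lambda>_. lborel)) (1 + q)"
  using assms
proof (induction I arbitrary: f rule: finite_induct)
  case empty
  interpret product_sigma_finite "\<lambda>_::'i. lborel :: real measure" ..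
  show ?case by (simp add: nn_integral_empty)
next
  case (insert j I)
  interpret product_sigma_finite "\<lambda>_::'i. lborel :: real measure" ..
  note f [measurable] = insert.prems(3)
  define k where "k = real (card I)"
  have card: "real (card (insert j I)) - 1 = k"
    using insert by (simp add: k_def)
  have kq: "k * q \<le> 1" using insert.prems card by simp
  have upd [measurable]: "(\<lambda>(x, t). x(i := t)) \<in> Pi\<^sub>M I (\<lambda>_. lborel) \<Otimes>\<^sub>M lborel \<rightarrow>\<^sub>M Pi\<^sub>M (insert i I) (\<lambda>_. lborel :: real measure)" for i I
    by (rule measurable_PiM_single') (auto simp: space_pair_measure space_PiM PiE_def extensional_def)
  define F where "F x = (\<integral>\<^sup>+t. f (x(j := t)) \<partial>lborel)" for x
  have fj: "(\<lambda>(x, t). f (x(j := t))) \<in> borel_measurable (Pi\<^sub>M I (\<lambda>_. lborel) \<Otimes>\<^sub>M lborel)"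
    using measurable_comp[OF upd f] by (simp add: comp_def split_beta')
  have F [measurable]: "F \<in> borel_measurable (Pi\<^sub>M I (\<lambda>_. lborel))"
    unfolding F_def using fj by measurable
  have lines: "(\<lambda>x. \<integral>\<^sup>+s. f (x(i := s)) \<partial>lborel) \<in> borel_measurable (Pi\<^sub>M (insert j I) (\<lambda>_. lborel))"
    if "i \<in> insert j I" for i
  proof -
    have "(\<lambda>(x, t). f (x(i := t))) \<in> borel_measurable (Pi\<^sub>M (insert j I) (\<lambda>_. lborel) \<Otimes>\<^sub>M lborel)"
      using measurable_comp[OF upd[of i "insert j I", unfolded insert_absorb[OF that]] f]
      by (simp add: comp_def split_beta')
    then show ?thesis by measurable
  qed
  have upd1: "(\<lambda>t. x(j := t)) \<in> lborel \<rightarrow>\<^sub>M Pi\<^sub>M (insert j I) (\<lambda>_. lborel :: real measure)"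
    if "x \<in> space (Pi\<^sub>M I (\<lambda>_. lborel))" for x
    using that by (intro measurable_PiM_single') (auto simp: space_PiM PiE_def extensional_def)
  let ?l = "\<lambda>i. if i = j then 1 - k * q else q"
  let ?g = "\<lambda>x i t. if i = j then f (x(j := t)) else (\<integral>\<^sup>+s. f (x(j := t, i := s)) \<partial>lborel)"
  have line_meas: "?g x i \<in> borel_measurable lborel"
    if x: "x \<in> space (Pi\<^sub>M I (\<lambda>_. lborel))" and i: "i \<in> insert j I" for x i
  proof (cases "i = j")
    case True
    have "(\<lambda>t. f (x(j := t))) \<in> borel_measurable lborel"
      by (rule measurable_compose[OF upd1[OF x] f])
    with True show ?thesis by (simp only: if_True simp_thms)
  next
    case False
    have "(\<lambda>t. \<integral>\<^sup>+s. f (x(j := t, i := s)) \<partial>lborel) \<in> borel_measurable lborel"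
      by (rule measurable_compose[OF upd1[OF x] lines[OF i]])
    with False show ?thesis by (simp only: if_False)
  qed
  \<comment> \<open>Hoelder in the new variable: the exponents are 1 - k q once and q for each of the k old
      coordinates.\<close>
  have inner: "(\<integral>\<^sup>+t. (\<Prod>i\<in>insert j I. epow (?g x i t) (?l i)) \<partial>lborel)
      \<le> epow (F x) (1 - k * q) * (\<Prod>i\<in>I. epow (\<integral>\<^sup>+s. F (x(i := s)) \<partial>lborel) q)"
    if x: "x \<in> space (Pi\<^sub>M I (\<lambda>_. lborel))" for x
  proof -
    have m: "?g x i \<in> borel_measurable lborel" if "i \<in> insert j I" for i
      by (rule line_meas[OF x that])
    have "(\<Sum>i\<in>insert j I. ?l i) = (1 - k * q) + (\<Sum>i\<in>I. q)"
    proof -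
      have "(\<Sum>i\<in>I. ?l i) = (\<Sum>i\<in>I. q)"
        using insert(2) by (intro sum.cong) auto
      then show ?thesis using insert(1,2) by simp
    qed
    then have l1: "(\<Sum>i\<in>insert j I. ?l i) = 1"
      by (simp add: k_def)
    have l0: "0 \<le> ?l i" for i
      using kq insert.prems(1) by simp
    have "(\<integral>\<^sup>+t. (\<Prod>i\<in>insert j I. epow (?g x i t) (?l i)) \<partial>lborel)
        \<le> (\<Prod>i\<in>insert j I. epow (\<integral>\<^sup>+t. ?g x i t \<partial>lborel) (?l i))"
      by (rule nn_integral_Holder[OF _ l0 l1 m]) (simp add: insert(1))
    also have "\<dots> = epow (F x) (1 - k * q) *
        (\<Prod>i\<in>I. epow (\<integral>\<^sup>+t. \<integral>\<^sup>+s. f (x(j := t, i := s)) \<partial>lborel \<partial>lborel) q)"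
    proof -
      have "(\<Prod>i\<in>I. epow (\<integral>\<^sup>+t. ?g x i t \<partial>lborel) (?l i))
          = (\<Prod>i\<in>I. epow (\<integral>\<^sup>+t. \<integral>\<^sup>+s. f (x(j := t, i := s)) \<partial>lborel \<partial>lborel) q)"
        using insert(2) by (intro prod.cong) auto
      then show ?thesis
        by (simp only: prod.insert[OF insert(1,2)] if_True F_def simp_thms)
    qed
    also have "(\<Prod>i\<in>I. epow (\<integral>\<^sup>+t. \<integral>\<^sup>+s. f (x(j := t, i := s)) \<partial>lborel \<partial>lborel) q)
       = (\<Prod>i\<in>I. epow (\<integral>\<^sup>+s. F (x(i := s)) \<partial>lborel) q)"
    proof (rule prod.cong[OF refl])
      fix i assume i: "i \<in> I"
      have "(\<lambda>p. (x(j := fst p))(i := snd p)) \<in> lborel \<Otimes>\<^sub>M lborel \<rightarrow>\<^sub>M Pi\<^sub>M (insert j I) (\<lambda>_. lborel :: real measure)"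
      proof (rule measurable_PiM_single')
        fix l assume "l \<in> insert j I"
        show "(\<lambda>p. ((x(j := fst p))(i := snd p)) l) \<in> lborel \<Otimes>\<^sub>M lborel \<rightarrow>\<^sub>M lborel"
          by (cases "l = i"; cases "l = j") simp_all
      qed (use x i in \<open>auto simp: space_PiM PiE_def extensional_def\<close>)
      from measurable_compose[OF this f]
      have m2: "(\<lambda>(t, s). f (x(j := t, i := s))) \<in> borel_measurable (lborel \<Otimes>\<^sub>M lborel)"
        by (simp only: split_beta')
      have "(\<integral>\<^sup>+t. \<integral>\<^sup>+s. f (x(j := t, i := s)) \<partial>lborel \<partial>lborel)
          = (\<integral>\<^sup>+s. \<integral>\<^sup>+t. f (x(j := t, i := s)) \<partial>lborel \<partial>lborel)"
        by (rule lborel_pair.Fubini'[OF m2, symmetric])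
      also have "\<dots> = (\<integral>\<^sup>+s. F (x(i := s)) \<partial>lborel)"
      proof -
        have "i \<noteq> j" using i insert(2) by blast
        then have "x(j := t, i := s) = x(i := s, j := t)" for t s
          by (intro fun_upd_twist) simp
        then show ?thesis by (simp only: F_def)
      qed
      finally show "epow (\<integral>\<^sup>+t. \<integral>\<^sup>+s. f (x(j := t, i := s)) \<partial>lborel \<partial>lborel) q
         = epow (\<integral>\<^sup>+s. F (x(i := s)) \<partial>lborel) q" by simp
    qed
    finally show ?thesis .
  qed
  have "(\<integral>\<^sup>+x. epow (f x) (1 - (real (card (insert j I)) - 1) * q)
            * (\<Prod>i\<in>insert j I. epow (\<integral>\<^sup>+t. f (x(i := t)) \<partial>lborel) q) \<partial>Pi\<^sub>M (insert j I) (\<lambda>_. lborel))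
      = (\<integral>\<^sup>+x. \<integral>\<^sup>+t. epow (f (x(j := t))) (1 - k * q)
            * (\<Prod>i\<in>insert j I. epow (\<integral>\<^sup>+s. f (x(j := t, i := s)) \<partial>lborel) q) \<partial>lborel \<partial>Pi\<^sub>M I (\<lambda>_. lborel))"
    unfolding card 
    by (rule product_nn_integral_insert[OF insert(1,2)])
      (intro borel_measurable_times_ennreal borel_measurable_prod_ennreal epow_measurable f lines)
  also have "\<dots> = (\<integral>\<^sup>+x. \<integral>\<^sup>+t. epow (F x) q * (\<Prod>i\<in>insert j I. epow (?g x i t) (?l i)) \<partial>lborel \<partial>Pi\<^sub>M I (\<lambda>_. lborel))"
  proof (intro nn_integral_cong)
    fix x and t :: real
    have "(\<Prod>i\<in>I. epow (\<integral>\<^sup>+s. f (x(j := t, i := s)) \<partial>lborel) q) = (\<Prod>i\<in>I. epow (?g x i t) (?l i))"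
      using insert(2) by (intro prod.cong) auto
    moreover have "(\<integral>\<^sup>+s. f (x(j := t, j := s)) \<partial>lborel) = F x"
      by (simp only: F_def fun_upd_upd)
    ultimately show "epow (f (x(j := t))) (1 - k * q)
            * (\<Prod>i\<in>insert j I. epow (\<integral>\<^sup>+s. f (x(j := t, i := s)) \<partial>lborel) q)
      = epow (F x) q * (\<Prod>i\<in>insert j I. epow (?g x i t) (?l i))"
      by (simp only: prod.insert[OF insert(1,2)] if_True mult.left_commute simp_thms)
  qed
  also have "\<dots> = (\<integral>\<^sup>+x. epow (F x) q * (\<integral>\<^sup>+t. (\<Prod>i\<in>insert j I. epow (?g x i t) (?l i)) \<partial>lborel) \<partial>Pi\<^sub>M I (\<lambda>_. lborel))"
  proof (intro nn_integral_cong nn_integral_cmult)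
    fix x assume x: "x \<in> space (Pi\<^sub>M I (\<lambda>_. lborel :: real measure))"
    show "(\<lambda>t. \<Prod>i\<in>insert j I. epow (?g x i t) (?l i)) \<in> borel_measurable lborel"
      by (rule borel_measurable_prod_ennreal, rule epow_measurable, rule line_meas[OF x])
  qed
  also have "\<dots> \<le> (\<integral>\<^sup>+x. epow (F x) q * (epow (F x) (1 - k * q) * (\<Prod>i\<in>I. epow (\<integral>\<^sup>+s. F (x(i := s)) \<partial>lborel) q)) \<partial>Pi\<^sub>M I (\<lambda>_. lborel))"
    by (rule nn_integral_mono, rule mult_left_mono, rule inner) simp_all
  also have "\<dots> = (\<integral>\<^sup>+x. epow (F x) (1 - (k - 1) * q) * (\<Prod>i\<in>I. epow (\<integral>\<^sup>+s. F (x(i := s)) \<partial>lborel) q) \<partial>Pi\<^sub>M I (\<lambda>_. lborel))"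
  proof -
    have "epow y q * epow y (1 - k * q) = epow y (1 - (k - 1) * q)" for y
    proof -
      have "1 - (k - 1) * q = q + (1 - k * q)" by (simp add: left_diff_distrib)
      then show ?thesis using insert.prems(1) kq by (simp only: epow_add diff_ge_0_iff_ge)
    qed
    then show ?thesis by (simp only: mult.assoc[symmetric])
  qed
  also have "\<dots> \<le> epow (\<integral>\<^sup>+x. F x \<partial>Pi\<^sub>M I (\<lambda>_. lborel)) (1 + q)"
    unfolding k_def
  proof (rule insert.IH[OF insert.prems(1) _ F])
    show "(real (card I) - 1) * q \<le> 1"
      using kq insert.prems(1) by (simp add: k_def left_diff_distrib)
  qed
  also have "(\<integral>\<^sup>+x. F x \<partial>Pi\<^sub>M I (\<lambda>_. lborel)) = (\<integral>\<^sup>+x. f x \<partial>Pi\<^sub>M (insert j I) (\<lambda>_. lborel))"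
    unfolding F_def by (rule product_nn_integral_insert[OF insert(1,2) f, symmetric])
  finally show ?case .
qed

section \<open>The Sobolev inequality for smooth functions on Euclidean space\<close>

text \<open>A function that is bounded at every point by the integral of \<open>F\<close> over each
  coordinate line through the point lies in the Lebesgue space with exponent \<open>n / (n -
  1)\<close>, like a function with gradient \<open>F\<close>: write its power as the product
  over the coordinates and use the inequality for grid lines.\<close>

lemma gagliardo_nirenberg_lines:
  fixes \<phi> F :: "'a::euclidean_space \<Rightarrow> ennreal"
  defines "n \<equiv> real DIM('a)"
  assumes n: "DIM('a) \<ge> 2" and [measurable]: "F \<in> borel_measurable borel" "\<phi> \<in> borel_measurable borel"
    and le: "\<And>x b. b \<in> Basis \<Longrightarrow> \<phi> x \<le> (\<integral>\<^sup>+t. F (x + (t - x \<bullet> b) *\<^sub>R b) \<partial>lborel)"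
  shows "(\<integral>\<^sup>+x. epow (\<phi> x) (n / (n - 1)) \<partial>lborel) \<le> epow (\<integral>\<^sup>+x. F x \<partial>lborel) (n / (n - 1))"
proof -
  let ?P = "Pi\<^sub>M (Basis::'a set) (\<lambda>_. lborel :: real measure)"
  define e where "e f = (\<Sum>b\<in>Basis. f b *\<^sub>R b)" for f :: "'a \<Rightarrow> real"
  define q where "q = 1 / (n - 1)"
  have n2: "n \<ge> 2" using n by (simp add: n_def)
  have q: "0 \<le> q" "(n - 1) * q = 1" "1 + q = n / (n - 1)" "n * q = n / (n - 1)"
  proof -
    have a: "n - 1 > 0" using n2 by linarith
    show "0 \<le> q" unfolding q_def using a by (intro divide_nonneg_pos) auto
    show "(n - 1) * q = 1" unfolding q_def using a by simp
    show "n * q = n / (n - 1)" unfolding q_def by simp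
    show "1 + q = n / (n - 1)" unfolding q_def using a by (subst add_divide_eq_iff) auto
  qed
  have [measurable]: "e \<in> ?P \<rightarrow>\<^sub>M borel"
    unfolding e_def
  proof (intro borel_measurable_sum borel_measurable_scaleR borel_measurable_const)
    fix b :: 'a assume "b \<in> Basis"
    then have "(\<lambda>f. f b) \<in> ?P \<rightarrow>\<^sub>M (lborel :: real measure)"
      by (rule measurable_component_singleton)
    then show "(\<lambda>f. f b) \<in> borel_measurable ?P" by simp
  qed
  have ef: "e f \<bullet> b = f b" if "b \<in> Basis" for f b
    using that unfolding e_def by (rule inner_sum_left_Basis)
  have upd: "e (f(b := t)) = e f + (t - e f \<bullet> b) *\<^sub>R b" if "b \<in> Basis" for f b t
  proof (rule euclidean_eqI)
    fix c :: 'a assume "c \<in> Basis"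
    then show "e (f(b := t)) \<bullet> c = (e f + (t - e f \<bullet> b) *\<^sub>R b) \<bullet> c"
      using that by (simp add: ef inner_add_left inner_Basis)
  qed
  have lb: "lborel = distr ?P borel e"
    unfolding e_def by (rule lborel_eq)
  have "(\<integral>\<^sup>+x. epow (\<phi> x) (n / (n - 1)) \<partial>lborel) = (\<integral>\<^sup>+f. epow (\<phi> (e f)) (n / (n - 1)) \<partial>?P)"
    by (subst lb) (simp add: nn_integral_distr)
  also have "\<dots> = (\<integral>\<^sup>+f. (\<Prod>b\<in>(Basis::'a set). epow (\<phi> (e f)) q) \<partial>?P)"
    using epow_of_nat_mult[OF q(1), of _ "DIM('a)"] by (simp add: n_def[symmetric] q(4))
  also have "\<dots> \<le> (\<integral>\<^sup>+f. (\<Prod>b\<in>(Basis::'a set). epow (\<integral>\<^sup>+t. F (e (f(b := t))) \<partial>lborel) q) \<partial>?P)"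
    by (intro nn_integral_mono prod_mono_ennreal epow_mono q) (simp add: upd le)
  also have "\<dots> = (\<integral>\<^sup>+f. epow (F (e f)) (1 - (real DIM('a) - 1) * q) *
      (\<Prod>b\<in>(Basis::'a set). epow (\<integral>\<^sup>+t. F (e (f(b := t))) \<partial>lborel) q) \<partial>?P)"
    by (simp add: n_def[symmetric] q(2))
  also have "\<dots> \<le> epow (\<integral>\<^sup>+f. F (e f) \<partial>?P) (1 + q)"
    using q by (intro grid_lines_inequality) (auto simp: n_def[symmetric])
  also have "(\<integral>\<^sup>+f. F (e f) \<partial>?P) = (\<integral>\<^sup>+x. F x \<partial>lborel)"
    by (subst lb) (simp add: nn_integral_distr)
  finally show ?thesis by (simp add: q(3))
qed

lemma abs_powr_has_derivative:
  fixes a :: real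
  assumes a: "a > 1"
  shows "((\<lambda>x. \<bar>x\<bar> powr a) has_real_derivative a * (sgn x * \<bar>x\<bar> powr (a - 1))) (at x)"
proof (cases x "0::real" rule: linorder_cases)
  case less
  have ev: "eventually (\<lambda>s. \<bar>s\<bar> powr a = (- s) powr a) (nhds x)"
    using eventually_nhds_in_open[of "{..<0}" x] less by (auto elim!: eventually_mono)
  have "((\<lambda>s. (- s) powr a) has_real_derivative a * (sgn x * \<bar>x\<bar> powr (a - 1))) (at x)"
    using less by (auto intro!: derivative_eq_intros)
  then show ?thesis using DERIV_cong_ev[OF refl ev refl] by blast
next
  case greater
  have ev: "eventually (\<lambda>s. \<bar>s\<bar> powr a = s powr a) (nhds x)"
    using eventually_nhds_in_open[of "{0<..}" x] greater by (auto elim!: eventually_mono)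
  have "((\<lambda>s. s powr a) has_real_derivative a * (sgn x * \<bar>x\<bar> powr (a - 1))) (at x)"
    using greater by (auto intro!: derivative_eq_intros)
  then show ?thesis using DERIV_cong_ev[OF refl ev refl] by blast
next
  case equal
  have "((\<lambda>h. \<bar>h::real\<bar> powr (a - 1)) \<longlongrightarrow> \<bar>0\<bar> powr (a - 1)) (at 0)"
    using a by (intro tendsto_powr' tendsto_rabs tendsto_const tendsto_ident_at) auto
  then have lim: "((\<lambda>h. \<bar>h::real\<bar> powr (a - 1)) \<longlongrightarrow> 0) (at 0)"
    by simp
  have "((\<lambda>h. (\<bar>h\<bar> powr a - \<bar>0\<bar> powr a) / (h - 0)) \<longlongrightarrow> 0) (at 0)"
    by (rule Lim_null_comparison[OF _ lim]) (auto simp: powr_diff divide_simps eventually_at_filter)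
  then show ?thesis by (simp add: equal has_field_derivative_iff)
qed

lemma isCont_sgn_abs_powr:
  fixes a :: real
  assumes a: "a > 0"
  shows "isCont (\<lambda>x. sgn x * \<bar>x\<bar> powr a) x"
proof (cases "x = 0")
  case True
  have "((\<lambda>h. \<bar>h::real\<bar> powr a) \<longlongrightarrow> \<bar>0\<bar> powr a) (at 0)"
    using a by (intro tendsto_powr' tendsto_rabs tendsto_const tendsto_ident_at) auto
  then have lim: "((\<lambda>h. \<bar>h::real\<bar> powr a) \<longlongrightarrow> 0) (at 0)" by simp
  have "((\<lambda>h. sgn h * \<bar>h\<bar> powr a) \<longlongrightarrow> 0) (at (0::real))"
    by (rule Lim_null_comparison[OF _ lim]) (auto simp: abs_mult abs_sgn_eq)
  with True show ?thesis by (simp add: isCont_def)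
next
  case False
  then show ?thesis
    by (auto simp: isCont_def intro!: tendsto_intros)
qed

text \<open>The fundamental theorem of calculus along the line through \<open>x\<close> in direction
  \<open>b\<close>, for the continuously differentiable function \<open>|\<phi>|\<^sup>a\<close>
  and started from a point outside the support.\<close>

lemma abs_powr_le_line_integral:
  fixes \<phi> :: "'a::euclidean_space \<Rightarrow> real"
  assumes sm: "smooth \<phi>" and supp: "bounded {x. \<phi> x \<noteq> 0}" and a: "a > 1" and b: "b \<in> Basis"
  shows "ennreal (\<bar>\<phi> x\<bar> powr a) \<le>
    (\<integral>\<^sup>+t. ennreal (a * \<bar>\<phi> (x + (t - x \<bullet> b) *\<^sub>R b)\<bar> powr (a - 1)
        * \<bar>frechet_derivative \<phi> (at (x + (t - x \<bullet> b) *\<^sub>R b)) b\<bar>) \<partial>lborel)"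
proof -
  define y where "y t = x + (t - x \<bullet> b) *\<^sub>R b" for t
  have yb: "y t \<bullet> b = t" for t
    using b by (simp add: y_def inner_add_left)
  have y0: "y (x \<bullet> b) = x" by (simp add: y_def)
  obtain R where R: "\<And>z. \<phi> z \<noteq> 0 \<Longrightarrow> norm z \<le> R"
    using supp by (auto simp: bounded_iff)
  define T where "T = - (\<bar>R\<bar> + 1 + \<bar>x \<bullet> b\<bar>)"
  have "norm (y T) > R"
  proof -
    have "\<bar>y T \<bullet> b\<bar> \<le> norm (y T)" by (rule Basis_le_norm[OF b])
    then show ?thesis by (simp add: yb T_def)
  qed
  then have phiT: "\<phi> (y T) = 0" using R[of "y T"] by force
  have dy: "(y has_derivative (\<lambda>h. h *\<^sub>R b)) (at t)" for t
    unfolding y_def by (auto intro!: derivative_eq_intros)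
  define k' where "k' t = frechet_derivative \<phi> (at (y t)) b" for t
  have dk: "((\<lambda>t. \<phi> (y t)) has_real_derivative k' t) (at t)" for t
  proof -
    have "((\<lambda>t. \<phi> (y t)) has_derivative (\<lambda>h. frechet_derivative \<phi> (at (y t)) (h *\<^sub>R b))) (at t)"
      by (rule has_derivative_compose[OF dy smooth_has_derivative[OF sm]])
    moreover have "frechet_derivative \<phi> (at (y t)) (h *\<^sub>R b) = k' t * h" for h
      using linear_scale[OF has_derivative_linear[OF smooth_has_derivative[OF sm]]]
      by (simp add: k'_def)
    ultimately show ?thesis by (simp add: has_field_derivative_def)
  qed
  define d where "d t = a * (sgn (\<phi> (y t)) * \<bar>\<phi> (y t)\<bar> powr (a - 1)) * k' t" for t
  have D: "((\<lambda>t. \<bar>\<phi> (y t)\<bar> powr a) has_real_derivative d t) (at t)" for t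
    unfolding d_def by (rule DERIV_chain2[OF abs_powr_has_derivative[OF a] dk])
  have conty: "isCont y t" for t
    using dy has_derivative_continuous by blast
  have contphi: "isCont (\<lambda>t. \<phi> (y t)) t" for t
    using dk DERIV_isCont by blast
  have contk': "isCont k' t" for t
    unfolding k'_def
    using smooth_continuous_on[OF smooth_frechet_derivative[OF sm, of b], of UNIV]
    by (intro isCont_o2[OF conty]) (auto simp: continuous_on_eq_continuous_at)
  have contd: "isCont d t" for t
    unfolding d_def using a
    by (intro isCont_mult continuous_const contk' isCont_o2[OF contphi isCont_sgn_abs_powr]) auto
  have "has_bochner_integral lborel (\<lambda>t. d t * indicator {T..x \<bullet> b} t)
      (\<bar>\<phi> (y (x \<bullet> b))\<bar> powr a - \<bar>\<phi> (y T)\<bar> powr a)"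
    by (rule has_bochner_integral_FTC_Icc_real) (use D contd in \<open>auto simp: T_def\<close>)
  then have hb: "has_bochner_integral lborel (\<lambda>t. d t * indicator {T..x \<bullet> b} t) (\<bar>\<phi> x\<bar> powr a)"
    by (simp add: y0 phiT)
  have "ennreal (\<bar>\<phi> x\<bar> powr a) = ennreal (norm (\<integral>t. d t * indicator {T..x \<bullet> b} t \<partial>lborel))"
    using has_bochner_integral_integral_eq[OF hb] by simp
  also have "\<dots> \<le> (\<integral>\<^sup>+t. ennreal (norm (d t * indicator {T..x \<bullet> b} t)) \<partial>lborel)"
    by (rule integral_norm_bound_ennreal) (use hb in \<open>auto simp: has_bochner_integral_iff\<close>)
  also have "\<dots> \<le> (\<integral>\<^sup>+t. ennreal (a * \<bar>\<phi> (y t)\<bar> powr (a - 1) * \<bar>k' t\<bar>) \<partial>lborel)"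
    using a by (intro nn_integral_mono ennreal_leI)
      (auto simp: d_def abs_mult abs_sgn_eq indicator_def)
  finally show ?thesis unfolding y_def k'_def .
qed

lemma integrable_continuous_bounded_support:
  fixes f :: "'a::euclidean_space \<Rightarrow> 'b::euclidean_space"
  assumes "continuous_on UNIV f" "bounded {x. f x \<noteq> 0}"
  shows "integrable lborel f"
proof -
  obtain R where R: "\<And>x. f x \<noteq> 0 \<Longrightarrow> x \<in> cball 0 R"
    using assms(2) by (auto simp: bounded_iff)
  have "integrable lborel (\<lambda>x. indicator (cball 0 R) x *\<^sub>R f x)"
    by (rule borel_integrable_compact) (auto intro: continuous_on_subset[OF assms(1)])
  moreover have "(\<lambda>x. indicator (cball 0 R) x *\<^sub>R f x) = f"
    using R by (force simp: indicator_def)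
  ultimately show ?thesis by simp
qed

lemma gradient_inner_axis:
  fixes \<phi> :: "real ^ 'n \<Rightarrow> real"
  shows "gradient \<phi> x \<bullet> axis i 1 = frechet_derivative \<phi> (at x) (axis i 1)"
  by (simp add: gradient_def inner_axis)

lemma continuous_on_gradient:
  fixes \<phi> :: "real ^ 'n \<Rightarrow> real"
  shows "smooth \<phi> \<Longrightarrow> continuous_on UNIV (gradient \<phi>)"
  unfolding gradient_def[abs_def]
  by (intro continuous_on_vec_lambda smooth_continuous_on smooth_frechet_derivative)

lemma frechet_derivative_eq_0_outside_support:
  assumes "x \<notin> closure {x. \<phi> x \<noteq> 0}"
  shows "frechet_derivative \<phi> (at x) = (\<lambda>v. 0)"
proof -
  have ev: "eventually (\<lambda>y. 0 = \<phi> y) (at x)"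
    unfolding eventually_at_topological using assms closure_subset[of "{x. \<phi> x \<noteq> 0}"]
    by (intro exI[of _ "- closure {x. \<phi> x \<noteq> 0}"]) auto
  have "\<phi> x = 0" using assms closure_subset[of "{x. \<phi> x \<noteq> 0}"] by auto
  then have "(\<phi> has_derivative (\<lambda>v. 0)) (at x)"
    using has_derivative_transform_eventually[OF has_derivative_const ev] by auto
  then show ?thesis using frechet_derivative_at by metis
qed

lemma gradient_bounded_support:
  fixes \<phi> :: "real ^ 'n \<Rightarrow> real"
  assumes "bounded {x. \<phi> x \<noteq> 0}"
  shows "bounded {x. gradient \<phi> x \<noteq> 0}"
proof (rule bounded_subset[OF bounded_closure[OF assms]])
  show "{x. gradient \<phi> x \<noteq> 0} \<subseteq> closure {x. \<phi> x \<noteq> 0}"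
  proof (rule ccontr)
    assume "\<not> ?thesis"
    then obtain x where x: "gradient \<phi> x \<noteq> 0" "x \<notin> closure {x. \<phi> x \<noteq> 0}" by auto
    from x show False
      using frechet_derivative_eq_0_outside_support[OF x(2)] by (simp add: gradient_def vec_eq_iff)
  qed
qed

lemma integrable_powr_bounded_support:
  fixes f :: "'a::euclidean_space \<Rightarrow> 'b::euclidean_space"
  assumes "continuous_on UNIV f" "bounded {x. f x \<noteq> 0}" "p > 0"
  shows "integrable lborel (\<lambda>x. norm (f x) powr p)"
proof (rule integrable_continuous_bounded_support)
  show "continuous_on UNIV (\<lambda>x. norm (f x) powr p)"
    using assms by (intro continuous_on_powr' continuous_intros) auto
  show "bounded {x. norm (f x) powr p \<noteq> 0}"
    using assms(2) by simp
qed

text \<open>A Sobolev inequality with an explicit constant. It is not sharp; it makes the set whose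
  supremum is \<^const>\<open>sobolev_const\<close> bounded. The case of exponent
  \<open>1\<close> is applied to \<open>|\<phi>|\<^sup>a\<close>, and the factor
  \<open>|\<phi>|\<^sup>a\<^sup>-\<^sup>1\<close> in its gradient is absorbed by Hoelder into
  the left-hand side.\<close>

theorem sobolev_inequality_smooth:
  fixes \<phi> :: "real ^ 'n \<Rightarrow> real"
  assumes p: "1 < p" "p < real CARD('n)" and sm: "smooth \<phi>" and supp: "bounded {x. \<phi> x \<noteq> 0}"
  shows "Lp_norm (sobolev_exponent CARD('n) p) lborel \<phi>
    \<le> (p * (real CARD('n) - 1) / (real CARD('n) - p)) * Lp_norm p lborel (gradient \<phi>)"
proof -
  define n where "n = real CARD('n)"
  define s where "s = sobolev_exponent CARD('n) p"
  define a where "a = p * (n - 1) / (n - p)"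
  have n: "n > p" "n > 1" using p by (auto simp: n_def)
  then have n2: "CARD('n) \<ge> 2" by (auto simp: n_def)
  have s: "s = p * n / (n - p)" "s > 0" using n p by (auto simp: s_def sobolev_exponent_def n_def)
  \<comment> \<open>The exponent a is the only one for which both the power on the left and the power of the
      function that Hoelder produces on the right equal s.\<close>
  have a: "a > 1" "a * (n / (n - 1)) = s" "(a - 1) * (p / (p - 1)) = s"
  proof -
    have nz: "n - p \<noteq> 0" "n - 1 \<noteq> 0" "p - 1 \<noteq> 0" using n p by auto
    have a1: "a - 1 = n * (p - 1) / (n - p)"
      using nz by (simp add: a_def divide_simps) (simp add: algebra_simps)
    have "n * (p - 1) / (n - p) > 0" using n p by simp
    then show "a > 1" using a1 by linarith
    show "a * (n / (n - 1)) = s" using nz by (simp add: a_def s)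
    show "(a - 1) * (p / (p - 1)) = s" unfolding a1 s(1) using nz by (simp add: mult.commute)
  qed
  define G where "G x = norm (gradient \<phi> x)" for x
  have cphi: "continuous_on UNIV \<phi>" by (rule smooth_continuous_on[OF sm])
  have cG: "continuous_on UNIV (gradient \<phi>)" by (rule continuous_on_gradient[OF sm])
  have [measurable]: "\<phi> \<in> borel_measurable borel" "gradient \<phi> \<in> borel_measurable borel"
    using cphi cG by (auto intro: borel_measurable_continuous_onI)
  have [measurable]: "G \<in> borel_measurable borel" unfolding G_def by measurable
  define A where "A = (\<integral>x. \<bar>\<phi> x\<bar> powr s \<partial>lborel)"
  define B where "B = (\<integral>x. G x powr p \<partial>lborel)"
  have A0: "A \<ge> 0" and B0: "B \<ge> 0" by (auto simp: A_def B_def)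
  have A: "(\<integral>\<^sup>+x. ennreal (\<bar>\<phi> x\<bar> powr s) \<partial>lborel) = ennreal A"
    unfolding A_def using integrable_powr_bounded_support[OF cphi supp s(2)]
    by (intro nn_integral_eq_integral) auto
  have B: "(\<integral>\<^sup>+x. ennreal (G x powr p) \<partial>lborel) = ennreal B"
    unfolding B_def G_def using integrable_powr_bounded_support[OF cG gradient_bounded_support[OF supp]] p
    by (intro nn_integral_eq_integral) auto
  define F where "F x = ennreal a * (epow (ennreal (\<bar>\<phi> x\<bar> powr s)) ((p - 1) / p) * epow (ennreal (G x powr p)) (1 / p))" for x
  have F_eq: "F x = ennreal (a * \<bar>\<phi> x\<bar> powr (a - 1) * G x)" for x
  proof -
    have "s * ((p - 1) / p) = a - 1" using a(3) p by (auto simp: field_simps)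
    then show ?thesis using p a(1)
      by (simp add: F_def epow_ennreal powr_powr ennreal_mult[symmetric] mult.assoc G_def)
  qed
  have Fm: "F \<in> borel_measurable borel"
    unfolding F_def by measurable
  have line: "ennreal (\<bar>\<phi> x\<bar> powr a) \<le> (\<integral>\<^sup>+t. F (x + (t - x \<bullet> b) *\<^sub>R b) \<partial>lborel)" if b: "b \<in> Basis" for x b
  proof -
    obtain i where i: "b = axis i 1" using b by (auto simp: Basis_vec_def)
    have *: "\<bar>frechet_derivative \<phi> (at y) b\<bar> \<le> G y" for y
      using Basis_le_norm[OF b, of "gradient \<phi> y"] unfolding G_def i gradient_inner_axis by simp
    have "ennreal (\<bar>\<phi> x\<bar> powr a) \<le>
      (\<integral>\<^sup>+t. ennreal (a * \<bar>\<phi> (x + (t - x \<bullet> b) *\<^sub>R b)\<bar> powr (a - 1)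
        * \<bar>frechet_derivative \<phi> (at (x + (t - x \<bullet> b) *\<^sub>R b)) b\<bar>) \<partial>lborel)"
      by (rule abs_powr_le_line_integral[OF sm supp a(1) b])
    also have "\<dots> \<le> (\<integral>\<^sup>+t. F (x + (t - x \<bullet> b) *\<^sub>R b) \<partial>lborel)"
      unfolding F_eq using a(1) by (intro nn_integral_mono ennreal_leI mult_left_mono *) auto
    finally show ?thesis .
  qed
  have "ennreal A = (\<integral>\<^sup>+x. epow (ennreal (\<bar>\<phi> x\<bar> powr a)) (n / (n - 1)) \<partial>lborel)"
    using n a(2) by (simp add: A[symmetric] epow_ennreal powr_powr)
  also have "\<dots> \<le> epow (\<integral>\<^sup>+x. F x \<partial>lborel) (n / (n - 1))"
    using gagliardo_nirenberg_lines[where 'a="real^'n", OF _ Fm _ line] n2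
    by (simp add: n_def)
  also have "(\<integral>\<^sup>+x. F x \<partial>lborel) \<le> ennreal a * (epow (ennreal A) ((p - 1) / p) * epow (ennreal B) (1 / p))"
  proof -
    have "(\<integral>\<^sup>+x. (\<Prod>c\<in>UNIV. epow (if c then ennreal (\<bar>\<phi> x\<bar> powr s) else ennreal (G x powr p)) (if c then (p - 1) / p else 1 / p)) \<partial>lborel)
      \<le> (\<Prod>c\<in>UNIV. epow (\<integral>\<^sup>+x. (if c then ennreal (\<bar>\<phi> x\<bar> powr s) else ennreal (G x powr p)) \<partial>lborel) (if c then (p - 1) / p else 1 / p))"
      using p by (intro nn_integral_Holder) (auto simp: UNIV_bool field_simps)
    then have "(\<integral>\<^sup>+x. epow (ennreal (\<bar>\<phi> x\<bar> powr s)) ((p - 1) / p) * epow (ennreal (G x powr p)) (1 / p) \<partial>lborel)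
      \<le> epow (ennreal A) ((p - 1) / p) * epow (ennreal B) (1 / p)"
      by (simp add: UNIV_bool A B mult.commute)
    then show ?thesis
      unfolding F_def by (subst nn_integral_cmult) (auto intro!: mult_left_mono)
  qed
  also have "ennreal a * (epow (ennreal A) ((p - 1) / p) * epow (ennreal B) (1 / p))
      = ennreal (a * (A powr ((p - 1) / p) * B powr (1 / p)))"
    using p a(1) A0 B0 by (simp add: epow_ennreal ennreal_mult)
  finally have "ennreal A \<le> epow (ennreal (a * (A powr ((p - 1) / p) * B powr (1 / p)))) (n / (n - 1))"
    using n by (simp add: epow_mono)
  then have main: "A \<le> (a * (A powr ((p - 1) / p) * B powr (1 / p))) powr (n / (n - 1))"
    using n a(1) A0 B0 by (simp add: epow_ennreal)
  have "A powr (1 / s) \<le> a * B powr (1 / p)"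
  proof (cases "A = 0")
    case True then show ?thesis using a(1) by simp
  next
    case False
    then have A1: "A > 0" using A0 by simp
    have "A powr ((n - 1) / n) \<le> ((a * (A powr ((p - 1) / p) * B powr (1 / p))) powr (n / (n - 1))) powr ((n - 1) / n)"
      using main n A0 by (intro powr_mono2) auto
    also have "\<dots> = a * (A powr ((p - 1) / p) * B powr (1 / p))"
      using n a(1) by (simp add: powr_powr)
    finally have "A powr ((n - 1) / n) / A powr ((p - 1) / p) \<le> a * B powr (1 / p)"
      using A1 by (simp add: field_simps)
    moreover have "(n - 1) / n - (p - 1) / p = 1 / s"
      using n p by (simp add: s field_simps)
    ultimately show ?thesis by (simp add: powr_diff[symmetric])
  qed
  then show ?thesis
    by (simp add: Lp_norm_def A_def B_def G_def s_def[symmetric] a_def n_def)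
qed

lemma sobolev_quotient_le_sobolev_const:
  fixes \<phi> :: "real ^ 'n \<Rightarrow> real"
  assumes p: "1 < p" "p < real CARD('n)"
    and "smooth \<phi>" "bounded {x. \<phi> x \<noteq> 0}" "\<phi> \<noteq> (\<lambda>x. 0)"
  shows "Lp_norm (sobolev_exponent CARD('n) p) lborel \<phi> / Lp_norm p lborel (gradient \<phi>)
    \<le> sobolev_const TYPE('n) p"
proof -
  let ?C = "p * (real CARD('n) - 1) / (real CARD('n) - p)"
  let ?r = "\<lambda>\<phi> :: real ^ 'n \<Rightarrow> real. Lp_norm (sobolev_exponent CARD('n) p) lborel \<phi> / Lp_norm p lborel (gradient \<phi>)"
  let ?S = "{?r \<phi> | \<phi> :: real ^ 'n \<Rightarrow> real. smooth \<phi> \<and> compact (closure {x. \<phi> x \<noteq> 0}) \<and> \<phi> \<noteq> (\<lambda>x. 0)}"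
  have C0: "?C \<ge> 0" using p by auto
  have "r \<le> ?C" if "r \<in> ?S" for r
  proof -
    from that obtain \<phi> :: "real ^ 'n \<Rightarrow> real" where \<phi>: "r = ?r \<phi>" "smooth \<phi>" "bounded {x. \<phi> x \<noteq> 0}"
      by auto
    have "0 \<le> Lp_norm p lborel (gradient \<phi>)" by (simp add: Lp_norm_def)
    then show ?thesis
      using sobolev_inequality_smooth[OF p \<phi>(2,3)] C0 unfolding \<phi>(1)
      by (cases "Lp_norm p lborel (gradient \<phi>) = 0") (simp_all add: divide_le_eq)
  qed
  then have bdd: "bdd_above ?S" by (rule bdd_aboveI)
  show ?thesis
    unfolding sobolev_const_def using assms(3-5) by (intro cSup_upper bdd) auto
qed

lemma sobolev_const_nonneg:
  assumes p: "1 < p" "p < real CARD('n::finite)"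
  shows "sobolev_const TYPE('n) p \<ge> 0"
proof -
  let ?b = "\<lambda>x :: real ^ 'n. flat_exp 0 (1 - x \<bullet> x)"
  have "{x. ?b x \<noteq> 0} \<subseteq> ball 0 1"
    by (auto simp: flat_exp_0_eq_0_iff dot_square_norm not_le abs_square_less_1)
  then have "bounded {x. ?b x \<noteq> 0}" by (rule bounded_subset[OF bounded_ball])
  moreover have "smooth ?b"
    by (intro smooth_compose_real[OF smooth_flat_exp] smooth_diff smooth_const smooth_inner smooth_ident)
  moreover have "?b \<noteq> (\<lambda>x. 0)"
    by (auto simp: fun_eq_iff flat_exp_0_eq_0_iff intro!: exI[of _ 0])
  ultimately have "Lp_norm (sobolev_exponent CARD('n) p) lborel ?b / Lp_norm p lborel (gradient ?b)
      \<le> sobolev_const TYPE('n) p"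
    by (intro sobolev_quotient_le_sobolev_const p)
  moreover have "0 \<le> Lp_norm (sobolev_exponent CARD('n) p) lborel ?b / Lp_norm p lborel (gradient ?b)"
    by (simp add: Lp_norm_def)
  ultimately show ?thesis by linarith
qed

lemma sobolev_inequality_sharp:
  fixes \<phi> :: "real ^ 'n \<Rightarrow> real"
  assumes p: "1 < p" "p < real CARD('n)" and sm: "smooth \<phi>" and supp: "bounded {x. \<phi> x \<noteq> 0}"
  shows "Lp_norm (sobolev_exponent CARD('n) p) lborel \<phi>
    \<le> sobolev_const TYPE('n) p * Lp_norm p lborel (gradient \<phi>)"
proof (cases "Lp_norm p lborel (gradient \<phi>) = 0")
  case True
  then show ?thesis using sobolev_inequality_smooth[OF p sm supp] by simp
next
  case False
  then have pos: "Lp_norm p lborel (gradient \<phi>) > 0" by (simp add: Lp_norm_def)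
  have "gradient (\<lambda>x::real^'n. 0::real) = (\<lambda>x. 0)"
    by (auto simp: gradient_def fun_eq_iff vec_eq_iff frechet_derivative_const)
  with False have "\<phi> \<noteq> (\<lambda>x. 0)" by (auto simp: Lp_norm_def)
  from sobolev_quotient_le_sobolev_const[OF p sm supp this] pos show ?thesis
    by (simp add: divide_le_eq)
qed

section \<open>Translations and mollifiers\<close>

lemma nn_integral_lborel_affine:
  fixes f :: "'a::euclidean_space \<Rightarrow> ennreal"
  assumes [measurable]: "f \<in> borel_measurable borel" and c: "c \<noteq> 0"
  shows "(\<integral>\<^sup>+x. f x \<partial>lborel) = ennreal (\<bar>c\<bar> ^ DIM('a)) * (\<integral>\<^sup>+x. f (t + c *\<^sub>R x) \<partial>lborel)"
  by (subst lborel_affine[OF c, of t])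
     (simp add: nn_integral_density nn_integral_distr nn_integral_cmult)

lemma nn_integral_lborel_translate:
  fixes f :: "'a::euclidean_space \<Rightarrow> ennreal"
  assumes "f \<in> borel_measurable borel"
  shows "(\<integral>\<^sup>+x. f (x - t) \<partial>lborel) = (\<integral>\<^sup>+x. f x \<partial>lborel)"
  using nn_integral_lborel_affine[OF assms, of 1 "- t"] by simp

lemma nn_integral_lborel_reflect:
  fixes f :: "'a::euclidean_space \<Rightarrow> ennreal"
  assumes "f \<in> borel_measurable borel"
  shows "(\<integral>\<^sup>+x. f (t - x) \<partial>lborel) = (\<integral>\<^sup>+x. f x \<partial>lborel)"
  using nn_integral_lborel_affine[OF assms, of "-1" t] by simp

text \<open>Squeeze \<open>A\<close> between a compact \<open>K\<close> and an open \<open>U\<close>. For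
  a shift shorter than the distance from \<open>K\<close> to the complement of \<open>U\<close>,
  the indicator of \<open>A\<close> and its shift differ at \<open>y\<close> only if
  \<open>y\<close> or \<open>y - w\<close> lies in \<open>U - K\<close>.\<close>

lemma indicator_translation_small:
  fixes A :: "'a::euclidean_space set"
  assumes A: "A \<in> sets lborel" "emeasure lborel A < \<infinity>" and e: "e > 0"
  shows "\<exists>\<delta>>0. \<forall>w. norm w < \<delta> \<longrightarrow>
    (\<integral>\<^sup>+y. ennreal \<bar>indicator A (y - w) - indicator A y\<bar> \<partial>lborel) \<le> ennreal e"
proof -
  have Ab [measurable]: "A \<in> sets borel" using A(1) by simp
  define M where "M = density lborel (indicator A)"
  have M: "emeasure M X = emeasure lborel (A \<inter> X)" if "X \<in> sets borel" for X
    unfolding M_def using that A(1) by (intro emeasure_restricted) auto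
  have fin: "emeasure M (space M) \<noteq> \<infinity>"
    using M[of UNIV] A(2) by (simp add: M_def)
  have MA: "emeasure M A \<noteq> \<infinity>" using M[OF Ab] A(2) by simp
  have sup: "emeasure M A = (SUP K \<in> {K. K \<subseteq> A \<and> compact K}. emeasure M K)"
    by (rule inner_regular[OF _ fin Ab]) (simp add: M_def)
  have "\<exists>K\<in>{K. K \<subseteq> A \<and> compact K}. emeasure M A < emeasure M K + ennreal (e / 4)"
    by (rule SUP_approx_ennreal[OF _ _ sup MA]) (use e in \<open>auto intro: exI[of _ "{}"]\<close>)
  then obtain K where K: "K \<subseteq> A" "compact K" "emeasure M A < emeasure M K + ennreal (e / 4)"
    by blast
  have Kb [measurable]: "K \<in> sets borel" using K(2) by (simp add: compact_imp_closed)
  have Kfin: "emeasure lborel K < \<infinity>"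
    using emeasure_mono[OF K(1), of lborel] A by (auto intro: le_less_trans)
  have AK: "emeasure lborel (A - K) \<le> ennreal (e / 4)"
  proof -
    have "emeasure lborel A \<le> ennreal (e/4) + emeasure lborel K"
      using K(1,3) M[OF Ab] M[OF Kb] by (simp add: Int_absorb1 add.commute less_imp_le)
    then show ?thesis
      using K(1) Kfin A(1) by (subst emeasure_Diff) (auto simp: ennreal_minus_le_iff add.commute)
  qed
  obtain U where U: "open U" "A \<subseteq> U" "emeasure lborel (U - A) < ennreal (e / 4)"
    using outer_regular_lborel[OF Ab, of "e/4"] e by auto
  have Ub [measurable]: "U \<in> sets borel" using U(1) by simp
  have UK: "emeasure lborel (U - K) \<le> ennreal (e / 2)"
  proof -
    have "U - K \<subseteq> (U - A) \<union> (A - K)" by auto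
    then have "emeasure lborel (U - K) \<le> emeasure lborel ((U - A) \<union> (A - K))"
      by (intro emeasure_mono) auto
    also have "\<dots> \<le> emeasure lborel (U - A) + emeasure lborel (A - K)"
      by (intro emeasure_subadditive) auto
    also have "\<dots> \<le> ennreal (e / 4) + ennreal (e / 4)"
      using U(3) AK by (intro add_mono) auto
    finally show ?thesis using e by (simp flip: ennreal_plus)
  qed
  obtain d where d: "d > 0" "(\<Union>x\<in>K. ball x d) \<subseteq> U"
    using compact_subset_open_imp_ball_epsilon_subset[OF K(2) U(1)] K(1) U(2) by blast
  have near: "x + w \<in> U" "x - w \<in> U" if "x \<in> K" "norm w < d" for x w
  proof -
    have "x + w \<in> ball x d" "x - w \<in> ball x d" using that(2) by (auto simp: dist_norm)
    then show "x + w \<in> U" "x - w \<in> U" using d(2) that(1) by blast+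
  qed
  show ?thesis
  proof (intro exI[of _ d] conjI d(1) allI impI)
    fix w :: 'a assume w: "norm w < d"
    \<comment> \<open>If exactly one of y and y - w lies in A, then one of them lies in U - K: a point of K
        stays in U when it is shifted.\<close>
    have "\<bar>indicator A (y - w) - indicator A y\<bar> \<le> (indicator (U - K) y + indicator (U - K) (y - w) :: real)" for y
      using near[OF _ w, of y] near[OF _ w, of "y - w"] K(1) U(2)
      by (auto simp: indicator_def)
    then have "(\<integral>\<^sup>+y. ennreal \<bar>indicator A (y - w) - indicator A y\<bar> \<partial>lborel)
        \<le> (\<integral>\<^sup>+y. ennreal (indicator (U - K) y + indicator (U - K) (y - w)) \<partial>lborel)"
      by (intro nn_integral_mono ennreal_leI)
    also have "\<dots> = (\<integral>\<^sup>+y. indicator (U - K) y \<partial>lborel) + (\<integral>\<^sup>+y. indicator (U - K) (y - w) \<partial>lborel)"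
    proof -
      have "ennreal (indicator (U - K) y + indicator (U - K) (y - w)) = indicator (U - K) y + indicator (U - K) (y - w)" for y
        by (auto simp: indicator_def simp del: Diff_iff)
      then show ?thesis
        by (simp only:) (rule nn_integral_add; measurable)
    qed
    also have "(\<integral>\<^sup>+y. indicator (U - K) (y - w) \<partial>lborel) = (\<integral>\<^sup>+y. indicator (U - K) y \<partial>lborel)"
      by (rule nn_integral_lborel_translate) measurable
    also have "(\<integral>\<^sup>+y. indicator (U - K) y \<partial>lborel) + (\<integral>\<^sup>+y. indicator (U - K) y \<partial>lborel) \<le> ennreal (e/2) + ennreal (e/2)"
      using UK by (intro add_mono) auto
    also have "\<dots> = ennreal e" using e by (simp flip: ennreal_plus)
    finally show "(\<integral>\<^sup>+y. ennreal \<bar>indicator A (y - w) - indicator A y\<bar> \<partial>lborel) \<le> ennreal e" .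
  qed
qed

lemma L1_translation_continuous:
  fixes f :: "'a::euclidean_space \<Rightarrow> 'b::euclidean_space"
  assumes "integrable lborel f" and "\<epsilon> > 0"
  shows "\<exists>\<delta>>0. \<forall>w. norm w < \<delta> \<longrightarrow> (\<integral>\<^sup>+y. ennreal (norm (f (y - w) - f y)) \<partial>lborel) \<le> ennreal \<epsilon>"
  using assms
proof (induction arbitrary: \<epsilon> rule: integrable_induct)
  case (base A c)
  obtain d where d: "d > 0" "\<And>w. norm w < d \<Longrightarrow>
    (\<integral>\<^sup>+y. ennreal \<bar>indicator A (y - w) - indicator A y\<bar> \<partial>lborel) \<le> ennreal (\<epsilon> / (norm c + 1))"
    using indicator_translation_small[OF base(1,2), of "\<epsilon> / (norm c + 1)"] base(3)
    by (auto simp: add_nonneg_pos)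
  have [measurable]: "A \<in> sets borel" using base(1) by simp
  show ?case
  proof (intro exI[of _ d] conjI d(1) allI impI)
    fix w :: 'a assume w: "norm w < d"
    have "(\<integral>\<^sup>+y. ennreal (norm (indicator A (y - w) *\<^sub>R c - indicator A y *\<^sub>R c)) \<partial>lborel)
      = (\<integral>\<^sup>+y. ennreal (norm c) * ennreal \<bar>indicator A (y - w) - indicator A y\<bar> \<partial>lborel)"
      by (simp add: scaleR_diff_left[symmetric] ennreal_mult[symmetric] mult.commute)
    also have "\<dots> = ennreal (norm c) * (\<integral>\<^sup>+y. ennreal \<bar>indicator A (y - w) - indicator A y\<bar> \<partial>lborel)"
      by (rule nn_integral_cmult) measurable
    also have "\<dots> \<le> ennreal (norm c) * ennreal (\<epsilon> / (norm c + 1))"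
      by (intro mult_left_mono d(2) w) auto
    also have "\<dots> \<le> ennreal \<epsilon>"
      using base(3) by (simp add: ennreal_mult[symmetric] divide_simps mult.commute add_nonneg_pos)
    finally show "(\<integral>\<^sup>+y. ennreal (norm (indicator A (y - w) *\<^sub>R c - indicator A y *\<^sub>R c)) \<partial>lborel) \<le> ennreal \<epsilon>" .
  qed
next
  case (add f g)
  have [measurable]: "f \<in> borel_measurable borel" "g \<in> borel_measurable borel"
    using add.hyps by auto
  have "\<epsilon> / 2 > 0" using add.prems by simp
  note e2 = this
  obtain d1 where d1: "d1 > 0"
    "\<And>w. norm w < d1 \<Longrightarrow> (\<integral>\<^sup>+y. ennreal (norm (f (y - w) - f y)) \<partial>lborel) \<le> ennreal (\<epsilon> / 2)"
    using add.IH(1)[OF e2] by blast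
  obtain d2 where d2: "d2 > 0"
    "\<And>w. norm w < d2 \<Longrightarrow> (\<integral>\<^sup>+y. ennreal (norm (g (y - w) - g y)) \<partial>lborel) \<le> ennreal (\<epsilon> / 2)"
    using add.IH(2)[OF e2] by blast
  show ?case
  proof (intro exI[of _ "min d1 d2"] conjI allI impI)
    fix w :: 'a assume w: "norm w < min d1 d2"
    have "(\<integral>\<^sup>+y. ennreal (norm (f (y - w) + g (y - w) - (f y + g y))) \<partial>lborel)
      \<le> (\<integral>\<^sup>+y. ennreal (norm (f (y - w) - f y)) + ennreal (norm (g (y - w) - g y)) \<partial>lborel)"
      by (intro nn_integral_mono)
        (simp add: norm_diff_triangle_ineq flip: ennreal_plus)
    also have "\<dots> = (\<integral>\<^sup>+y. ennreal (norm (f (y - w) - f y)) \<partial>lborel) + (\<integral>\<^sup>+y. ennreal (norm (g (y - w) - g y)) \<partial>lborel)"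
      by (rule nn_integral_add) measurable
    also have "\<dots> \<le> ennreal (\<epsilon> / 2) + ennreal (\<epsilon> / 2)"
      using w by (intro add_mono d1(2) d2(2)) auto
    also have "\<dots> = ennreal \<epsilon>" using add.prems by (simp flip: ennreal_plus)
    finally show "(\<integral>\<^sup>+y. ennreal (norm (f (y - w) + g (y - w) - (f y + g y))) \<partial>lborel) \<le> ennreal \<epsilon>" .
  qed (use d1 d2 in auto)
next
  case (lim f s)
  have intf: "integrable lborel f" and ints: "\<And>i. integrable lborel (s i)"
    by (rule lim.hyps)+
  have [measurable]: "f \<in> borel_measurable borel" "\<And>i. s i \<in> borel_measurable borel"
    using intf ints by auto
  have "(\<lambda>i. (\<integral>\<^sup>+x. norm (f x - s i x) \<partial>lborel)) \<longlonglongrightarrow> 0"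
  proof (rule nn_integral_dominated_convergence_norm)
    show "(\<integral>\<^sup>+x. ennreal (2 * norm (f x)) \<partial>lborel) < \<infinity>"
      using intf by (simp add: integrable_iff_bounded ennreal_mult nn_integral_cmult ennreal_mult_less_top)
  qed (use lim.hyps in auto)
  then have "eventually (\<lambda>i. (\<integral>\<^sup>+x. norm (f x - s i x) \<partial>lborel) < ennreal (\<epsilon> / 3)) sequentially"
    by (rule order_tendstoD) (use lim.prems in simp)
  then obtain i where i: "(\<integral>\<^sup>+x. norm (f x - s i x) \<partial>lborel) < ennreal (\<epsilon> / 3)"
    by (auto simp: eventually_sequentially)
  obtain d where d: "d > 0"
    "\<And>w. norm w < d \<Longrightarrow> (\<integral>\<^sup>+y. ennreal (norm (s i (y - w) - s i y)) \<partial>lborel) \<le> ennreal (\<epsilon> / 3)"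
    using lim.IH[of "\<epsilon> / 3" i] lim.prems by auto
  show ?case
  proof (intro exI[of _ d] conjI allI impI d(1))
    fix w :: 'a assume w: "norm w < d"
    \<comment> \<open>Replace f by a simple function; the two errors have the same integral by translation
        invariance.\<close>
    have tri: "norm (f (y - w) - f y) \<le> norm (f (y - w) - s i (y - w)) + norm (s i (y - w) - s i y) + norm (f y - s i y)" for y
      using norm_triangle_ineq[of "f (y - w) - s i (y - w) + (s i (y - w) - s i y)" "s i y - f y"]
        norm_triangle_ineq[of "f (y - w) - s i (y - w)" "s i (y - w) - s i y"]
      by (simp add: norm_minus_commute)
    have "(\<integral>\<^sup>+y. ennreal (norm (f (y - w) - f y)) \<partial>lborel)
      \<le> (\<integral>\<^sup>+y. ennreal (norm (f (y - w) - s i (y - w))) + ennreal (norm (s i (y - w) - s i y)) + ennreal (norm (f y - s i y)) \<partial>lborel)"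
      using tri by (intro nn_integral_mono) (simp flip: ennreal_plus)
    also have "\<dots> = (\<integral>\<^sup>+y. ennreal (norm (f (y - w) - s i (y - w))) \<partial>lborel) + (\<integral>\<^sup>+y. ennreal (norm (s i (y - w) - s i y)) \<partial>lborel) + (\<integral>\<^sup>+y. ennreal (norm (f y - s i y)) \<partial>lborel)"
      by (simp add: nn_integral_add)
    also have "(\<integral>\<^sup>+y. ennreal (norm (f (y - w) - s i (y - w))) \<partial>lborel) = (\<integral>\<^sup>+y. ennreal (norm (f y - s i y)) \<partial>lborel)"
      by (rule nn_integral_lborel_translate[of "\<lambda>y. ennreal (norm (f y - s i y))"]) measurable
    also have "(\<integral>\<^sup>+y. ennreal (norm (f y - s i y)) \<partial>lborel) + (\<integral>\<^sup>+y. ennreal (norm (s i (y - w) - s i y)) \<partial>lborel) + (\<integral>\<^sup>+y. ennreal (norm (f y - s i y)) \<partial>lborel)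
       \<le> ennreal (\<epsilon> / 3) + ennreal (\<epsilon> / 3) + ennreal (\<epsilon> / 3)"
      using i by (intro add_mono d(2) w) auto
    also have "\<dots> = ennreal \<epsilon>" using lim.prems by (simp flip: ennreal_plus)
    finally show "(\<integral>\<^sup>+y. ennreal (norm (f (y - w) - f y)) \<partial>lborel) \<le> ennreal \<epsilon>" .
  qed
qed

lemma mollifier_exists:
  fixes r :: real
  assumes r: "r > 0"
  shows "\<exists>\<rho> :: 'a::euclidean_space \<Rightarrow> real. smooth \<rho> \<and> (\<forall>x. 0 \<le> \<rho> x) \<and> (\<forall>x. r \<le> norm x \<longrightarrow> \<rho> x = 0) \<and>
    (\<integral>\<^sup>+x. ennreal (\<rho> x) \<partial>lborel) = 1"
proof -
  define b where "b x = flat_exp 0 (r\<^sup>2 - x \<bullet> x)" for x :: 'a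
  have sm: "smooth b"
    unfolding b_def
    by (intro smooth_compose_real[OF smooth_flat_exp] smooth_diff smooth_const smooth_inner smooth_ident)
  have nn: "0 \<le> b x" for x by (simp add: b_def flat_exp_nonneg)
  have supp: "b x = 0" if "r \<le> norm x" for x
    using that r by (simp add: b_def flat_exp_0_eq_0_iff dot_square_norm power_mono)
  have pos: "b x > 0" if "norm x < r" for x
    using that r by (simp add: b_def flat_exp_0_pos_iff dot_square_norm power_strict_mono)
  have bd: "bounded {x. b x \<noteq> 0}"
    using supp by (auto simp: bounded_iff not_le intro!: exI[of _ r] less_imp_le) (meson not_le supp)
  have int: "integrable lborel b"
    by (rule integrable_continuous_bounded_support[OF smooth_continuous_on[OF sm] bd])
  have [measurable]: "b \<in> borel_measurable borel" using int by auto
  define I where "I = (\<integral>x. b x \<partial>lborel)"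
  have I: "(\<integral>\<^sup>+x. ennreal (b x) \<partial>lborel) = ennreal I"
    unfolding I_def by (rule nn_integral_eq_integral[OF int]) (simp add: nn)
  have "I \<noteq> 0"
  proof
    assume "I = 0"
    then have "AE x in lborel. b x = 0"
      unfolding I_def using integral_nonneg_eq_0_iff_AE[OF int] nn by simp
    then have "AE x in lborel. x \<notin> ball (0::'a) r"
      by (rule AE_mp, intro AE_I2) (use pos in force)
    then have "emeasure lborel (ball (0::'a) r) = 0"
      by (subst (asm) AE_iff_measurable[of "ball 0 r"]) auto
    then have "measure lborel (ball (0::'a) r) = 0" by (simp add: measure_def)
    then show False using content_ball_pos[OF r, of "0::'a"] by simp
  qed
  moreover have "I \<ge> 0" unfolding I_def by (intro integral_nonneg_AE) (simp add: nn)
  ultimately have I0: "I > 0" by simp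
  show ?thesis
  proof (intro exI[of _ "\<lambda>x. inverse I * b x"] conjI allI impI)
    show "smooth (\<lambda>x. inverse I * b x)" by (intro smooth_mult smooth_const sm)
    show "(\<integral>\<^sup>+x. ennreal (inverse I * b x) \<partial>lborel) = 1"
      using I0 nn by (simp add: ennreal_mult nn_integral_cmult I) (simp flip: ennreal_mult)
  qed (use I0 nn supp in auto)
qed

section \<open>Convolution\<close>

lemma continuous_bounded_support_imp_bounded:
  fixes f :: "'a::euclidean_space \<Rightarrow> 'b::real_normed_vector"
  assumes "continuous_on UNIV f" "bounded {x. f x \<noteq> 0}"
  obtains M where "0 \<le> M" "\<And>x. norm (f x) \<le> M"
proof -
  obtain R where R: "\<And>x. f x \<noteq> 0 \<Longrightarrow> x \<in> cball 0 R"
    using assms(2) by (auto simp: bounded_iff)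
  have "compact (f ` cball 0 R)"
    by (intro compact_continuous_image continuous_on_subset[OF assms(1)]) auto
  then obtain M where M: "\<And>x. x \<in> cball 0 R \<Longrightarrow> norm (f x) \<le> M"
    using compact_imp_bounded by (force simp: bounded_iff)
  show thesis
  proof
    show "norm (f x) \<le> max 0 M" for x
      using M[of x] R[of x] by (cases "f x = 0") auto
  qed simp
qed

lemma frechet_derivative_bounded_support:
  assumes "bounded {x. \<phi> x \<noteq> 0}"
  shows "bounded {x. frechet_derivative \<phi> (at x) v \<noteq> 0}"
proof (rule bounded_subset[OF bounded_closure[OF assms]])
  show "{x. frechet_derivative \<phi> (at x) v \<noteq> 0} \<subseteq> closure {x. \<phi> x \<noteq> 0}"
    using frechet_derivative_eq_0_outside_support by fastforce
qed

lemma smooth_bounded_support_lipschitz: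
  fixes \<rho> :: "'a::euclidean_space \<Rightarrow> real"
  assumes sm: "smooth \<rho>" and bd: "bounded {x. \<rho> x \<noteq> 0}"
  obtains M where "0 \<le> M" "\<And>x y. \<bar>\<rho> x - \<rho> y\<bar> \<le> M * norm (x - y)"
    "\<And>x v. \<bar>frechet_derivative \<rho> (at x) v\<bar> \<le> M * norm v"
proof -
  have "\<exists>M\<ge>0. \<forall>x. \<bar>frechet_derivative \<rho> (at x) b\<bar> \<le> M" for b
    using continuous_bounded_support_imp_bounded[OF
        smooth_continuous_on[OF smooth_frechet_derivative[OF sm]] frechet_derivative_bounded_support[OF bd], of b]
    by (metis real_norm_def)
  then obtain M where M: "\<And>b. M b \<ge> 0" "\<And>b x. \<bar>frechet_derivative \<rho> (at x) b\<bar> \<le> M b"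
    by metis
  define K where "K = (\<Sum>b\<in>(Basis::'a set). M b)"
  have K: "\<bar>frechet_derivative \<rho> (at x) v\<bar> \<le> K * norm v" for x v
  proof -
    have lin: "linear (frechet_derivative \<rho> (at x))"
      by (rule has_derivative_linear[OF smooth_has_derivative[OF sm]])
    have "frechet_derivative \<rho> (at x) v = frechet_derivative \<rho> (at x) (\<Sum>b\<in>Basis. (v \<bullet> b) *\<^sub>R b)"
      by (simp add: euclidean_representation)
    also have "\<dots> = (\<Sum>b\<in>Basis. (v \<bullet> b) * frechet_derivative \<rho> (at x) b)"
      by (simp add: linear_sum[OF lin] linear_scale[OF lin])
    also have "\<bar>\<dots>\<bar> \<le> (\<Sum>b\<in>Basis. norm v * M b)"
      by (rule order_trans[OF sum_abs]) (auto simp: abs_mult intro!: sum_mono mult_mono M Basis_le_norm)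
    also have "\<dots> = K * norm v"
      unfolding K_def sum_distrib_right by (intro sum.cong) (simp_all add: mult.commute)
    finally show ?thesis .
  qed
  have K0: "K \<ge> 0" unfolding K_def by (intro sum_nonneg M)
  show thesis
  proof
    show "\<bar>\<rho> x - \<rho> y\<bar> \<le> K * norm (x - y)" for x y
    proof -
      have "norm (\<rho> x - \<rho> y) \<le> K * norm (x - y)"
      proof (rule differentiable_bound[of UNIV])
        show "onorm (frechet_derivative \<rho> (at z)) \<le> K" for z
          using K by (intro onorm_le) auto
      qed (use smooth_has_derivative[OF sm] in auto)
      then show ?thesis by simp
    qed
  qed (use K K0 in auto)
qed

definition convolve :: "('a::euclidean_space \<Rightarrow> real) \<Rightarrow> ('a \<Rightarrow> 'b::euclidean_space) \<Rightarrow> 'a \<Rightarrow> 'b" where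
  "convolve \<rho> v y = (\<integral>z. \<rho> (y - z) *\<^sub>R v z \<partial>lborel)"

lemma integrable_convolve:
  fixes v :: "'a::euclidean_space \<Rightarrow> 'b::euclidean_space"
  assumes v: "integrable lborel v" and c: "continuous_on UNIV \<rho>" and bd: "bounded {x. \<rho> x \<noteq> 0}"
  shows "integrable lborel (\<lambda>z. \<rho> (y - z) *\<^sub>R v z)"
proof -
  obtain M where M: "M \<ge> 0" "\<And>x. norm (\<rho> x) \<le> M"
    using continuous_bounded_support_imp_bounded[OF c bd] by blast
  have [measurable]: "\<rho> \<in> borel_measurable borel" by (rule borel_measurable_continuous_onI[OF c])
  have [measurable]: "v \<in> borel_measurable borel" using v by auto
  show ?thesis
  proof (rule Bochner_Integration.integrable_bound)
    show "integrable lborel (\<lambda>z. M *\<^sub>R v z)" using v by simp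
    show "AE z in lborel. norm (\<rho> (y - z) *\<^sub>R v z) \<le> norm (M *\<^sub>R v z)"
      using M by (auto intro!: mult_right_mono simp: order_trans[OF M(2) abs_ge_self])
  qed measurable
qed

text \<open>Differentiation under the integral sign by dominated convergence along sequences; the
  difference quotients are dominated because \<open>\<rho>\<close> is Lipschitz.\<close>

lemma convolve_has_derivative:
  fixes v :: "'a::euclidean_space \<Rightarrow> 'b::euclidean_space"
  assumes v: "integrable lborel v" and sm: "smooth \<rho>" and bd: "bounded {x. \<rho> x \<noteq> 0}"
  shows "(convolve \<rho> v has_derivative (\<lambda>h. convolve (\<lambda>x. frechet_derivative \<rho> (at x) h) v y)) (at y)"
proof -
  let ?D = "\<lambda>x. frechet_derivative \<rho> (at x)"
  let ?L = "\<lambda>h. convolve (\<lambda>x. ?D x h) v y"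
  obtain M where M: "0 \<le> M" "\<And>x y. \<bar>\<rho> x - \<rho> y\<bar> \<le> M * norm (x - y)"
    "\<And>x v. \<bar>?D x v\<bar> \<le> M * norm v"
    using smooth_bounded_support_lipschitz[OF sm bd] by blast
  have [measurable]: "\<rho> \<in> borel_measurable borel" "\<And>h. (\<lambda>x. ?D x h) \<in> borel_measurable borel"
    using sm smooth_frechet_derivative[OF sm] by (auto intro: smooth_borel_measurable)
  have [measurable]: "v \<in> borel_measurable borel" using v by auto
  have intD: "integrable lborel (\<lambda>z. ?D (y - z) h *\<^sub>R v z)" for h y
    by (rule integrable_convolve[OF v smooth_continuous_on[OF smooth_frechet_derivative[OF sm]]
          frechet_derivative_bounded_support[OF bd]])
  have int\<rho>: "integrable lborel (\<lambda>z. \<rho> (y - z) *\<^sub>R v z)" for y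
    by (rule integrable_convolve[OF v smooth_continuous_on[OF sm] bd])
  have linD: "linear (?D x)" for x
    by (rule has_derivative_linear[OF smooth_has_derivative[OF sm]])
  have intv: "integrable lborel (\<lambda>z. norm (v z))" using v by simp
  have "bounded_linear ?L"
  proof (rule bounded_linear_intro)
    show "?L (a + b) = ?L a + ?L b" for a b
      unfolding convolve_def using intD
      by (simp add: linear_add[OF linD] scaleR_add_left Bochner_Integration.integral_add)
    show "?L (r *\<^sub>R a) = r *\<^sub>R ?L a" for r a
      unfolding convolve_def by (simp add: linear_scale[OF linD] scaleR_scaleR[symmetric] del: scaleR_scaleR)
    show "norm (?L h) \<le> norm h * (M * (\<integral>z. norm (v z) \<partial>lborel))" for h
    proof -
      have "norm (?L h) \<le> (\<integral>z. norm (?D (y - z) h *\<^sub>R v z) \<partial>lborel)"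
        unfolding convolve_def by (rule integral_norm_bound)
      also have "\<dots> \<le> (\<integral>z. (M * norm h) * norm (v z) \<partial>lborel)"
      proof (rule integral_mono)
        show "integrable lborel (\<lambda>z. norm (?D (y - z) h *\<^sub>R v z))" using intD by (rule integrable_norm)
        show "integrable lborel (\<lambda>z. (M * norm h) * norm (v z))" using intv by simp
        show "norm (?D (y - z) h *\<^sub>R v z) \<le> M * norm h * norm (v z)" for z
          using M(3) by (simp add: mult_right_mono)
      qed
      finally show ?thesis by (simp add: mult_ac)
    qed
  qed
  moreover have "((\<lambda>h. norm (convolve \<rho> v (y + h) - convolve \<rho> v y - ?L h) / norm h) \<longlongrightarrow> 0) (at 0)"
  proof (rule tendsto_at_iff_sequentially[THEN iffD2], intro allI impI)
    fix X :: "nat \<Rightarrow> 'a" assume X0: "\<forall>i. X i \<in> UNIV - {0}" and X: "X \<longlonglongrightarrow> 0"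
    let ?q = "\<lambda>i z. ((\<rho> (y + X i - z) - \<rho> (y - z) - ?D (y - z) (X i)) / norm (X i)) *\<^sub>R v z"
    have Xn: "norm (X i) > 0" for i using X0 by simp
    have eq: "(1 / norm (X i)) *\<^sub>R (convolve \<rho> v (y + X i) - convolve \<rho> v y - ?L (X i)) = (\<integral>z. ?q i z \<partial>lborel)" for i
    proof -
      have "convolve \<rho> v (y + X i) - convolve \<rho> v y - ?L (X i) =
          (\<integral>z. \<rho> (y + X i - z) *\<^sub>R v z - \<rho> (y - z) *\<^sub>R v z - ?D (y - z) (X i) *\<^sub>R v z \<partial>lborel)"
        unfolding convolve_def using intD int\<rho>
        by (simp add: Bochner_Integration.integral_diff Bochner_Integration.integrable_diff)
      then show ?thesis
        by (simp add: integral_scaleR_right[symmetric] scaleR_diff_left[symmetric] divide_inverse mult.commute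
            del: integral_scaleR_right)
    qed
    have "(\<lambda>i. \<integral>z. ?q i z \<partial>lborel) \<longlonglongrightarrow> (\<integral>z. (0::'b) \<partial>(lborel::'a measure))"
    proof (rule integral_dominated_convergence)
      show "integrable lborel (\<lambda>z. (2 * M) * norm (v z))" using intv by simp
      show "AE z in lborel. norm (?q i z) \<le> 2 * M * norm (v z)" for i
      proof (intro AE_I2)
        fix z
        have "\<bar>\<rho> (y + X i - z) - \<rho> (y - z) - ?D (y - z) (X i)\<bar> \<le> M * norm (X i) + M * norm (X i)"
          using M(2)[of "y + X i - z" "y - z"] M(3)[of "y - z" "X i"] by simp
        then have "\<bar>\<rho> (y + X i - z) - \<rho> (y - z) - ?D (y - z) (X i)\<bar> / norm (X i) \<le> 2 * M"
          using Xn[of i] by (simp add: divide_le_eq)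
        then show "norm (?q i z) \<le> 2 * M * norm (v z)"
          using mult_right_mono[OF _ norm_ge_zero[of "v z"]] by fastforce
      qed
      show "AE z in lborel. (\<lambda>i. ?q i z) \<longlonglongrightarrow> 0"
      proof (intro AE_I2)
        fix z
        have "(\<lambda>h. norm (\<rho> (y - z + h) - \<rho> (y - z) - ?D (y - z) h) / norm h) \<midarrow>0\<rightarrow> 0"
          using smooth_has_derivative[OF sm, of "y - z"] by (simp add: has_derivative_at)
        then have "(\<lambda>i. norm (\<rho> (y - z + X i) - \<rho> (y - z) - ?D (y - z) (X i)) / norm (X i)) \<longlonglongrightarrow> 0"
          using X X0 by (simp add: tendsto_at_iff_sequentially comp_def)
        then have "(\<lambda>i. norm ((\<rho> (y + X i - z) - \<rho> (y - z) - ?D (y - z) (X i)) / norm (X i))) \<longlonglongrightarrow> 0"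
          by (simp add: algebra_simps)
        then have "(\<lambda>i. (\<rho> (y + X i - z) - \<rho> (y - z) - ?D (y - z) (X i)) / norm (X i)) \<longlonglongrightarrow> 0"
          by (rule tendsto_norm_zero_cancel)
        from tendsto_scaleR[OF this tendsto_const[of "v z"]]
        show "(\<lambda>i. ?q i z) \<longlonglongrightarrow> 0" by simp
      qed
    qed simp_all
    then have "(\<lambda>i. norm (\<integral>z. ?q i z \<partial>lborel)) \<longlonglongrightarrow> 0"
      by (intro tendsto_norm_zero) simp
    then show "((\<lambda>h. norm (convolve \<rho> v (y + h) - convolve \<rho> v y - ?L h) / norm h) \<circ> X) \<longlonglongrightarrow> 0"
      unfolding eq[symmetric] by (simp add: comp_def)
  qed
  ultimately show ?thesis by (simp add: has_derivative_at)
qed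

lemma smooth_convolve:
  fixes v :: "'a::euclidean_space \<Rightarrow> 'b::euclidean_space"
  assumes v: "integrable lborel v" and "smooth \<rho>" "bounded {x. \<rho> x \<noteq> 0}"
  shows "smooth (convolve \<rho> v)"
  unfolding smooth_def
proof
  fix k show "Ck k (convolve \<rho> v)"
    using assms(2,3)
  proof (induction k arbitrary: \<rho>)
    case 0
    then show ?case
      using convolve_has_derivative[OF v 0]
      by (auto intro!: continuous_at_imp_continuous_on has_derivative_continuous)
  next
    case (Suc k)
    show ?case
      by (rule Ck_SucI[OF convolve_has_derivative[OF v Suc.prems]])
        (intro Suc.IH smooth_frechet_derivative frechet_derivative_bounded_support Suc.prems)
  qed
qed

lemma convolve_bounded_support:
  fixes v :: "'a::euclidean_space \<Rightarrow> 'b::euclidean_space"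
  assumes "\<And>x. r \<le> norm x \<Longrightarrow> \<rho> x = 0" "\<And>z. R < norm z \<Longrightarrow> v z = 0"
  shows "bounded {y. convolve \<rho> v y \<noteq> 0}"
proof -
  have "convolve \<rho> v y = 0" if "norm y > R + r" for y
  proof -
    have "\<rho> (y - z) *\<^sub>R v z = 0" for z
      using assms(1)[of "y - z"] assms(2)[of z] norm_triangle_sub[of y z] that by (cases "norm z > R") auto
    then have "(\<lambda>z. \<rho> (y - z) *\<^sub>R v z) = (\<lambda>z. 0)" by (rule ext)
    then show ?thesis by (simp add: convolve_def)
  qed
  then show ?thesis by (auto simp: bounded_iff intro!: exI[of _ "R + r"] leI)
qed

text \<open>Hoelder with respect to the probability density \<open>\<rho> (y - \<cdot>)\<close>, then
  integration over \<open>y\<close>.\<close>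

lemma convolve_Lp_bound:
  fixes g :: "'a::euclidean_space \<Rightarrow> 'b::euclidean_space"
  assumes p: "p > 1" and [measurable]: "g \<in> borel_measurable borel" "\<rho> \<in> borel_measurable borel"
    and \<rho>: "\<And>x. 0 \<le> \<rho> x" "(\<integral>\<^sup>+x. ennreal (\<rho> x) \<partial>lborel) = 1"
  shows "(\<integral>\<^sup>+y. ennreal (norm (convolve \<rho> g y) powr p) \<partial>lborel) \<le> (\<integral>\<^sup>+z. ennreal (norm (g z) powr p) \<partial>lborel)"
proof -
  have \<rho>1: "(\<integral>\<^sup>+z. ennreal (\<rho> (y - z)) \<partial>lborel) = 1" for y
    using nn_integral_lborel_reflect[of "\<lambda>x. ennreal (\<rho> x)" y] \<rho>(2) by simp
  have \<rho>2: "(\<integral>\<^sup>+y. ennreal (\<rho> (y - z)) \<partial>lborel) = 1" for z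
    using nn_integral_lborel_translate[of "\<lambda>x. ennreal (\<rho> x)" z] \<rho>(2) by simp
  have pt: "ennreal (norm (convolve \<rho> g y) powr p) \<le> (\<integral>\<^sup>+z. ennreal (\<rho> (y - z)) * ennreal (norm (g z) powr p) \<partial>lborel)" for y
  proof -
    let ?I = "\<integral>\<^sup>+z. ennreal (\<rho> (y - z)) * ennreal (norm (g z) powr p) \<partial>lborel"
    have "ennreal (norm (convolve \<rho> g y)) \<le> (\<integral>\<^sup>+z. ennreal (norm (\<rho> (y - z) *\<^sub>R g z)) \<partial>lborel)"
    proof (cases "integrable lborel (\<lambda>z. \<rho> (y - z) *\<^sub>R g z)")
      case True
      then show ?thesis unfolding convolve_def by (rule integral_norm_bound_ennreal)
    qed (simp add: convolve_def not_integrable_integral_eq)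
    also have "\<dots> = (\<integral>\<^sup>+z. (\<Prod>c\<in>UNIV. epow (if c then ennreal (\<rho> (y - z)) * ennreal (norm (g z) powr p) else ennreal (\<rho> (y - z)))
         (if c then 1 / p else 1 - 1 / p)) \<partial>lborel)"
    proof (intro nn_integral_cong)
      fix z
      have "\<rho> (y - z) powr (1 / p) * \<rho> (y - z) powr (1 - 1 / p) = \<rho> (y - z)"
        using \<rho>(1)[of "y - z"] by (cases "\<rho> (y - z) = 0") (simp_all add: powr_add[symmetric])
      moreover have "(\<rho> (y - z) * norm (g z) powr p) powr (1 / p) = \<rho> (y - z) powr (1 / p) * norm (g z)"
        using p \<rho>(1)[of "y - z"] by (simp add: powr_mult powr_powr)
      ultimately show "ennreal (norm (\<rho> (y - z) *\<^sub>R g z)) = (\<Prod>c\<in>UNIV. epow (if c then ennreal (\<rho> (y - z)) * ennreal (norm (g z) powr p) else ennreal (\<rho> (y - z)))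
         (if c then 1 / p else 1 - 1 / p))"
        using p \<rho>(1)[of "y - z"]
        by (simp add: UNIV_bool epow_ennreal ennreal_mult[symmetric] mult_ac)
    qed
    also have "\<dots> \<le> (\<Prod>c\<in>UNIV. epow (\<integral>\<^sup>+z. (if c then ennreal (\<rho> (y - z)) * ennreal (norm (g z) powr p) else ennreal (\<rho> (y - z))) \<partial>lborel)
         (if c then 1 / p else 1 - 1 / p))"
      using p by (intro nn_integral_Holder) (auto simp: UNIV_bool)
    also have "\<dots> = epow ?I (1 / p)"
      by (simp add: UNIV_bool \<rho>1) (simp add: epow_def)
    finally have "epow (ennreal (norm (convolve \<rho> g y))) p \<le> epow (epow ?I (1 / p)) p"
      using p by (intro epow_mono) auto
    also have "epow (epow ?I (1 / p)) p = ?I"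
      using p by (cases ?I) (auto simp: epow_def powr_powr)
    finally show ?thesis using p by (simp add: epow_ennreal)
  qed
  have "(\<integral>\<^sup>+y. ennreal (norm (convolve \<rho> g y) powr p) \<partial>lborel)
      \<le> (\<integral>\<^sup>+y. (\<integral>\<^sup>+z. ennreal (\<rho> (y - z)) * ennreal (norm (g z) powr p) \<partial>lborel) \<partial>lborel)"
    by (intro nn_integral_mono pt)
  also have "\<dots> = (\<integral>\<^sup>+z. (\<integral>\<^sup>+y. ennreal (\<rho> (y - z)) * ennreal (norm (g z) powr p) \<partial>lborel) \<partial>lborel)"
    by (rule lborel_pair.Fubini') measurable
  also have "\<dots> = (\<integral>\<^sup>+z. ennreal (norm (g z) powr p) \<partial>lborel)"
    by (simp add: nn_integral_multc \<rho>2)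
  finally show ?thesis .
qed

text \<open>The error at \<open>y\<close> is an average of \<open>v (y - w) - v y\<close> over small
  \<open>w\<close>, so its integral is at most the largest \<open>L\<^sup>1\<close> distance
  between \<open>v\<close> and a translate by a small vector.\<close>

lemma convolve_tendsto_L1:
  fixes v :: "'a::euclidean_space \<Rightarrow> 'b::euclidean_space"
  assumes v: "integrable lborel v"
    and sm: "\<And>k. smooth (\<rho> k)" and pos: "\<And>k x. 0 \<le> \<rho> k x"
    and supp: "\<And>k x. 1 / real (Suc k) \<le> norm x \<Longrightarrow> \<rho> k x = 0"
    and int1: "\<And>k. (\<integral>\<^sup>+x. ennreal (\<rho> k x) \<partial>lborel) = 1"
  shows "(\<lambda>k. \<integral>\<^sup>+y. ennreal (norm (convolve (\<rho> k) v y - v y)) \<partial>lborel) \<longlonglongrightarrow> 0"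
proof (rule tendsto_sandwich[of "\<lambda>_. 0" _ _ "\<lambda>k. SUP w\<in>ball 0 (1 / real (Suc k)). \<integral>\<^sup>+y. ennreal (norm (v (y - w) - v y)) \<partial>lborel"])
  have [measurable]: "\<And>k. \<rho> k \<in> borel_measurable borel" using sm by (auto intro: smooth_borel_measurable)
  have [measurable]: "v \<in> borel_measurable borel" using v by auto
  have bd: "bounded {x. \<rho> k x \<noteq> 0}" for k
    using supp[of k] by (auto simp: bounded_iff intro!: exI[of _ "1 / real (Suc k)"]) (meson le_cases)
  have int\<rho>: "integrable lborel (\<rho> k)" for k
    by (rule integrable_continuous_bounded_support[OF smooth_continuous_on[OF sm] bd])
  have \<rho>1: "(\<integral>\<^sup>+z. ennreal (\<rho> k (y - z)) \<partial>lborel) = 1" for y k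
    using nn_integral_lborel_reflect[of "\<lambda>x. ennreal (\<rho> k x)" y] int1 by simp
  let ?S = "\<lambda>k. SUP w\<in>ball 0 (1 / real (Suc k)). \<integral>\<^sup>+y. ennreal (norm (v (y - w) - v y)) \<partial>lborel"
  have "(\<integral>\<^sup>+y. ennreal (norm (convolve (\<rho> k) v y - v y)) \<partial>lborel) \<le> ?S k" for k
  proof -
    have pt: "ennreal (norm (convolve (\<rho> k) v y - v y)) \<le> (\<integral>\<^sup>+w. ennreal (\<rho> k w) * ennreal (norm (v (y - w) - v y)) \<partial>lborel)" for y
    proof -
      have i1: "integrable lborel (\<lambda>z. \<rho> k (y - z))"
        by (rule integrableI_nonneg) (auto simp: pos \<rho>1)
      have "(\<integral>z. \<rho> k (y - z) \<partial>lborel) = 1"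
        by (rule integral_eq_nn_integral[THEN trans]) (auto simp: pos \<rho>1)
      then have "v y = (\<integral>z. \<rho> k (y - z) *\<^sub>R v y \<partial>lborel)"
        by (subst integral_scaleR_left) (auto simp: i1)
      moreover have i2: "integrable lborel (\<lambda>z. \<rho> k (y - z) *\<^sub>R v z)"
        by (rule integrable_convolve[OF v smooth_continuous_on[OF sm] bd])
      ultimately have "convolve (\<rho> k) v y - v y = (\<integral>z. \<rho> k (y - z) *\<^sub>R (v z - v y) \<partial>lborel)"
        unfolding convolve_def using i1
        by (simp add: scaleR_diff_right Bochner_Integration.integral_diff)
      also have "ennreal (norm \<dots>) \<le> (\<integral>\<^sup>+z. ennreal (norm (\<rho> k (y - z) *\<^sub>R (v z - v y))) \<partial>lborel)"
        using i1 i2 by (intro integral_norm_bound_ennreal) (simp add: scaleR_diff_right)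
      also have "\<dots> = (\<integral>\<^sup>+w. ennreal (norm (\<rho> k (y - (y - w)) *\<^sub>R (v (y - w) - v y))) \<partial>lborel)"
        by (rule nn_integral_lborel_reflect[symmetric]) measurable
      finally show ?thesis by (simp add: ennreal_mult pos)
    qed
    have "(\<integral>\<^sup>+y. ennreal (norm (convolve (\<rho> k) v y - v y)) \<partial>lborel)
      \<le> (\<integral>\<^sup>+y. (\<integral>\<^sup>+w. ennreal (\<rho> k w) * ennreal (norm (v (y - w) - v y)) \<partial>lborel) \<partial>lborel)"
      by (intro nn_integral_mono pt)
    also have "\<dots> = (\<integral>\<^sup>+w. (\<integral>\<^sup>+y. ennreal (\<rho> k w) * ennreal (norm (v (y - w) - v y)) \<partial>lborel) \<partial>lborel)"
      by (rule lborel_pair.Fubini') measurable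
    also have "\<dots> = (\<integral>\<^sup>+w. ennreal (\<rho> k w) * (\<integral>\<^sup>+y. ennreal (norm (v (y - w) - v y)) \<partial>lborel) \<partial>lborel)"
      by (simp add: nn_integral_cmult)
    also have "\<dots> \<le> (\<integral>\<^sup>+w. ennreal (\<rho> k w) * ?S k \<partial>lborel)"
    proof (intro nn_integral_mono)
      fix w :: 'a
      show "ennreal (\<rho> k w) * (\<integral>\<^sup>+y. ennreal (norm (v (y - w) - v y)) \<partial>lborel) \<le> ennreal (\<rho> k w) * ?S k"
      proof (cases "w \<in> ball 0 (1 / real (Suc k))")
        case True
        then show ?thesis by (intro mult_left_mono SUP_upper) auto
      next
        case False
        then show ?thesis using supp[of k w] by simp
      qed
    qed
    also have "\<dots> = ?S k" by (simp add: nn_integral_multc int1)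
    finally show ?thesis .
  qed
  then show "eventually (\<lambda>k. (\<integral>\<^sup>+y. ennreal (norm (convolve (\<rho> k) v y - v y)) \<partial>lborel) \<le> ?S k) sequentially"
    by simp
  show "?S \<longlonglongrightarrow> 0"
  proof (rule order_tendstoI)
    fix a :: ennreal assume a: "0 < a"
    obtain b where b: "0 < b" "b < a" using dense[OF a] by blast
    then have "b \<noteq> \<infinity>" by auto
    with b obtain e where e: "e > 0" "ennreal e < a"
      by (cases b) auto
    obtain d where d: "d > 0"
      "\<And>w. norm w < d \<Longrightarrow> (\<integral>\<^sup>+y. ennreal (norm (v (y - w) - v y)) \<partial>lborel) \<le> ennreal e"
      using L1_translation_continuous[OF v e(1)] by blast
    have "eventually (\<lambda>k. 1 / real (Suc k) < d) sequentially"
      using order_tendstoD(2)[OF LIMSEQ_inverse_real_of_nat d(1)] by (simp add: inverse_eq_divide)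
    then show "eventually (\<lambda>k. ?S k < a) sequentially"
    proof (rule eventually_mono)
      fix k assume k: "1 / real (Suc k) < d"
      have "?S k \<le> ennreal e"
        using k by (intro SUP_least d(2)) (auto simp: dist_norm)
      then show "?S k < a" using e(2) by (rule le_less_trans)
    qed
  qed simp
qed auto

section \<open>The Sobolev inequality for weakly differentiable functions\<close>

text \<open>Testing the weak gradient identity with \<open>z \<mapsto> \<rho> (y - z)\<close> identifies
  the gradient of the mollified function with the mollified weak gradient, whose norm is not
  larger. The sharp inequality for the mollified functions passes to an almost everywhere
  convergent subsequence by Fatou's lemma. Since \<open>v\<close> vanishes outside a ball, the
  test functions may have arbitrary support.\<close>

theorem sobolev_inequality_weak:
  fixes v :: "real ^ 'n \<Rightarrow> real" and g :: "real ^ 'n \<Rightarrow> real ^ 'n"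
  assumes p: "1 < p" "p < real CARD('n)"
    and v: "integrable lborel v" and g: "integrable lborel g"
    and supp: "\<And>z. R < norm z \<Longrightarrow> v z = 0"
    and weak: "\<And>\<psi> e. smooth \<psi> \<Longrightarrow>
      (\<integral>z. v z * frechet_derivative \<psi> (at z) e \<partial>lborel) = - (\<integral>z. (g z \<bullet> e) * \<psi> z \<partial>lborel)"
    and gp: "integrable lborel (\<lambda>z. norm (g z) powr p)"
  shows "(\<integral>\<^sup>+z. ennreal (\<bar>v z\<bar> powr sobolev_exponent CARD('n) p) \<partial>lborel)
    \<le> ennreal ((sobolev_const TYPE('n) p * Lp_norm p lborel g) powr sobolev_exponent CARD('n) p)"
proof -
  define s where "s = sobolev_exponent CARD('n) p"
  have s0: "s > 0" using p by (simp add: s_def sobolev_exponent_def)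
  let ?S = "sobolev_const TYPE('n) p"
  have S0: "?S \<ge> 0" by (rule sobolev_const_nonneg[OF p])
  have [measurable]: "v \<in> borel_measurable borel" "g \<in> borel_measurable borel" using v g by auto
  obtain \<rho> :: "nat \<Rightarrow> real ^ 'n \<Rightarrow> real" where
    sm: "\<And>k. smooth (\<rho> k)" and pos: "\<And>k x. 0 \<le> \<rho> k x"
    and \<rho>supp: "\<And>k x. 1 / real (Suc k) \<le> norm x \<Longrightarrow> \<rho> k x = 0"
    and int1: "\<And>k. (\<integral>\<^sup>+x. ennreal (\<rho> k x) \<partial>lborel) = 1"
  proof -
    have "\<forall>k. \<exists>\<rho> :: real ^ 'n \<Rightarrow> real. smooth \<rho> \<and> (\<forall>x. 0 \<le> \<rho> x) \<and>
        (\<forall>x. 1 / real (Suc k) \<le> norm x \<longrightarrow> \<rho> x = 0) \<and> (\<integral>\<^sup>+x. ennreal (\<rho> x) \<partial>lborel) = 1"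
      by (intro allI mollifier_exists) simp
    then show thesis using that by metis
  qed
  have [measurable]: "\<And>k. \<rho> k \<in> borel_measurable borel" using sm by (auto intro: smooth_borel_measurable)
  have bd: "bounded {x. \<rho> k x \<noteq> 0}" for k
    using \<rho>supp[of k] by (auto simp: bounded_iff intro!: exI[of _ "1 / real (Suc k)"]) (meson le_cases)
  define w where "w k = convolve (\<rho> k) v" for k
  have smw: "smooth (w k)" for k unfolding w_def by (rule smooth_convolve[OF v sm bd])
  have [measurable]: "\<And>k. w k \<in> borel_measurable borel" using smw by (auto intro: smooth_borel_measurable)
  have bdw: "bounded {x. w k x \<noteq> 0}" for k
    unfolding w_def by (rule convolve_bounded_support[OF \<rho>supp supp])
  have dw: "frechet_derivative (w k) (at y) e = convolve (\<rho> k) g y \<bullet> e" for k y e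
  proof -
    let ?\<psi> = "\<lambda>z. \<rho> k (y - z)"
    have sm\<psi>: "smooth ?\<psi>"
      using smooth_compose_affine[OF sm, of "\<lambda>z. - z" k y] by (simp add: bounded_linear_minus bounded_linear_ident)
    \<comment> \<open>The test function depends on z through y - z, hence the sign.\<close>
    have d\<psi>: "frechet_derivative ?\<psi> (at z) e = - frechet_derivative (\<rho> k) (at (y - z)) e" for z
    proof -
      have "(?\<psi> has_derivative (\<lambda>h. frechet_derivative (\<rho> k) (at (y - z)) (- h))) (at z)"
        by (rule has_derivative_compose[OF _ smooth_has_derivative[OF sm], of "\<lambda>z. y - z"])
           (auto intro!: derivative_eq_intros)
      from frechet_derivative_at[OF this]
      show ?thesis
        using linear_neg[OF has_derivative_linear[OF smooth_has_derivative[OF sm]]] by metis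
    qed
    have "frechet_derivative (w k) (at y) e = (\<integral>z. frechet_derivative (\<rho> k) (at (y - z)) e *\<^sub>R v z \<partial>lborel)"
      unfolding w_def frechet_derivative_at[OF convolve_has_derivative[OF v sm bd], symmetric]
      by (simp add: convolve_def)
    also have "\<dots> = - (\<integral>z. v z * frechet_derivative ?\<psi> (at z) e \<partial>lborel)"
      by (simp add: d\<psi> mult.commute)
    also have "\<dots> = (\<integral>z. (\<rho> k (y - z) *\<^sub>R g z) \<bullet> e \<partial>lborel)"
      using weak[OF sm\<psi>, of e] by (simp add: mult.commute)
    also have "\<dots> = convolve (\<rho> k) g y \<bullet> e"
      unfolding convolve_def
      by (rule integral_inner_left) (intro integrable_convolve g smooth_continuous_on sm bd)
    finally show ?thesis .
  qed
  have gw: "gradient (w k) y = convolve (\<rho> k) g y" for k y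
    by (simp add: gradient_def dw inner_axis vec_eq_iff)
  define N where "N = Lp_norm p lborel g"
  have gradle: "Lp_norm p lborel (gradient (w k)) \<le> N" for k
  proof -
    have int: "integrable lborel (\<lambda>x. norm (gradient (w k) x) powr p)"
      using p by (intro integrable_powr_bounded_support continuous_on_gradient smw gradient_bounded_support bdw) auto
    have "ennreal (\<integral>y. norm (gradient (w k) y) powr p \<partial>lborel) = (\<integral>\<^sup>+y. ennreal (norm (convolve (\<rho> k) g y) powr p) \<partial>lborel)"
      using nn_integral_eq_integral[OF int] by (simp add: gw)
    also have "\<dots> \<le> (\<integral>\<^sup>+z. ennreal (norm (g z) powr p) \<partial>lborel)"
      by (rule convolve_Lp_bound[OF p(1)]) (auto simp: pos int1)
    also have "\<dots> = ennreal (\<integral>z. norm (g z) powr p \<partial>lborel)"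
      by (rule nn_integral_eq_integral[OF gp]) simp
    finally have "(\<integral>y. norm (gradient (w k) y) powr p \<partial>lborel) \<le> (\<integral>z. norm (g z) powr p \<partial>lborel)"
      by (subst (asm) ennreal_le_iff) auto
    then show ?thesis
      unfolding N_def Lp_norm_def using p by (intro powr_mono2) auto
  qed
  have wbound: "(\<integral>\<^sup>+z. ennreal (\<bar>w k z\<bar> powr s) \<partial>lborel) \<le> ennreal ((?S * N) powr s)" for k
  proof -
    have int: "integrable lborel (\<lambda>x. \<bar>w k x\<bar> powr s)"
      using integrable_powr_bounded_support[OF smooth_continuous_on[OF smw] bdw s0] by simp
    have "Lp_norm s lborel (w k) \<le> ?S * Lp_norm p lborel (gradient (w k))"
      unfolding s_def by (rule sobolev_inequality_sharp[OF p smw bdw])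
    also have "\<dots> \<le> ?S * N" by (intro mult_left_mono gradle S0)
    finally have "Lp_norm s lborel (w k) powr s \<le> (?S * N) powr s"
      using s0 by (intro powr_mono2) (auto simp: Lp_norm_def)
    then have "(\<integral>z. \<bar>w k z\<bar> powr s \<partial>lborel) \<le> (?S * N) powr s"
      using s0 by (simp add: Lp_norm_def powr_powr)
    then show ?thesis
      by (subst nn_integral_eq_integral[OF int]) (auto intro: ennreal_leI)
  qed
  have intw: "integrable lborel (w k)" for k
    by (rule integrable_continuous_bounded_support[OF smooth_continuous_on[OF smw] bdw])
  have "(\<lambda>k. \<integral>y. norm (w k y - v y) \<partial>lborel) \<longlonglongrightarrow> 0"
  proof -
    have "(\<lambda>k. ennreal (\<integral>y. norm (w k y - v y) \<partial>lborel)) \<longlonglongrightarrow> ennreal 0"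
    proof -
      have "(\<integral>\<^sup>+y. ennreal (norm (w k y - v y)) \<partial>lborel) = ennreal (\<integral>y. norm (w k y - v y) \<partial>lborel)" for k
        using intw v by (intro nn_integral_eq_integral) auto
      then show ?thesis
        using convolve_tendsto_L1[OF v sm pos \<rho>supp int1] by (simp add: w_def)
    qed
    then show ?thesis by (subst (asm) tendsto_ennreal_iff) auto
  qed
  then obtain r where r: "strict_mono r" "AE x in lborel. (\<lambda>k. w (r k) x - v x) \<longlonglongrightarrow> 0"
    using tendsto_L1_AE_subseq[of lborel "\<lambda>k x. w k x - v x"] intw v by auto
  have "(\<integral>\<^sup>+z. ennreal (\<bar>v z\<bar> powr s) \<partial>lborel) = (\<integral>\<^sup>+z. liminf (\<lambda>k. ennreal (\<bar>w (r k) z\<bar> powr s)) \<partial>lborel)"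
  proof (rule nn_integral_cong_AE)
    show "AE z in lborel. ennreal (\<bar>v z\<bar> powr s) = liminf (\<lambda>k. ennreal (\<bar>w (r k) z\<bar> powr s))"
      using r(2)
    proof (rule AE_mp, intro AE_I2 impI)
      fix z assume "(\<lambda>k. w (r k) z - v z) \<longlonglongrightarrow> 0"
      then have "(\<lambda>k. w (r k) z) \<longlonglongrightarrow> v z" by (simp add: LIM_zero_iff)
      then have "(\<lambda>k. \<bar>w (r k) z\<bar> powr s) \<longlonglongrightarrow> \<bar>v z\<bar> powr s"
        using s0 by (intro tendsto_powr' tendsto_rabs tendsto_const) auto
      then have "(\<lambda>k. ennreal (\<bar>w (r k) z\<bar> powr s)) \<longlonglongrightarrow> ennreal (\<bar>v z\<bar> powr s)"
        by (rule tendsto_ennrealI)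
      then show "ennreal (\<bar>v z\<bar> powr s) = liminf (\<lambda>k. ennreal (\<bar>w (r k) z\<bar> powr s))"
        by (intro lim_imp_Liminf[symmetric]) auto
    qed
  qed
  also have "\<dots> \<le> liminf (\<lambda>k. \<integral>\<^sup>+z. ennreal (\<bar>w (r k) z\<bar> powr s) \<partial>lborel)"
    by (rule nn_integral_liminf) measurable
  also have "\<dots> \<le> liminf (\<lambda>k::nat. ennreal ((?S * N) powr s))"
    by (intro Liminf_mono always_eventually allI wbound)
  also have "\<dots> = ennreal ((?S * N) powr s)"
    by (simp add: Liminf_const)
  finally show ?thesis unfolding s_def N_def .
qed

section \<open>Surface measure in an orthogonal projection chart\<close>

text \<open>The image of Lebesgue measure is invariant under translations and reflections, hence
  proportional to Lebesgue measure, and the unit ball has the same volume on both sides.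
  Concretely, evaluate the double integral of \<open>1\<^sub>A (L w) 1\<^sub>B (y - L
  w)\<close>, with \<open>B\<close> the unit ball, in both orders.\<close>

lemma distr_lborel_linear_isometry:
  fixes L :: "'a::euclidean_space \<Rightarrow> 'b::euclidean_space"
  assumes lin: "linear L" and iso: "\<And>x. norm (L x) = norm x" and surj: "surj L"
  shows "distr lborel borel L = lborel"
proof (rule measure_eqI)
  have dim: "DIM('a) = DIM('b)"
  proof -
    have "inj L" using linear_injective_0[OF lin] iso by (metis norm_eq_zero)
    then have "dim (range L) = dim (UNIV :: 'a set)"
      using lin by (intro dim_image_eq) auto
    then show ?thesis using surj by simp
  qed
  have [measurable]: "L \<in> borel_measurable borel"
    by (intro borel_measurable_continuous_onI linear_continuous_on linear_conv_bounded_linear[THEN iffD1] lin)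
  fix A assume "A \<in> sets (distr lborel borel L)"
  then have [measurable]: "A \<in> sets borel" by simp
  let ?B = "ball (0::'b) 1"
  let ?a = "indicator A :: 'b \<Rightarrow> ennreal" and ?b = "indicator ?B :: 'b \<Rightarrow> ennreal"
  have am [measurable]: "?a \<in> borel_measurable borel" and bm [measurable]: "?b \<in> borel_measurable borel"
    by (intro borel_measurable_indicator; simp)+
  have "(\<integral>\<^sup>+w. (\<integral>\<^sup>+y. ?a (L w) * ?b (y - L w) \<partial>lborel) \<partial>lborel) = (\<integral>\<^sup>+w. ?a (L w) * emeasure lborel ?B \<partial>lborel)"
  proof (intro nn_integral_cong)
    fix w
    have "(\<integral>\<^sup>+y. ?b (y - L w) \<partial>lborel) = emeasure lborel ?B"
      using nn_integral_lborel_translate[OF bm, of "L w"] by simp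
    then show "(\<integral>\<^sup>+y. ?a (L w) * ?b (y - L w) \<partial>lborel) = ?a (L w) * emeasure lborel ?B"
      by (subst nn_integral_cmult) auto
  qed
  also have "\<dots> = emeasure (distr lborel borel L) A * emeasure lborel ?B"
    by (simp add: nn_integral_multc flip: nn_integral_distr[of L lborel borel ?a])
  finally have 1: "(\<integral>\<^sup>+w. (\<integral>\<^sup>+y. ?a (L w) * ?b (y - L w) \<partial>lborel) \<partial>lborel) = emeasure (distr lborel borel L) A * emeasure lborel ?B" .
  have "(\<integral>\<^sup>+w. (\<integral>\<^sup>+y. ?a (L w) * ?b (y - L w) \<partial>lborel) \<partial>lborel) = (\<integral>\<^sup>+y. (\<integral>\<^sup>+w. ?a (L w) * ?b (y - L w) \<partial>lborel) \<partial>lborel)"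
    by (rule lborel_pair.Fubini') measurable
  also have "\<dots> = (\<integral>\<^sup>+y. (\<integral>\<^sup>+w. ?a (y - L w) * ?b (L w) \<partial>lborel) \<partial>lborel)"
  proof (rule nn_integral_cong)
    fix y :: 'b
    \<comment> \<open>Reflecting w in the point that L maps to y/2 swaps the two indicator functions.\<close>
    obtain w0 where w0: "y = L w0" using surj by (metis surjD)
    have "(\<integral>\<^sup>+w. ?a (L w) * ?b (y - L w) \<partial>lborel) = (\<integral>\<^sup>+w. ?a (L (w0 - w)) * ?b (y - L (w0 - w)) \<partial>lborel)"
      by (rule nn_integral_lborel_reflect[symmetric]) measurable
    then show "(\<integral>\<^sup>+w. ?a (L w) * ?b (y - L w) \<partial>lborel) = (\<integral>\<^sup>+w. ?a (y - L w) * ?b (L w) \<partial>lborel)"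
      by (simp add: w0 linear_diff[OF lin])
  qed
  also have "\<dots> = (\<integral>\<^sup>+w. (\<integral>\<^sup>+y. ?a (y - L w) * ?b (L w) \<partial>lborel) \<partial>lborel)"
    by (rule lborel_pair.Fubini') measurable
  also have "\<dots> = (\<integral>\<^sup>+w. emeasure lborel A * indicator (ball (0::'a) 1) w \<partial>lborel)"
  proof (rule nn_integral_cong)
    fix w :: 'a
    have "(\<integral>\<^sup>+y. ?a (y - L w) \<partial>lborel) = emeasure lborel A"
      using nn_integral_lborel_translate[OF am, of "L w"] by simp
    then show "(\<integral>\<^sup>+y. ?a (y - L w) * ?b (L w) \<partial>lborel) = emeasure lborel A * indicator (ball 0 1) w"
      by (subst nn_integral_multc) (auto simp: indicator_def iso)
  qed
  also have "\<dots> = emeasure lborel A * emeasure lborel (ball (0::'a) 1)"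
    by (rule nn_integral_cmult_indicator) simp
  also have "emeasure lborel (ball (0::'a) 1) = emeasure lborel ?B"
    by (simp add: emeasure_ball dim)
  finally have "emeasure (distr lborel borel L) A * emeasure lborel ?B = emeasure lborel A * emeasure lborel ?B"
    using 1 by simp
  moreover have "unit_ball_vol (real DIM('b)) > 0"
    using Gamma_real_pos[of "real DIM('b) / 2 + 1"] by (simp add: unit_ball_vol_def add_nonneg_pos)
  then have "unit_ball_vol (real DIM('b)) \<noteq> 0" by linarith
  then have "emeasure lborel ?B \<noteq> 0" "emeasure lborel ?B \<noteq> \<infinity>"
    by (simp_all add: emeasure_ball)
  ultimately show "emeasure (distr lborel borel L) A = emeasure lborel A"
    by (metis ennreal_mult_divide_eq infinity_ennreal_def)
qed simp

lemma space_sphere_measure [simp]: "space sphere_measure = sphere (0::'a::euclidean_space) 1"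
  by (simp add: sphere_measure_def space_scale_measure space_restrict_space)

lemma sets_sphere_measure: "sets sphere_measure = sets (restrict_space borel (sphere (0::'a::euclidean_space) 1))"
  by (simp add: sphere_measure_def)

lemma borel_measurable_sphere_measure [measurable (raw)]:
  fixes f :: "'a::euclidean_space \<Rightarrow> 'b::topological_space"
  assumes "f \<in> borel_measurable borel"
  shows "f \<in> borel_measurable sphere_measure"
  using measurable_restrict_space1[OF assms, of "sphere 0 1"]
  by (subst measurable_cong_sets[OF sets_sphere_measure refl])

lemma sgn_measurable_sphere:
  "sgn \<in> restrict_space lborel (ball 0 1 - {0}) \<rightarrow>\<^sub>M restrict_space borel (sphere (0::'a::euclidean_space) 1)"
proof (rule measurable_restrict_space2)
  show "sgn \<in> space (restrict_space lborel (ball 0 1 - {0})) \<rightarrow> sphere (0::'a) 1"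
    by (auto simp: space_restrict_space norm_sgn)
  have "(\<lambda>x::'a. x /\<^sub>R norm x) \<in> borel_measurable borel" by measurable
  then have "(sgn :: 'a \<Rightarrow> 'a) \<in> borel_measurable borel" by (simp add: sgn_div_norm[abs_def])
  then show "(sgn :: 'a \<Rightarrow> 'a) \<in> borel_measurable (restrict_space lborel (ball 0 1 - {0}))"
    by (intro measurable_restrict_space1) simp
qed

lemma nn_integral_sphere_measure:
  fixes f :: "'a::euclidean_space \<Rightarrow> ennreal"
  assumes [measurable]: "f \<in> borel_measurable sphere_measure"
  shows "(\<integral>\<^sup>+x. f x \<partial>sphere_measure) =
    of_nat DIM('a) * (\<integral>\<^sup>+x. f (sgn x) * indicator (ball 0 1 - {0}) x \<partial>lborel)"
proof -
  have f: "f \<in> borel_measurable (restrict_space borel (sphere 0 1))"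
    using assms by (subst (asm) measurable_cong_sets[OF sets_sphere_measure refl])
  show ?thesis
  proof -
    have "(\<integral>\<^sup>+x. f x \<partial>distr (restrict_space lborel (ball 0 1 - {0})) (restrict_space borel (sphere 0 1)) sgn)
      = (\<integral>\<^sup>+x. f (sgn x) \<partial>restrict_space lborel (ball 0 1 - {0}))"
      by (rule nn_integral_distr[OF sgn_measurable_sphere]) (simp add: f)
    also have "\<dots> = (\<integral>\<^sup>+x. f (sgn x) * indicator (ball 0 1 - {0}) x \<partial>lborel)"
      by (rule nn_integral_restrict_space) simp
    finally show ?thesis
      unfolding sphere_measure_def by (subst nn_integral_scale_measure) (simp_all add: f)
  qed
qed

lemma finite_measure_sphere: "finite_measure (sphere_measure :: 'a::euclidean_space measure)"
proof
  have "emeasure (sphere_measure :: 'a measure) (space sphere_measure) = (\<integral>\<^sup>+x. 1 \<partial>(sphere_measure :: 'a measure))"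
    by simp
  also have "\<dots> = of_nat DIM('a) * (\<integral>\<^sup>+x. indicator (ball 0 1 - {0}) (x::'a) \<partial>lborel)"
    by (subst nn_integral_sphere_measure) simp_all
  also have "\<dots> \<le> of_nat DIM('a) * emeasure lborel (ball (0::'a) 1)"
    by (intro mult_left_mono) (auto intro!: emeasure_mono)
  also have "\<dots> < \<infinity>" 
    using emeasure_lborel_ball_finite[of "0::'a" 1]
    by (simp add: ennreal_mult_less_top ennreal_of_nat_eq_real_of_nat)
  finally show "emeasure (sphere_measure :: 'a measure) (space sphere_measure) \<noteq> \<infinity>" by simp
qed

interpretation sphere: finite_measure "sphere_measure :: 'a::euclidean_space measure"
  by (rule finite_measure_sphere)

lemma nn_integral_power_unit: "(\<integral>\<^sup>+r. ennreal (r ^ n) * indicator {0<..<1} r \<partial>lborel) = ennreal (1 / real (Suc n))"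
proof -
  have "(\<integral>\<^sup>+r. ennreal (r ^ n) * indicator {0<..<1::real} r \<partial>lborel) = (\<integral>\<^sup>+r. ennreal (r ^ n) * indicator {0..1::real} r \<partial>lborel)"
  proof (rule nn_integral_cong_AE)
    have "AE r in lborel. r \<noteq> (0::real) \<and> r \<noteq> 1" by (auto intro: AE_lborel_singleton)
    then show "AE r in lborel. ennreal (r ^ n) * indicator {0<..<1::real} r = ennreal (r ^ n) * indicator {0..1::real} r"
      by (rule AE_mp) (auto intro!: AE_I2 simp: indicator_def)
  qed
  also have "\<dots> = ennreal (1 ^ Suc n / real (Suc n) - 0 ^ Suc n / real (Suc n))"
  proof (rule nn_integral_FTC_Icc)
    show "((\<lambda>r. r ^ Suc n / real (Suc n)) has_real_derivative r ^ n) (at r)" for r :: real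
      using DERIV_cdivide[OF DERIV_pow[of "Suc n" r], of "real (Suc n)"] by simp
  qed auto
  finally show ?thesis by simp
qed

text \<open>Substitution \<open>r = sqrt (s\<^sup>2 + a\<^sup>2)\<close>, whose inverse has derivative
  \<open>1 / sqrt (1 - (a / r)\<^sup>2)\<close>. It exchanges the height of a point of the solid
  half ball for its distance from the origin.\<close>

lemma radial_substitution:
  fixes F :: "real \<Rightarrow> real" and a :: real
  assumes [measurable]: "F \<in> borel_measurable borel" and a: "a > 0"
  shows "(\<integral>\<^sup>+s. ennreal (F (sqrt (s\<^sup>2 + a\<^sup>2))) * indicator {s. 0 < s \<and> s\<^sup>2 + a\<^sup>2 < 1} s \<partial>lborel)
    = (\<integral>\<^sup>+r. ennreal (F r / sqrt (1 - (a / r)\<^sup>2)) * indicator {a<..<1} r \<partial>lborel)"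
proof (cases "a < 1")
  case False
  then have "1 \<le> a\<^sup>2" using a by (simp add: abs_square_less_1[of a] not_less[symmetric])
  then have "{s. 0 < s \<and> s\<^sup>2 + a\<^sup>2 < 1} = {}" by (auto simp: not_less) (smt (verit) zero_le_power2)
  moreover have "{a<..<1} = {}" using False by auto
  ultimately show ?thesis by simp
next
  case True
  define b where "b = sqrt (1 - a\<^sup>2)"
  have a2: "a\<^sup>2 < 1" using True a by (simp add: abs_square_less_1)
  then have b: "b > 0" "b\<^sup>2 = 1 - a\<^sup>2" by (auto simp: b_def)
  define g where "g s = sqrt (s\<^sup>2 + a\<^sup>2)" for s
  have pos: "s\<^sup>2 + a\<^sup>2 > 0" for s using a by (simp add: add_nonneg_pos)
  have gpos: "g s > 0" for s using pos by (simp add: g_def)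
  have g0: "g 0 = a" and gb: "g b = 1" using a b by (auto simp: g_def)
  define h where "h r = F r / sqrt (1 - (a / r)\<^sup>2)" for r
  have [measurable]: "h \<in> borel_measurable borel" unfolding h_def by measurable
  have sub: "(\<integral>\<^sup>+r. ennreal (h r * indicator {g 0..g b} r) \<partial>lborel) =
    (\<integral>\<^sup>+s. ennreal (h (g s) * (s / g s) * indicator {0..b} s) \<partial>lborel)"
  proof (rule nn_integral_substitution)
    show "(g has_real_derivative x / g x) (at x)" for x
      unfolding g_def using pos[of x] by (auto intro!: derivative_eq_intros simp: field_simps)
    show "continuous_on {0..b} (\<lambda>s. s / g s)"
      unfolding g_def using pos by (intro continuous_intros) (auto simp: less_imp_neq[symmetric])
  qed (use gpos b in \<open>auto simp: less_imp_le set_borel_measurable_def\<close>)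
  have ptl: "ennreal (F (g s)) * indicator {s. 0 < s \<and> s\<^sup>2 + a\<^sup>2 < 1} s = ennreal (h (g s) * (s / g s) * indicator {0..b} s)"
    if s: "s \<noteq> 0" "s \<noteq> b" for s
  proof (cases "0 < s \<and> s < b")
    case True
    then have "s\<^sup>2 < b\<^sup>2" by (intro power_strict_mono) auto
    then have "s\<^sup>2 + a\<^sup>2 < 1" using b by simp
    moreover have "h (g s) * (s / g s) = F (g s)"
    proof -
      have "1 - (a / g s)\<^sup>2 = (s / g s)\<^sup>2"
        using pos[of s] a by (simp add: g_def power_divide) (simp add: field_simps add_divide_distrib[symmetric])
      then have "sqrt (1 - (a / g s)\<^sup>2) = s / g s"
        using True gpos[of s] by simp
      then show ?thesis using True gpos[of s] by (simp add: h_def)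
    qed
    ultimately show ?thesis using True by simp
  next
    case False
    have "\<not> (0 < s \<and> s\<^sup>2 + a\<^sup>2 < 1)"
    proof
      assume *: "0 < s \<and> s\<^sup>2 + a\<^sup>2 < 1"
      then have "s\<^sup>2 < b\<^sup>2" using b by simp
      then have "s < b" by (rule power_less_imp_less_base) (use b in simp)
      with * False show False by simp
    qed
    then show ?thesis using False s by auto
  qed
  have "(\<integral>\<^sup>+s. ennreal (F (g s)) * indicator {s. 0 < s \<and> s\<^sup>2 + a\<^sup>2 < 1} s \<partial>lborel)
      = (\<integral>\<^sup>+s. ennreal (h (g s) * (s / g s) * indicator {0..b} s) \<partial>lborel)"
  proof (rule nn_integral_cong_AE)
    have "AE s in lborel. s \<noteq> (0::real) \<and> s \<noteq> b" by (auto intro: AE_lborel_singleton)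
    then show "AE s in lborel. ennreal (F (g s)) * indicator {s. 0 < s \<and> s\<^sup>2 + a\<^sup>2 < 1} s = ennreal (h (g s) * (s / g s) * indicator {0..b} s)"
      by (rule AE_mp, intro AE_I2 impI ptl) auto
  qed
  also have "\<dots> = (\<integral>\<^sup>+r. ennreal (h r * indicator {a..1} r) \<partial>lborel)"
    using sub by (simp add: g0 gb)
  also have "\<dots> = (\<integral>\<^sup>+r. ennreal (h r) * indicator {a<..<1} r \<partial>lborel)"
  proof (rule nn_integral_cong_AE)
    have "AE s in lborel. s \<noteq> (a::real) \<and> s \<noteq> 1" by (auto intro: AE_lborel_singleton)
    then show "AE r in lborel. ennreal (h r * indicator {a..1} r) = ennreal (h r) * indicator {a<..<1} r"
      by (rule AE_mp) (auto intro!: AE_I2 simp: indicator_def)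
  qed
  finally show ?thesis unfolding g_def h_def .
qed

text \<open>A linear isometry \<open>T\<close> onto the hyperplane orthogonal to the unit vector
  \<open>\<xi>\<close>. It parametrises the open half sphere around \<open>\<xi>\<close> by the
  unit ball.\<close>

locale sphere_chart =
  fixes \<xi> :: "real ^ 'k" and T :: "real ^ 'n \<Rightarrow> real ^ 'k"
  assumes card: "CARD('k) = CARD('n) + 1" and norm_xi: "norm \<xi> = 1"
    and linT: "linear T" and normT: "\<And>z. norm (T z) = norm z" and T_xi: "\<And>z. T z \<bullet> \<xi> = 0"

lemma sphere_chart_exists:
  fixes \<xi> :: "real ^ 'k"
  assumes card: "CARD('k) = CARD('n::finite) + 1" and xi: "\<xi> \<in> sphere 0 1"
  shows "\<exists>T :: real ^ 'n \<Rightarrow> real ^ 'k. sphere_chart \<xi> T"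
proof -
  have "\<xi> \<noteq> 0" using xi by auto
  then have "dim {x. \<xi> \<bullet> x = 0} = CARD('n)"
    using card by (simp add: dim_hyperplane)
  then obtain T :: "real ^ 'n \<Rightarrow> real ^ 'k" where T: "linear T" "T ` UNIV = {x. \<xi> \<bullet> x = 0}" "\<And>x. norm (T x) = norm x"
    by - (rule isometries_subspaces[of "UNIV :: (real ^ 'n) set" "{x. \<xi> \<bullet> x = 0}"],
      auto simp: subspace_hyperplane)
  have "sphere_chart \<xi> T"
  proof -
    have "T z \<bullet> \<xi> = 0" for z using T(2) by (auto simp: inner_commute)
    then show ?thesis unfolding sphere_chart_def using T card xi by simp
  qed
  then show ?thesis by (intro exI[of _ T])
qed

context sphere_chart
begin

lemma inner_T: "T z \<bullet> T w = z \<bullet> w"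
proof -
  have "(norm (T (z + w)))\<^sup>2 = (norm (z + w))\<^sup>2" "(norm (T z))\<^sup>2 = (norm z)\<^sup>2" "(norm (T w))\<^sup>2 = (norm w)\<^sup>2"
    by (simp_all add: normT)
  then show ?thesis
    by (simp add: linear_add[OF linT] power2_norm_eq_inner inner_add_left inner_add_right inner_commute)
qed

definition frame :: "real \<times> (real ^ 'n) \<Rightarrow> real ^ 'k" where
  "frame p = fst p *\<^sub>R \<xi> + T (snd p)"

lemma frame_linear: "linear frame"
  by (rule linearI) (auto simp: frame_def linear_add[OF linT] linear_scale[OF linT] algebra_simps)

lemma frame_inner_xi: "frame p \<bullet> \<xi> = fst p"
  using norm_xi by (simp add: frame_def inner_add_left T_xi power2_norm_eq_inner[symmetric])

lemma norm_frame: "norm (frame p) = sqrt ((fst p)\<^sup>2 + (norm (snd p))\<^sup>2)"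
proof -
  have "(norm (frame p))\<^sup>2 = (fst p)\<^sup>2 + (norm (snd p))\<^sup>2"
    using norm_xi T_xi unfolding power2_norm_eq_inner frame_def
    by (simp add: inner_add_left inner_add_right inner_T inner_commute power2_eq_square norm_eq_1)
  then show ?thesis by (metis norm_ge_zero real_sqrt_unique)
qed

lemma surj_frame: "surj frame"
proof -
  have inj: "inj T" using linear_injective_0[OF linT] normT by (metis norm_eq_zero)
  have "dim (range T) = CARD('n)"
    using dim_image_eq[of T UNIV] linT inj by (simp add: dim_UNIV)
  moreover have "range T \<subseteq> {x. \<xi> \<bullet> x = 0}" using T_xi by (auto simp: inner_commute)
  moreover have "\<xi> \<noteq> 0" using norm_xi by auto
  then have "dim {x. \<xi> \<bullet> x = 0} = CARD('n)" using card by (simp add: dim_hyperplane)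
  ultimately have rT: "range T = {x. \<xi> \<bullet> x = 0}"
    by (intro subspace_dim_equal) (auto simp: subspace_hyperplane linear_subspace_image[OF linT])
  show ?thesis
  proof (rule surjI)
    fix x
    have "\<xi> \<bullet> (x - (x \<bullet> \<xi>) *\<^sub>R \<xi>) = 0"
      using norm_xi by (simp add: inner_diff_right inner_commute norm_eq_1)
    then have "x - (x \<bullet> \<xi>) *\<^sub>R \<xi> \<in> range T" using rT by simp
    then have "T (inv T (x - (x \<bullet> \<xi>) *\<^sub>R \<xi>)) = x - (x \<bullet> \<xi>) *\<^sub>R \<xi>" by (rule f_inv_into_f)
    then show "frame (x \<bullet> \<xi>, inv T (x - (x \<bullet> \<xi>) *\<^sub>R \<xi>)) = x" by (simp add: frame_def)
  qed
qed

lemma distr_frame: "distr (lborel \<Otimes>\<^sub>M lborel) borel frame = lborel"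
  unfolding lborel_prod
  by (rule distr_lborel_linear_isometry[OF frame_linear _ surj_frame])
     (simp add: norm_frame norm_prod_def)

lemma frame_measurable [measurable]: "frame \<in> borel_measurable borel"
  by (intro borel_measurable_continuous_onI linear_continuous_on linear_conv_bounded_linear[THEN iffD1] frame_linear)

definition height :: "real ^ 'n \<Rightarrow> real" where
  "height z = sqrt (1 - (norm z)\<^sup>2)"

text \<open>Outside the unit ball the value \<open>\<xi>\<close> is a default that keeps the map inside
  the sphere.\<close>

definition chart :: "real ^ 'n \<Rightarrow> real ^ 'k" where
  "chart z = (if norm z < 1 then frame (height z, z) else \<xi>)"

lemma height_pos: "norm z < 1 \<Longrightarrow> height z > 0"
  by (simp add: height_def abs_square_less_1)

lemma height_measurable [measurable]: "height \<in> borel_measurable borel"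
  unfolding height_def[abs_def] by measurable

lemma chart_measurable [measurable]: "chart \<in> borel_measurable borel"
  unfolding chart_def[abs_def] by measurable

lemma chart_in_sphere: "chart z \<in> sphere 0 1"
proof (cases "norm z < 1")
  case True
  then have "(norm z)\<^sup>2 \<le> 1" by (simp add: abs_square_le_1)
  then show ?thesis using True by (simp add: chart_def norm_frame height_def)
qed (simp add: chart_def norm_xi)

lemma chart_inner_xi: "norm z < 1 \<Longrightarrow> chart z \<bullet> \<xi> = height z"
  by (simp add: chart_def frame_inner_xi)

definition chart_weight :: "real ^ 'n \<Rightarrow> real" where
  "chart_weight z = indicator (ball 0 1) z / height z"

lemma chart_weight_nonneg: "0 \<le> chart_weight z"
  using height_pos[of z] by (auto simp: chart_weight_def indicator_def less_imp_le)

lemma chart_weight_measurable [measurable]: "chart_weight \<in> borel_measurable borel"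
  unfolding chart_weight_def[abs_def]
  by (intro borel_measurable_divide borel_measurable_indicator height_measurable) simp

text \<open>The defining cone integral is computed in the coordinates height and projection. For a fixed
  projection, \<open>radial_substitution\<close> exchanges height for distance \<open>r\<close>
  from the origin; for a fixed \<open>r\<close>, scaling by \<open>r\<close> reduces to the unit
  sphere and produces \<open>r\<^sup>n\<close>, whose integral over the unit interval cancels
  the dimension factor in the definition of the surface measure.\<close>

lemma sphere_measure_half:
  assumes A: "A \<in> sets borel"
  shows "(\<integral>\<^sup>+x. indicator (A \<inter> {x. 0 < x \<bullet> \<xi>}) x \<partial>sphere_measure) =
    (\<integral>\<^sup>+z. ennreal (chart_weight z) * indicator A (chart z) \<partial>lborel)"
proof -
  note [measurable] = A
  let ?f = "indicator A :: real ^ 'k \<Rightarrow> real"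
  define H where "H z = ennreal (chart_weight z * ?f (chart z))" for z
  have [measurable]: "H \<in> borel_measurable borel" unfolding H_def by measurable
  define K where "K x = ennreal (?f (sgn x)) * indicator {x. 0 < x \<bullet> \<xi> \<and> norm x < 1} x" for x
  have sgnm [measurable]: "(sgn :: real ^ 'k \<Rightarrow> _) \<in> borel_measurable borel"
  proof -
    have "(\<lambda>x::real ^ 'k. x /\<^sub>R norm x) \<in> borel_measurable borel" by measurable
    then show ?thesis by (simp add: sgn_div_norm[abs_def])
  qed
  have [measurable]: "K \<in> borel_measurable borel" unfolding K_def by measurable
  have inner: "(\<integral>\<^sup>+s. K (frame (s, z)) \<partial>lborel) = (\<integral>\<^sup>+r. H (z /\<^sub>R r) * indicator {0<..<1} r \<partial>lborel)"
    if z: "z \<noteq> 0" for z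
  proof -
    define a where "a = norm z"
    have a: "a > 0" using z by (simp add: a_def)
    define F where "F r = ?f (frame (sqrt (1 - (a / r)\<^sup>2), z /\<^sub>R r))" for r
    have [measurable]: "F \<in> borel_measurable borel" unfolding F_def by measurable
    have "(\<integral>\<^sup>+s. K (frame (s, z)) \<partial>lborel)
       = (\<integral>\<^sup>+s. ennreal (F (sqrt (s\<^sup>2 + a\<^sup>2))) * indicator {s. 0 < s \<and> s\<^sup>2 + a\<^sup>2 < 1} s \<partial>lborel)"
    proof (rule nn_integral_cong)
      fix s :: real
      define r where "r = sqrt (s\<^sup>2 + a\<^sup>2)"
      have r: "r > 0" using a by (simp add: r_def add_nonneg_pos)
      have nf: "norm (frame (s, z)) = r" by (simp add: norm_frame r_def a_def)
      show "K (frame (s, z)) = ennreal (F (sqrt (s\<^sup>2 + a\<^sup>2))) * indicator {s. 0 < s \<and> s\<^sup>2 + a\<^sup>2 < 1} s"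
      proof (cases "0 < s")
        case True
        \<comment> \<open>At distance r from the origin the point of height s over z is r times the chart
            point over z / r.\<close>
        have "1 - (a / r)\<^sup>2 = (s / r)\<^sup>2"
        proof -
          have "r\<^sup>2 = s\<^sup>2 + a\<^sup>2" by (simp add: r_def)
          moreover have "s\<^sup>2 + a\<^sup>2 > 0" using a by (simp add: add_nonneg_pos)
          ultimately show ?thesis using a by (simp add: power_divide) (simp add: field_simps add_divide_distrib[symmetric])
        qed
        then have "sqrt (1 - (a / r)\<^sup>2) = s / r" using True r by simp
        then have "F r = ?f (frame ((1 / r) *\<^sub>R (s, z)))"
          by (simp add: F_def divide_inverse mult.commute)
        also have "frame ((1 / r) *\<^sub>R (s, z)) = sgn (frame (s, z))"
          by (simp only: linear_scale[OF frame_linear] sgn_div_norm nf inverse_eq_divide)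
        finally have "F r = ?f (sgn (frame (s, z)))" .
        moreover have "s\<^sup>2 + a\<^sup>2 < 1 \<longleftrightarrow> r < 1" by (simp add: r_def)
        ultimately show ?thesis using True
          by (simp add: K_def frame_inner_xi nf r_def[symmetric] indicator_def)
      next
        case False
        then show ?thesis by (simp add: K_def frame_inner_xi)
      qed
    qed
    also have "\<dots> = (\<integral>\<^sup>+r. ennreal (F r / sqrt (1 - (a / r)\<^sup>2)) * indicator {a<..<1} r \<partial>lborel)"
      by (rule radial_substitution[OF _ a]) measurable
    also have "\<dots> = (\<integral>\<^sup>+r. H (z /\<^sub>R r) * indicator {0<..<1} r \<partial>lborel)"
    proof (rule nn_integral_cong)
      fix r :: real
      consider "r \<le> 0" | "0 < r" "r \<le> a" | "a < r" "r > 0" using a by linarith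
      then show "ennreal (F r / sqrt (1 - (a / r)\<^sup>2)) * indicator {a<..<1} r = H (z /\<^sub>R r) * indicator {0<..<1} r"
      proof cases
        case 1 then show ?thesis using a by simp
      next
        case 2
        then have "norm (z /\<^sub>R r) \<ge> 1" by (simp add: a_def field_simps)
        then have "chart_weight (z /\<^sub>R r) = 0" by (simp add: chart_weight_def indicator_def)
        then show ?thesis using 2 by (simp add: H_def)
      next
        case 3
        then have n: "norm (z /\<^sub>R r) = a / r" "a / r < 1" using a by (simp_all add: a_def divide_inverse mult.commute) (simp add: field_simps)
        then have "height (z /\<^sub>R r) = sqrt (1 - (a / r)\<^sup>2)" by (simp add: height_def)
        then show ?thesis using n 3 by (simp add: H_def F_def chart_def chart_weight_def indicator_def)
      qed
    qed
    finally show ?thesis .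
  qed
  have scale: "(\<integral>\<^sup>+z. H (z /\<^sub>R r) \<partial>lborel) = ennreal (r ^ CARD('n)) * (\<integral>\<^sup>+z. H z \<partial>lborel)" if "r > 0" for r
    using nn_integral_lborel_affine[of "\<lambda>z. H (z /\<^sub>R r)" r 0] that by simp
  have "(\<integral>\<^sup>+x. K x \<partial>lborel) = (\<integral>\<^sup>+p. K (frame p) \<partial>(lborel \<Otimes>\<^sub>M lborel))"
    by (subst distr_frame[symmetric], unfold lborel_prod) (rule nn_integral_distr; simp)
  also have "\<dots> = (\<integral>\<^sup>+z. \<integral>\<^sup>+s. K (frame (s, z)) \<partial>lborel \<partial>lborel)"
    by (rule lborel_pair.nn_integral_snd[symmetric]) (unfold lborel_prod, simp)
  also have "\<dots> = (\<integral>\<^sup>+z. \<integral>\<^sup>+r. H (z /\<^sub>R r) * indicator {0<..<1} r \<partial>lborel \<partial>lborel)"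
  proof (rule nn_integral_cong_AE)
    have "AE z in lborel. z \<noteq> (0 :: real ^ 'n)" by (rule AE_lborel_singleton)
    then show "AE z in lborel. (\<integral>\<^sup>+s. K (frame (s, z)) \<partial>lborel) = (\<integral>\<^sup>+r. H (z /\<^sub>R r) * indicator {0<..<1} r \<partial>lborel)"
      by (rule AE_mp, intro AE_I2 impI inner)
  qed
  also have "\<dots> = (\<integral>\<^sup>+r. \<integral>\<^sup>+z. H (z /\<^sub>R r) * indicator {0<..<1} r \<partial>lborel \<partial>lborel)"
    by (rule lborel_pair.Fubini') measurable
  also have "\<dots> = (\<integral>\<^sup>+r. (ennreal (r ^ CARD('n)) * indicator {0<..<1} r) * (\<integral>\<^sup>+z. H z \<partial>lborel) \<partial>lborel)"
  proof (rule nn_integral_cong)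
    fix r :: real
    show "(\<integral>\<^sup>+z. H (z /\<^sub>R r) * indicator {0<..<1} r \<partial>lborel) = (ennreal (r ^ CARD('n)) * indicator {0<..<1} r) * (\<integral>\<^sup>+z. H z \<partial>lborel)"
      by (cases "0 < r \<and> r < 1") (auto simp: scale)
  qed
  also have "\<dots> = ennreal (1 / real CARD('k)) * (\<integral>\<^sup>+z. H z \<partial>lborel)"
    by (subst nn_integral_multc) (auto simp: nn_integral_power_unit card)
  finally have K: "(\<integral>\<^sup>+x. K x \<partial>lborel) = ennreal (1 / real CARD('k)) * (\<integral>\<^sup>+z. H z \<partial>lborel)" .
  have "(\<integral>\<^sup>+x. indicator (A \<inter> {x. 0 < x \<bullet> \<xi>}) x \<partial>sphere_measure) =
     of_nat CARD('k) * (\<integral>\<^sup>+x. indicator (A \<inter> {x. 0 < x \<bullet> \<xi>}) (sgn x) * indicator (ball 0 1 - {0}) x \<partial>lborel)"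
    by (subst nn_integral_sphere_measure) (auto intro!: borel_measurable_sphere_measure)
  also have "(\<integral>\<^sup>+x. indicator (A \<inter> {x. 0 < x \<bullet> \<xi>}) (sgn x) * indicator (ball 0 1 - {0}) x \<partial>lborel) = (\<integral>\<^sup>+x. K x \<partial>lborel)"
  proof (rule nn_integral_cong)
    fix x :: "real ^ 'k"
    have "0 < sgn x \<bullet> \<xi> \<longleftrightarrow> 0 < x \<bullet> \<xi>"
      by (cases "x = 0") (simp_all add: sgn_div_norm zero_less_mult_iff)
    then show "indicator (A \<inter> {x. 0 < x \<bullet> \<xi>}) (sgn x) * indicator (ball 0 1 - {0}) x = K x"
      by (auto simp: K_def indicator_def)
  qed
  also have "of_nat CARD('k) * (\<integral>\<^sup>+x. K x \<partial>lborel) = (\<integral>\<^sup>+z. H z \<partial>lborel)"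
    unfolding K by (simp add: mult.assoc[symmetric] ennreal_of_nat_eq_real_of_nat ennreal_mult[symmetric])
  also have "\<dots> = (\<integral>\<^sup>+z. ennreal (chart_weight z) * indicator A (chart z) \<partial>lborel)"
    unfolding H_def by (intro nn_integral_cong) (auto simp: indicator_def)
  finally show ?thesis .
qed

lemma chart_measurable_sphere: "chart \<in> lborel \<rightarrow>\<^sub>M sphere_measure"
proof -
  have "chart \<in> borel \<rightarrow>\<^sub>M restrict_space borel (sphere 0 1)"
    by (intro measurable_restrict_space2 chart_measurable) (use chart_in_sphere in auto)
  then show ?thesis by (subst measurable_cong_sets[OF sets_lborel sets_sphere_measure])
qed

lemma density_half_sphere:
  "density sphere_measure (indicator {x. 0 < x \<bullet> \<xi>}) =
    distr (density lborel (\<lambda>z. ennreal (chart_weight z))) sphere_measure chart"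
proof (rule measure_eqI)
  fix A assume "A \<in> sets (density sphere_measure (indicator {x. 0 < x \<bullet> \<xi>}))"
  then have A: "A \<in> sets sphere_measure" by simp
  then have Ab: "A \<in> sets borel"
    unfolding sets_sphere_measure by (subst (asm) sets_restrict_space_iff) auto
  note [measurable] = A Ab chart_measurable_sphere
  have [measurable]: "indicator {x. 0 < x \<bullet> \<xi>} \<in> borel_measurable sphere_measure"
    by (intro borel_measurable_sphere_measure) measurable
  have "emeasure (density sphere_measure (indicator {x. 0 < x \<bullet> \<xi>})) A =
     (\<integral>\<^sup>+x. indicator (A \<inter> {x. 0 < x \<bullet> \<xi>}) x \<partial>sphere_measure)"
    by (subst emeasure_density) (auto intro!: nn_integral_cong simp: indicator_def)
  also have "\<dots> = (\<integral>\<^sup>+z. ennreal (chart_weight z) * indicator A (chart z) \<partial>lborel)"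
    by (rule sphere_measure_half[OF Ab])
  also have "\<dots> = (\<integral>\<^sup>+z. indicator A (chart z) \<partial>density lborel (\<lambda>z. ennreal (chart_weight z)))"
    by (subst nn_integral_density) auto
  also have "\<dots> = emeasure (distr (density lborel (\<lambda>z. ennreal (chart_weight z))) sphere_measure chart) A"
    by (subst nn_integral_distr[symmetric, of chart _ sphere_measure]) (auto simp: nn_integral_indicator)
  finally show "emeasure (density sphere_measure (indicator {x. 0 < x \<bullet> \<xi>})) A =
    emeasure (distr (density lborel (\<lambda>z. ennreal (chart_weight z))) sphere_measure chart) A" .
qed simp

lemma nn_integral_chart:
  assumes [measurable]: "F \<in> borel_measurable sphere_measure"
    and F0: "\<And>x. x \<in> sphere 0 1 \<Longrightarrow> x \<bullet> \<xi> \<le> 0 \<Longrightarrow> F x = 0"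
  shows "(\<integral>\<^sup>+x. F x \<partial>sphere_measure) = (\<integral>\<^sup>+z. ennreal (chart_weight z) * F (chart z) \<partial>lborel)"
proof -
  note [measurable] = chart_measurable_sphere
  have [measurable]: "indicator {x. 0 < x \<bullet> \<xi>} \<in> borel_measurable sphere_measure"
    by (intro borel_measurable_sphere_measure) measurable
  have "(\<integral>\<^sup>+x. F x \<partial>sphere_measure) = (\<integral>\<^sup>+x. indicator {x. 0 < x \<bullet> \<xi>} x * F x \<partial>sphere_measure)"
    using F0 by (intro nn_integral_cong) (auto simp: indicator_def not_less)
  also have "\<dots> = (\<integral>\<^sup>+x. F x \<partial>density sphere_measure (indicator {x. 0 < x \<bullet> \<xi>}))"
    by (subst nn_integral_density) auto
  also have "\<dots> = (\<integral>\<^sup>+z. ennreal (chart_weight z) * F (chart z) \<partial>lborel)"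
    unfolding density_half_sphere by (subst nn_integral_distr) (auto simp: nn_integral_density)
  finally show ?thesis .
qed

lemma
  fixes F :: "real ^ 'k \<Rightarrow> 'b::{banach, second_countable_topology}"
  assumes [measurable]: "F \<in> borel_measurable sphere_measure"
    and F0: "\<And>x. x \<in> sphere 0 1 \<Longrightarrow> x \<bullet> \<xi> \<le> 0 \<Longrightarrow> F x = 0"
  shows integral_chart: "(\<integral>x. F x \<partial>sphere_measure) = (\<integral>z. chart_weight z *\<^sub>R F (chart z) \<partial>lborel)"
    and integrable_chart: "integrable sphere_measure F \<longleftrightarrow> integrable lborel (\<lambda>z. chart_weight z *\<^sub>R F (chart z))"
proof -
  note [measurable] = chart_measurable_sphere
  have [measurable]: "(indicator {x. 0 < x \<bullet> \<xi>} :: _ \<Rightarrow> real) \<in> borel_measurable sphere_measure"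
    by (intro borel_measurable_sphere_measure) measurable
  have eq: "indicator {x. 0 < x \<bullet> \<xi>} x *\<^sub>R F x = F x" if "x \<in> space sphere_measure" for x
    using F0[of x] that by (auto simp: indicator_def not_less)
  have d: "density sphere_measure (\<lambda>x. ennreal (indicator {x. 0 < x \<bullet> \<xi>} x)) = density sphere_measure (indicator {x. 0 < x \<bullet> \<xi>})"
    by (simp add: ennreal_indicator)
  have "(\<integral>x. F x \<partial>sphere_measure) = (\<integral>x. indicator {x. 0 < x \<bullet> \<xi>} x *\<^sub>R F x \<partial>sphere_measure)"
    by (intro Bochner_Integration.integral_cong refl) (simp only: eq)
  also have "\<dots> = (\<integral>x. F x \<partial>density sphere_measure (indicator {x. 0 < x \<bullet> \<xi>}))"
    unfolding d[symmetric] by (subst integral_density) auto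
  also have "\<dots> = (\<integral>z. chart_weight z *\<^sub>R F (chart z) \<partial>lborel)"
    unfolding density_half_sphere by (simp add: integral_distr integral_density chart_weight_nonneg)
  finally show "(\<integral>x. F x \<partial>sphere_measure) = (\<integral>z. chart_weight z *\<^sub>R F (chart z) \<partial>lborel)" .
  have "integrable sphere_measure F \<longleftrightarrow> integrable sphere_measure (\<lambda>x. indicator {x. 0 < x \<bullet> \<xi>} x *\<^sub>R F x)"
    by (intro Bochner_Integration.integrable_cong refl) (simp only: eq)
  also have "\<dots> \<longleftrightarrow> integrable (density sphere_measure (indicator {x. 0 < x \<bullet> \<xi>})) F"
    unfolding d[symmetric] by (subst integrable_density) auto
  also have "\<dots> \<longleftrightarrow> integrable lborel (\<lambda>z. chart_weight z *\<^sub>R F (chart z))"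
    unfolding density_half_sphere by (simp add: integrable_distr_eq integrable_density chart_weight_nonneg)
  finally show "integrable sphere_measure F \<longleftrightarrow> integrable lborel (\<lambda>z. chart_weight z *\<^sub>R F (chart z))" .
qed

end

section \<open>The Sobolev inequality in small caps\<close>

text \<open>The trace of the rank one map \<open>h \<mapsto> l h \<cdot> w\<close>.\<close>

lemma trace_rank_one:
  fixes l :: "'a::euclidean_space \<Rightarrow> real"
  assumes "linear l"
  shows "(\<Sum>b\<in>Basis. l b * (w \<bullet> b)) = l w"
proof -
  have "l w = l (\<Sum>b\<in>Basis. (w \<bullet> b) *\<^sub>R b)" by (simp add: euclidean_representation)
  also have "\<dots> = (\<Sum>b\<in>Basis. (w \<bullet> b) * l b)" by (simp add: linear_sum[OF assms] linear_scale[OF assms])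
  finally show ?thesis by (simp add: mult.commute)
qed

definition grad :: "('a::euclidean_space \<Rightarrow> real) \<Rightarrow> 'a \<Rightarrow> 'a" where
  "grad \<eta> x = (\<Sum>b\<in>Basis. frechet_derivative \<eta> (at x) b *\<^sub>R b)"

lemma inner_grad:
  assumes "smooth \<eta>"
  shows "grad \<eta> x \<bullet> w = frechet_derivative \<eta> (at x) w"
proof -
  have "grad \<eta> x \<bullet> w = (\<Sum>b\<in>Basis. frechet_derivative \<eta> (at x) b * (w \<bullet> b))"
    unfolding grad_def inner_sum_left by (simp add: inner_commute)
  then show ?thesis
    by (simp add: trace_rank_one has_derivative_linear[OF smooth_has_derivative[OF assms]])
qed

lemma continuous_on_grad: "smooth \<eta> \<Longrightarrow> continuous_on A (grad \<eta>)"
  unfolding grad_def[abs_def]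
  by (intro continuous_on_sum continuous_on_scaleR smooth_continuous_on smooth_frechet_derivative continuous_on_const)

lemma integrable_sphere_bounded_mult:
  fixes f :: "'a::euclidean_space \<Rightarrow> 'b::euclidean_space" and g :: "'a \<Rightarrow> 'c::euclidean_space"
    and B :: "'b \<Rightarrow> 'c \<Rightarrow> 'd::euclidean_space"
  assumes B: "bounded_bilinear B" and f: "integrable sphere_measure f"
    and g: "continuous_on UNIV g"
  shows "integrable sphere_measure (\<lambda>x. B (f x) (g x))"
proof -
  obtain K where K: "\<And>a b. norm (B a b) \<le> norm a * norm b * K" "K > 0"
    using bounded_bilinear.pos_bounded[OF B] by blast
  have "compact (g ` sphere 0 1)" by (intro compact_continuous_image continuous_on_subset[OF g]) auto
  then obtain M where M: "\<And>x. x \<in> sphere 0 1 \<Longrightarrow> norm (g x) \<le> M"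
    using compact_imp_bounded by (force simp: bounded_iff)
  have [measurable]: "f \<in> borel_measurable sphere_measure" using f by auto
  have [measurable]: "g \<in> borel_measurable sphere_measure"
    by (intro borel_measurable_sphere_measure borel_measurable_continuous_onI g)
  show ?thesis
  proof (rule Bochner_Integration.integrable_bound)
    show "integrable sphere_measure (\<lambda>x. (M * K) *\<^sub>R f x)" using f by simp
    show "(\<lambda>x. B (f x) (g x)) \<in> borel_measurable sphere_measure"
    proof -
      have "continuous_on UNIV (\<lambda>p. B (fst p) (snd p))"
        by (intro bounded_bilinear.continuous_on[OF B] continuous_intros)
      then have Bm: "(\<lambda>p. B (fst p) (snd p)) \<in> borel_measurable borel" by (rule borel_measurable_continuous_onI)
      have "(\<lambda>x. (f x, g x)) \<in> borel_measurable sphere_measure"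
        by (rule borel_measurable_Pair) fact+
      from measurable_compose[OF this Bm] show ?thesis by simp
    qed
    show "AE x in sphere_measure. norm (B (f x) (g x)) \<le> norm ((M * K) *\<^sub>R f x)"
    proof (intro AE_I2)
      fix x :: 'a assume "x \<in> space sphere_measure"
      then have gx: "norm (g x) \<le> M" using M by simp
      have "norm (B (f x) (g x)) \<le> norm (f x) * norm (g x) * K" by (rule K)
      also have "\<dots> \<le> norm (f x) * M * K" using gx K(2) by (intro mult_right_mono mult_left_mono) auto
      also have "\<dots> = (M * K) * norm (f x)" by simp
      also have "\<dots> \<le> norm ((M * K) *\<^sub>R f x)" by (simp add: mult_right_mono)
      finally show "norm (B (f x) (g x)) \<le> norm ((M * K) *\<^sub>R f x)" .
    qed
  qed
qed

context sphere_chart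
begin

definition coord :: "real ^ 'k \<Rightarrow> real ^ 'n" where
  "coord = adjoint T"

lemma coord_linear: "linear coord"
  unfolding coord_def by (rule adjoint_linear[OF linT])

lemma inner_coord: "coord x \<bullet> w = x \<bullet> T w"
  using adjoint_works[OF linT, of w x] by (simp add: coord_def inner_commute)

lemma coord_T [simp]: "coord (T z) = z"
  by (rule vector_eq_rdot[THEN iffD1]) (simp add: inner_coord inner_T)

lemma coord_xi [simp]: "coord \<xi> = 0"
proof -
  have "coord \<xi> \<bullet> coord \<xi> = 0" using T_xi by (simp add: inner_coord inner_commute)
  then show ?thesis by simp
qed

lemma coord_frame [simp]: "coord (frame p) = snd p"
  by (simp add: frame_def linear_add[OF coord_linear] linear_scale[OF coord_linear])

lemma norm_coord_le: "norm (coord x) \<le> norm x"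
proof -
  have "norm (coord x) * norm (coord x) \<le> norm x * norm (coord x)"
    using Cauchy_Schwarz_ineq2[of x "T (coord x)"]
    by (simp add: inner_coord[symmetric] normT dot_square_norm power2_eq_square)
  then show ?thesis by (cases "norm (coord x) = 0") auto
qed

lemma coord_bounded_linear: "bounded_linear coord"
  using coord_linear linear_conv_bounded_linear by blast

text \<open>The lift of the field \<open>\<psi> e\<close> from the hyperplane to the sphere, multiplied by
  the height \<open>x \<bullet> \<xi>\<close>, which is the reciprocal of the density of the
  surface measure in the chart. Thanks to this factor the field is smooth on the whole ambient
  space and its divergence is the Euclidean one times the height.\<close>

definition test_field :: "(real ^ 'n \<Rightarrow> real) \<Rightarrow> real ^ 'n \<Rightarrow> real ^ 'k \<Rightarrow> real ^ 'k" where
  "test_field \<psi> e x = ((x \<bullet> \<xi>) * \<psi> (coord x)) *\<^sub>R T e - (\<psi> (coord x) * (T e \<bullet> x)) *\<^sub>R \<xi>"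

lemma test_field_tangent: "test_field \<psi> e x \<bullet> x = 0"
  unfolding test_field_def inner_diff_left by (simp add: inner_commute[of \<xi> x])

lemma smooth_test_field:
  assumes "smooth \<psi>" shows "smooth (test_field \<psi> e)"
proof -
  have 1: "smooth (\<lambda>x. \<psi> (coord x))"
    using smooth_compose_affine[OF assms coord_bounded_linear, of 0] by simp
  show ?thesis unfolding test_field_def[abs_def]
    by (intro smooth_diff smooth_scaleR smooth_mult smooth_inner smooth_const smooth_ident 1)
qed

lemma sphere_div_test_field:
  assumes \<eta>: "smooth \<eta>" and \<psi>: "smooth \<psi>"
  shows "sphere_div (\<lambda>x. \<eta> x *\<^sub>R test_field \<psi> e x) x =
    \<eta> x * ((x \<bullet> \<xi>) * frechet_derivative \<psi> (at (coord x)) e) + grad \<eta> x \<bullet> test_field \<psi> e x"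
proof -
  let ?D\<psi> = "frechet_derivative \<psi> (at (coord x))" and ?D\<eta> = "frechet_derivative \<eta> (at x)"
  let ?X = "test_field \<psi> e x"
  have lin\<psi>: "linear ?D\<psi>" by (rule has_derivative_linear[OF smooth_has_derivative[OF \<psi>]])
  have lin\<eta>: "linear ?D\<eta>" by (rule has_derivative_linear[OF smooth_has_derivative[OF \<eta>]])
  define l1 where "l1 h = (x \<bullet> \<xi>) * ?D\<psi> (coord h) + (h \<bullet> \<xi>) * \<psi> (coord x)" for h
  define l2 where "l2 h = \<psi> (coord x) * (T e \<bullet> h) + ?D\<psi> (coord h) * (T e \<bullet> x)" for h
  \<comment> \<open>The derivative of the test field is a sum of two rank one maps, so its trace is read off.\<close>
  have lc: "linear (\<lambda>h. ?D\<psi> (coord h))"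
    using linear_compose[OF coord_linear lin\<psi>] by (simp add: comp_def)
  have lin1: "linear l1" and lin2: "linear l2"
    unfolding l1_def l2_def
    by (auto intro!: linearI simp: linear_add[OF lc] linear_scale[OF lc] inner_add_left inner_add_right algebra_simps)
  have d\<psi>: "((\<lambda>x. \<psi> (coord x)) has_derivative (\<lambda>h. ?D\<psi> (coord h))) (at x)"
    by (rule has_derivative_compose[OF bounded_linear_imp_has_derivative[OF coord_bounded_linear] smooth_has_derivative[OF \<psi>]])
  have dX: "(test_field \<psi> e has_derivative (\<lambda>h. l1 h *\<^sub>R T e - l2 h *\<^sub>R \<xi>)) (at x)"
    unfolding test_field_def[abs_def] l1_def l2_def
    by (auto intro!: derivative_eq_intros d\<psi>)
  have "((\<lambda>x. \<eta> x *\<^sub>R test_field \<psi> e x) has_derivative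
      (\<lambda>h. \<eta> x *\<^sub>R (l1 h *\<^sub>R T e - l2 h *\<^sub>R \<xi>) + ?D\<eta> h *\<^sub>R ?X)) (at x)"
    by (rule has_derivative_scaleR[OF smooth_has_derivative[OF \<eta>] dX])
  from frechet_derivative_at[OF this]
  have D: "frechet_derivative (\<lambda>x. \<eta> x *\<^sub>R test_field \<psi> e x) (at x) =
      (\<lambda>h. \<eta> x *\<^sub>R (l1 h *\<^sub>R T e - l2 h *\<^sub>R \<xi>) + ?D\<eta> h *\<^sub>R ?X)"
    by (rule sym)
  have "(\<Sum>b\<in>Basis. (\<eta> x *\<^sub>R (l1 b *\<^sub>R T e - l2 b *\<^sub>R \<xi>) + ?D\<eta> b *\<^sub>R ?X) \<bullet> b) =
     \<eta> x * ((\<Sum>b\<in>Basis. l1 b * (T e \<bullet> b)) - (\<Sum>b\<in>Basis. l2 b * (\<xi> \<bullet> b))) + (\<Sum>b\<in>Basis. ?D\<eta> b * (?X \<bullet> b))"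
    unfolding sum_subtractf[symmetric] sum_distrib_left sum.distrib[symmetric]
    by (simp add: inner_add_left inner_diff_left)
  also have "\<dots> = \<eta> x * (l1 (T e) - l2 \<xi>) + grad \<eta> x \<bullet> ?X"
    by (simp add: trace_rank_one lin1 lin2 lin\<eta> inner_grad[OF \<eta>])
  also have "l1 (T e) - l2 \<xi> = (x \<bullet> \<xi>) * ?D\<psi> e"
    by (simp add: l1_def l2_def T_xi linear_0[OF lin\<psi>])
  finally have 1: "(\<Sum>b\<in>Basis. (\<eta> x *\<^sub>R (l1 b *\<^sub>R T e - l2 b *\<^sub>R \<xi>) + ?D\<eta> b *\<^sub>R ?X) \<bullet> b) =
     \<eta> x * ((x \<bullet> \<xi>) * ?D\<psi> e) + grad \<eta> x \<bullet> ?X" .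
  have "(\<eta> x *\<^sub>R (l1 x *\<^sub>R T e - l2 x *\<^sub>R \<xi>) + ?D\<eta> x *\<^sub>R ?X) \<bullet> x = \<eta> x * (l1 x * (T e \<bullet> x) - l2 x * (\<xi> \<bullet> x))"
    by (simp add: inner_add_left inner_diff_left test_field_tangent)
  also have "l1 x * (T e \<bullet> x) - l2 x * (\<xi> \<bullet> x) = 0"
    by (simp add: l1_def l2_def inner_commute algebra_simps)
  finally show ?thesis
    unfolding sphere_div_def D 1 by simp
qed

end

text \<open>A cut-off function \<open>\<eta>\<close> supported in the cap of radius \<open>r\<close>
  around \<open>\<xi>\<close>.\<close>

locale sphere_cap = sphere_chart \<xi> T for \<xi> :: "real ^ 'k" and T :: "real ^ 'n \<Rightarrow> real ^ 'k" +
  fixes r :: real and \<eta> :: "real ^ 'k \<Rightarrow> real"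
  assumes r: "0 < r" "r < 1" and \<eta>: "smooth \<eta>" and \<eta>_supp: "\<And>x. r \<le> norm (x - \<xi>) \<Longrightarrow> \<eta> x = 0"
begin

text \<open>On the sphere, points at distance at most \<open>r\<close> from \<open>\<xi>\<close> have
  height at least this.\<close>

definition floor_height :: real where "floor_height = 1 - r\<^sup>2 / 2"

lemma floor_height: "floor_height > 1 / 2" "1 / floor_height \<le> 1 + r\<^sup>2" "1 - floor_height\<^sup>2 \<le> r\<^sup>2"
proof -
  have r2: "r\<^sup>2 < 1" "0 < r\<^sup>2" using r by (auto simp: abs_square_less_1)
  show h: "floor_height > 1 / 2" using r2 by (simp add: floor_height_def)
  have "r\<^sup>2 * r\<^sup>2 \<le> r\<^sup>2 * 1" using r2 by (intro mult_left_mono) auto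
  then have "1 \<le> (1 + r\<^sup>2) * floor_height"
    by (simp add: floor_height_def algebra_simps)
  then show "1 / floor_height \<le> 1 + r\<^sup>2" using h by (simp add: divide_le_eq)
  show "1 - floor_height\<^sup>2 \<le> r\<^sup>2"
    using r2 by (simp add: floor_height_def power2_diff)
qed

lemma outside_cap:
  assumes x: "x \<in> sphere 0 1" and "x \<bullet> \<xi> < floor_height"
  shows "\<eta> x = 0" "grad \<eta> x = 0"
proof -
  have "(norm (x - \<xi>))\<^sup>2 = 2 - 2 * (x \<bullet> \<xi>)"
    using x norm_xi unfolding power2_norm_eq_inner
    by (simp add: inner_diff_left inner_diff_right inner_commute norm_eq_1)
  then have "(norm (x - \<xi>))\<^sup>2 > r\<^sup>2" using assms(2) by (simp add: floor_height_def)
  then have gt: "norm (x - \<xi>) > r" by (rule power_less_imp_less_base) simp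
  then show "\<eta> x = 0" by (intro \<eta>_supp) simp
  have "{x. \<eta> x \<noteq> 0} \<subseteq> cball \<xi> r" using \<eta>_supp by (force simp: dist_norm norm_minus_commute)
  then have "closure {x. \<eta> x \<noteq> 0} \<subseteq> cball \<xi> r" by (rule closure_minimal) simp
  then have "x \<notin> closure {x. \<eta> x \<noteq> 0}" using gt by (auto simp: dist_norm norm_minus_commute)
  then show "grad \<eta> x = 0"
    by (simp add: grad_def frechet_derivative_eq_0_outside_support)
qed

text \<open>The gradient of \<open>\<eta> u\<close> by the product rule, with the ambient gradient of
  \<open>\<eta>\<close>. The normal component of the latter does no harm, as only products with
  tangent fields are integrated.\<close>

definition cut_gradient :: "(real ^ 'k \<Rightarrow> real) \<Rightarrow> (real ^ 'k \<Rightarrow> real ^ 'k) \<Rightarrow> real ^ 'k \<Rightarrow> real ^ 'k" where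
  "cut_gradient u G x = \<eta> x *\<^sub>R G x + u x *\<^sub>R grad \<eta> x"

definition chart_fun :: "(real ^ 'k \<Rightarrow> real) \<Rightarrow> real ^ 'n \<Rightarrow> real" where
  "chart_fun u z = indicator (ball 0 1) z * (\<eta> (chart z) * u (chart z))"

text \<open>The pull-back of \<^const>\<open>cut_gradient\<close> along the chart: its product with
  \<open>e\<close> is the product of \<^const>\<open>cut_gradient\<close> with the derivative
  \<open>T e - (e \<bullet> z / height z) \<xi>\<close> of the chart in direction
  \<open>e\<close>.\<close>

definition chart_gradient :: "(real ^ 'k \<Rightarrow> real) \<Rightarrow> (real ^ 'k \<Rightarrow> real ^ 'k) \<Rightarrow> real ^ 'n \<Rightarrow> real ^ 'n" where
  "chart_gradient u G z = indicator (ball 0 1) z *\<^sub>R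
     (coord (cut_gradient u G (chart z)) - ((cut_gradient u G (chart z) \<bullet> \<xi>) / height z) *\<^sub>R z)"

lemma cut_gradient_outside:
  "x \<in> sphere 0 1 \<Longrightarrow> x \<bullet> \<xi> < floor_height \<Longrightarrow> cut_gradient u G x = 0"
  by (simp add: cut_gradient_def outside_cap)

lemma coord_chart: "norm z < 1 \<Longrightarrow> coord (chart z) = z"
  by (simp add: chart_def)

context
  fixes u :: "real ^ 'k \<Rightarrow> real" and G :: "real ^ 'k \<Rightarrow> real ^ 'k"
  assumes uG: "has_weak_gradient u G"
begin

lemma weakly_differentiable_integrable: "integrable sphere_measure u" and weak_gradient_integrable: "integrable sphere_measure G"
  using uG by (auto simp: has_weak_gradient_def)

lemma cut_gradient_integrable: "integrable sphere_measure (cut_gradient u G)"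
  unfolding cut_gradient_def[abs_def]
proof (rule Bochner_Integration.integrable_add)
  show "integrable sphere_measure (\<lambda>x. \<eta> x *\<^sub>R G x)"
    using integrable_sphere_bounded_mult[OF bounded_bilinear.flip[OF bounded_bilinear_scaleR] weak_gradient_integrable smooth_continuous_on[OF \<eta>]] .
  show "integrable sphere_measure (\<lambda>x. u x *\<^sub>R grad \<eta> x)"
    by (rule integrable_sphere_bounded_mult[OF bounded_bilinear_scaleR weakly_differentiable_integrable continuous_on_grad[OF \<eta>]])
qed

lemma continuous_on_coord: "continuous_on A coord"
  by (rule linear_continuous_on[OF coord_bounded_linear])

lemma continuous_on_inner_xi: "continuous_on A (\<lambda>x. x \<bullet> \<xi>)"
  by (intro continuous_intros)

lemma cut_function_integrable: "integrable sphere_measure (\<lambda>x. u x * (\<eta> x * (x \<bullet> \<xi>)))"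
  by (rule integrable_sphere_bounded_mult[OF bounded_bilinear_mult weakly_differentiable_integrable])
    (intro continuous_on_mult smooth_continuous_on[OF \<eta>] continuous_on_inner_xi)

lemma vanishes_on_lower_half: "x \<in> sphere 0 1 \<Longrightarrow> x \<bullet> \<xi> \<le> 0 \<Longrightarrow> \<eta> x = 0 \<and> cut_gradient u G x = 0"
  using floor_height(1) by (intro conjI outside_cap cut_gradient_outside) auto

lemma chart_fun_eq: "chart_weight z *\<^sub>R (u (chart z) * (\<eta> (chart z) * (chart z \<bullet> \<xi>))) = chart_fun u z"
  using height_pos[of z] by (auto simp: chart_weight_def chart_fun_def chart_inner_xi indicator_def)

lemma chart_fun_integrable: "integrable lborel (chart_fun u)"
proof -
  have "integrable sphere_measure (\<lambda>x. u x * (\<eta> x * (x \<bullet> \<xi>))) \<longleftrightarrow>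
      integrable lborel (\<lambda>z. chart_weight z *\<^sub>R (u (chart z) * (\<eta> (chart z) * (chart z \<bullet> \<xi>))))"
    by (rule integrable_chart) (use cut_function_integrable vanishes_on_lower_half in auto)
  then show ?thesis using cut_function_integrable by (simp only: chart_fun_eq)
qed

lemma chart_gradient_eq:
  "chart_weight z *\<^sub>R ((chart z \<bullet> \<xi>) *\<^sub>R coord (cut_gradient u G (chart z)) -
     (cut_gradient u G (chart z) \<bullet> \<xi>) *\<^sub>R coord (chart z)) = chart_gradient u G z"
  using height_pos[of z]
  by (auto simp: chart_weight_def chart_gradient_def chart_inner_xi coord_chart indicator_def scaleR_diff_right)

lemma chart_gradient_integrable: "integrable lborel (chart_gradient u G)"
proof -
  let ?F = "\<lambda>x. (x \<bullet> \<xi>) *\<^sub>R coord (cut_gradient u G x) - (cut_gradient u G x \<bullet> \<xi>) *\<^sub>R coord x"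
  have "integrable sphere_measure ?F"
  proof (rule Bochner_Integration.integrable_diff)
    have "integrable sphere_measure (\<lambda>x. coord (cut_gradient u G x))"
      by (rule integrable_bounded_linear[OF coord_bounded_linear cut_gradient_integrable])
    then show "integrable sphere_measure (\<lambda>x. (x \<bullet> \<xi>) *\<^sub>R coord (cut_gradient u G x))"
      by (rule integrable_sphere_bounded_mult[OF bounded_bilinear.flip[OF bounded_bilinear_scaleR] _ continuous_on_inner_xi])
    have "integrable sphere_measure (\<lambda>x. cut_gradient u G x \<bullet> \<xi>)"
      using cut_gradient_integrable by simp
    then show "integrable sphere_measure (\<lambda>x. (cut_gradient u G x \<bullet> \<xi>) *\<^sub>R coord x)"
      by (rule integrable_sphere_bounded_mult[OF bounded_bilinear_scaleR _ continuous_on_coord])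
  qed
  moreover have "?F x = 0" if "x \<in> sphere 0 1" "x \<bullet> \<xi> \<le> 0" for x
    using vanishes_on_lower_half[OF that] by (simp add: linear_0[OF coord_linear])
  moreover have "?F \<in> borel_measurable sphere_measure"
    using \<open>integrable sphere_measure ?F\<close> by (rule borel_measurable_integrable)
  ultimately have "integrable lborel (\<lambda>z. chart_weight z *\<^sub>R ?F (chart z))"
    using integrable_chart[of ?F] by blast
  then show ?thesis by (simp only: chart_gradient_eq)
qed

lemma chart_weak_gradient:
  assumes \<psi>: "smooth \<psi>"
  shows "(\<integral>z. chart_fun u z * frechet_derivative \<psi> (at z) e \<partial>lborel) = - (\<integral>z. (chart_gradient u G z \<bullet> e) * \<psi> z \<partial>lborel)"
proof -
  let ?D = "\<lambda>x. frechet_derivative \<psi> (at (coord x)) e"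
  let ?X = "test_field \<psi> e"
  have contD: "continuous_on UNIV ?D"
    using smooth_continuous_on[OF smooth_frechet_derivative[OF \<psi>], of UNIV e]
    by (rule continuous_on_compose2[OF _ continuous_on_coord]) auto
  have contX: "continuous_on UNIV ?X" by (rule smooth_continuous_on[OF smooth_test_field[OF \<psi>]])
  have "smooth_tangent_field (\<lambda>x. \<eta> x *\<^sub>R ?X x)"
    unfolding smooth_tangent_field_def
    by (auto intro!: smooth_scaleR \<eta> smooth_test_field \<psi> simp: test_field_tangent)
  then have "(\<integral>x. u x * sphere_div (\<lambda>x. \<eta> x *\<^sub>R ?X x) x \<partial>sphere_measure) = - (\<integral>x. G x \<bullet> (\<eta> x *\<^sub>R ?X x) \<partial>sphere_measure)"
    using uG by (simp add: has_weak_gradient_def)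
  moreover have "(\<integral>x. u x * sphere_div (\<lambda>x. \<eta> x *\<^sub>R ?X x) x \<partial>sphere_measure)
     = (\<integral>x. u x * (\<eta> x * (x \<bullet> \<xi>)) * ?D x \<partial>sphere_measure) + (\<integral>x. (u x *\<^sub>R grad \<eta> x) \<bullet> ?X x \<partial>sphere_measure)"
  proof (subst Bochner_Integration.integral_add[symmetric])
    show "integrable sphere_measure (\<lambda>x. u x * (\<eta> x * (x \<bullet> \<xi>)) * ?D x)"
      by (rule integrable_sphere_bounded_mult[OF bounded_bilinear_mult cut_function_integrable contD])
    show "integrable sphere_measure (\<lambda>x. (u x *\<^sub>R grad \<eta> x) \<bullet> ?X x)"
      by (rule integrable_sphere_bounded_mult[OF bounded_bilinear_inner _ contX])
        (rule integrable_sphere_bounded_mult[OF bounded_bilinear_scaleR weakly_differentiable_integrable continuous_on_grad[OF \<eta>]])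
  qed (auto intro!: Bochner_Integration.integral_cong simp: sphere_div_test_field[OF \<eta> \<psi>] algebra_simps)
  moreover have "(\<integral>x. (u x *\<^sub>R grad \<eta> x) \<bullet> ?X x \<partial>sphere_measure) + (\<integral>x. G x \<bullet> (\<eta> x *\<^sub>R ?X x) \<partial>sphere_measure)
     = (\<integral>x. cut_gradient u G x \<bullet> ?X x \<partial>sphere_measure)"
  proof (subst Bochner_Integration.integral_add[symmetric])
    show "integrable sphere_measure (\<lambda>x. (u x *\<^sub>R grad \<eta> x) \<bullet> ?X x)"
      by (rule integrable_sphere_bounded_mult[OF bounded_bilinear_inner _ contX])
        (rule integrable_sphere_bounded_mult[OF bounded_bilinear_scaleR weakly_differentiable_integrable continuous_on_grad[OF \<eta>]])
    show "integrable sphere_measure (\<lambda>x. G x \<bullet> (\<eta> x *\<^sub>R ?X x))"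
      by (rule integrable_sphere_bounded_mult[OF bounded_bilinear_inner weak_gradient_integrable])
        (intro continuous_on_scaleR contX smooth_continuous_on[OF \<eta>])
  qed (auto intro!: Bochner_Integration.integral_cong simp: cut_gradient_def inner_add_left)
  ultimately have main: "(\<integral>x. u x * (\<eta> x * (x \<bullet> \<xi>)) * ?D x \<partial>sphere_measure) = - (\<integral>x. cut_gradient u G x \<bullet> ?X x \<partial>sphere_measure)"
    by linarith
  have [measurable]: "?D \<in> borel_measurable sphere_measure" "?X \<in> borel_measurable sphere_measure"
    using contD contX by (auto intro!: borel_measurable_sphere_measure borel_measurable_continuous_onI)
  have [measurable]: "cut_gradient u G \<in> borel_measurable sphere_measure" "(\<lambda>x. u x * (\<eta> x * (x \<bullet> \<xi>))) \<in> borel_measurable sphere_measure"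
    using cut_gradient_integrable cut_function_integrable by auto
  have "(\<integral>x. u x * (\<eta> x * (x \<bullet> \<xi>)) * ?D x \<partial>sphere_measure) = (\<integral>z. chart_weight z *\<^sub>R (u (chart z) * (\<eta> (chart z) * (chart z \<bullet> \<xi>)) * ?D (chart z)) \<partial>lborel)"
    using vanishes_on_lower_half by (intro integral_chart) auto
  also have "\<dots> = (\<integral>z. chart_fun u z * frechet_derivative \<psi> (at z) e \<partial>lborel)"
  proof (intro Bochner_Integration.integral_cong refl)
    fix z
    show "chart_weight z *\<^sub>R (u (chart z) * (\<eta> (chart z) * (chart z \<bullet> \<xi>)) * ?D (chart z)) = chart_fun u z * frechet_derivative \<psi> (at z) e"
      using height_pos[of z]
      by (cases "norm z < 1") (auto simp: chart_weight_def chart_fun_def chart_inner_xi coord_chart indicator_def)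
  qed
  finally have L: "(\<integral>x. u x * (\<eta> x * (x \<bullet> \<xi>)) * ?D x \<partial>sphere_measure) = (\<integral>z. chart_fun u z * frechet_derivative \<psi> (at z) e \<partial>lborel)" .
  have "(\<integral>x. cut_gradient u G x \<bullet> ?X x \<partial>sphere_measure) = (\<integral>z. chart_weight z *\<^sub>R (cut_gradient u G (chart z) \<bullet> ?X (chart z)) \<partial>lborel)"
    using vanishes_on_lower_half by (intro integral_chart) auto
  also have "\<dots> = (\<integral>z. (chart_gradient u G z \<bullet> e) * \<psi> z \<partial>lborel)"
  proof (intro Bochner_Integration.integral_cong refl)
    fix z
    let ?H = "cut_gradient u G (chart z)"
    show "chart_weight z *\<^sub>R (?H \<bullet> ?X (chart z)) = (chart_gradient u G z \<bullet> e) * \<psi> z"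
    proof (cases "norm z < 1")
      case True
      then have h: "height z > 0" by (rule height_pos)
      have Te: "T e \<bullet> chart z = e \<bullet> z"
        using inner_coord[of "chart z" e] coord_chart[OF True] by (metis inner_commute)
      have X: "?X (chart z) = (height z * \<psi> z) *\<^sub>R T e - (\<psi> z * (e \<bullet> z)) *\<^sub>R \<xi>"
        using True by (simp add: test_field_def chart_inner_xi coord_chart Te)
      have g: "chart_gradient u G z \<bullet> e = ?H \<bullet> T e - (?H \<bullet> \<xi>) / height z * (e \<bullet> z)"
        using True by (simp add: chart_gradient_def inner_diff_left inner_coord inner_commute[of e z])
      show ?thesis
        unfolding X g using True h by (simp add: chart_weight_def inner_diff_right field_simps)
    qed (simp add: chart_weight_def chart_gradient_def)
  qed
  finally show ?thesis using L main by simp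
qed

text \<open>On the cap the chart is almost an isometry: the vertical part of its derivative has size
  \<open>|z| / height z\<close>, which is at most \<open>2 r\<close>.\<close>

lemma chart_gradient_norm_le:
  assumes "norm z < 1"
  shows "norm (chart_gradient u G z) \<le> (1 + 2 * r) * norm (cut_gradient u G (chart z))"
proof (cases "height z < floor_height")
  case True
  then have "cut_gradient u G (chart z) = 0"
    using assms by (intro cut_gradient_outside chart_in_sphere) (simp add: chart_inner_xi)
  then show ?thesis by (simp add: chart_gradient_def linear_0[OF coord_linear])
next
  case False
  let ?H = "cut_gradient u G (chart z)"
  have h: "height z \<ge> floor_height" "height z > 1 / 2" using False floor_height(1) by auto
  have "(norm z)\<^sup>2 = 1 - (height z)\<^sup>2"
    using assms by (simp add: height_def abs_square_le_1)
  also have "\<dots> \<le> 1 - floor_height\<^sup>2"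
    using h(1) floor_height(1) by (simp add: power_mono)
  also have "\<dots> \<le> r\<^sup>2" by (rule floor_height(3))
  finally have nz: "norm z \<le> r" using r by (simp add: power2_le_iff_abs_le)
  have xi: "\<bar>?H \<bullet> \<xi>\<bar> \<le> norm ?H"
    using Cauchy_Schwarz_ineq2[of ?H \<xi>] by (simp add: norm_xi)
  have "norm (chart_gradient u G z) \<le> norm (coord ?H) + norm (((?H \<bullet> \<xi>) / height z) *\<^sub>R z)"
  proof -
    have "chart_gradient u G z = coord ?H - ((?H \<bullet> \<xi>) / height z) *\<^sub>R z"
      using assms by (simp add: chart_gradient_def)
    then show ?thesis by (simp only: norm_triangle_ineq4)
  qed
  also have "norm (((?H \<bullet> \<xi>) / height z) *\<^sub>R z) = \<bar>?H \<bullet> \<xi>\<bar> * (norm z / height z)"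
    using h by (simp add: abs_divide)
  also have "\<dots> \<le> norm ?H * (2 * r)"
  proof (intro mult_mono xi)
    have "norm z * 1 \<le> r * (2 * height z)"
      using nz h r by (intro mult_mono) auto
    then show "norm z / height z \<le> 2 * r" using h by (simp add: divide_le_eq mult_ac)
  qed (use h in auto)
  finally show ?thesis using norm_coord_le[of ?H] by (simp add: algebra_simps)
qed

end

end

lemma continuous_on_sphere_bounded:
  fixes g :: "'a::euclidean_space \<Rightarrow> 'b::euclidean_space"
  assumes "continuous_on UNIV g"
  obtains M where "0 \<le> M" "\<And>x. x \<in> sphere 0 1 \<Longrightarrow> norm (g x) \<le> M"
proof -
  have "compact (g ` sphere 0 1)" by (intro compact_continuous_image continuous_on_subset[OF assms]) auto
  then obtain M where "\<And>x. x \<in> sphere 0 1 \<Longrightarrow> norm (g x) \<le> M"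
    using compact_imp_bounded by (force simp: bounded_iff)
  then show thesis using that[of "max 0 M"] by force
qed

lemma powr_add_le:
  fixes p \<kappa> :: real
  assumes p: "p > 0" and k: "\<kappa> > 0"
  obtains C where "C \<ge> 0" "\<And>a b. 0 \<le> a \<Longrightarrow> 0 \<le> b \<Longrightarrow> (a + b) powr p \<le> (1 + \<kappa>) * a powr p + C * b powr p"
proof -
  define t where "t = (1 + \<kappa>) powr (1 / p) - 1"
  have "1 < (1 + \<kappa>) powr (1 / p)" using p k by simp
  then have t: "t > 0" by (simp add: t_def)
  have tp: "(1 + t) powr p = 1 + \<kappa>" using p k by (simp add: t_def powr_powr)
  show thesis
  proof (rule that[of "(1 + 1 / t) powr p"])
    fix a b :: real assume ab: "0 \<le> a" "0 \<le> b"
    show "(a + b) powr p \<le> (1 + \<kappa>) * a powr p + (1 + 1 / t) powr p * b powr p"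
    proof (cases "b \<le> t * a")
      case True
      then have "(a + b) powr p \<le> ((1 + t) * a) powr p"
        using ab t p by (intro powr_mono2) (auto simp: algebra_simps)
      also have "\<dots> = (1 + \<kappa>) * a powr p" using ab t by (simp add: powr_mult tp)
      finally show ?thesis by (simp add: add_increasing2)
    next
      case False
      then have "a \<le> b / t" using t by (simp add: field_simps)
      then have "(a + b) powr p \<le> ((1 + 1 / t) * b) powr p"
        using ab t p by (intro powr_mono2) (auto simp: algebra_simps)
      also have "\<dots> = (1 + 1 / t) powr p * b powr p" using ab t by (simp add: powr_mult)
      finally show ?thesis using k by (simp add: add_increasing)
    qed
  qed simp
qed

context sphere_cap
begin

lemma cap_sobolev_cut_gradient:
  assumes p: "1 < p" "p < real CARD('n)" and uG: "has_weak_gradient u G"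
    and H: "integrable sphere_measure (\<lambda>x. norm (cut_gradient u G x) powr p)"
  shows "(\<integral>\<^sup>+x. ennreal (\<bar>\<eta> x * u x\<bar> powr sobolev_exponent CARD('n) p) \<partial>sphere_measure)
    \<le> ennreal ((1 + r\<^sup>2) * (sobolev_const TYPE('n) p * ((1 + 2 * r) *
        Lp_norm p sphere_measure (cut_gradient u G))) powr sobolev_exponent CARD('n) p)"
proof -
  define s where "s = sobolev_exponent CARD('n) p"
  have s0: "s > 0" using p by (simp add: s_def sobolev_exponent_def)
  let ?S = "sobolev_const TYPE('n) p"
  have S0: "?S \<ge> 0" by (rule sobolev_const_nonneg[OF p])
  let ?v = "chart_fun u" and ?g = "chart_gradient u G" and ?H = "cut_gradient u G"
  have [measurable]: "?g \<in> borel_measurable borel" "?v \<in> borel_measurable borel"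
    using chart_gradient_integrable[OF uG] chart_fun_integrable[OF uG] by auto
  have [measurable]: "?H \<in> borel_measurable sphere_measure" "u \<in> borel_measurable sphere_measure"
    using cut_gradient_integrable[OF uG] weakly_differentiable_integrable[OF uG] by auto
  have [measurable]: "\<eta> \<in> borel_measurable sphere_measure"
    by (intro borel_measurable_sphere_measure smooth_borel_measurable \<eta>)
  have [measurable]: "(\<lambda>x. x \<bullet> \<xi>) \<in> borel_measurable sphere_measure"
    by (intro borel_measurable_sphere_measure) measurable
  note [measurable] = chart_measurable_sphere
  note half = vanishes_on_lower_half[OF uG]
  have gp: "(\<integral>\<^sup>+z. ennreal (norm (?g z) powr p) \<partial>lborel)
      \<le> ennreal ((1 + 2 * r) powr p * (\<integral>x. norm (?H x) powr p \<partial>sphere_measure))"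
  proof -
    have "(\<integral>\<^sup>+z. ennreal (norm (?g z) powr p) \<partial>lborel)
      \<le> (\<integral>\<^sup>+z. ennreal ((1 + 2 * r) powr p) * (ennreal (chart_weight z) * ennreal ((chart z \<bullet> \<xi>) * norm (?H (chart z)) powr p)) \<partial>lborel)"
    proof (intro nn_integral_mono)
      fix z
      show "ennreal (norm (?g z) powr p) \<le> ennreal ((1 + 2 * r) powr p) * (ennreal (chart_weight z) * ennreal ((chart z \<bullet> \<xi>) * norm (?H (chart z)) powr p))"
      proof (cases "norm z < 1")
        case True
        have "norm (?g z) powr p \<le> ((1 + 2 * r) * norm (?H (chart z))) powr p"
          using chart_gradient_norm_le[OF uG True] p by (intro powr_mono2) auto
        also have "\<dots> = (1 + 2 * r) powr p * (chart_weight z * ((chart z \<bullet> \<xi>) * norm (?H (chart z)) powr p))"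
          using r True height_pos[OF True] by (simp add: powr_mult chart_weight_def chart_inner_xi)
        finally show ?thesis
          using True height_pos[OF True] chart_weight_nonneg[of z]
          by (simp add: ennreal_mult[symmetric] chart_inner_xi ennreal_leI)
      qed (simp add: chart_gradient_def)
    qed
    also have "\<dots> = ennreal ((1 + 2 * r) powr p) * (\<integral>\<^sup>+z. ennreal (chart_weight z) * ennreal ((chart z \<bullet> \<xi>) * norm (?H (chart z)) powr p) \<partial>lborel)"
      by (rule nn_integral_cmult) measurable
    also have "(\<integral>\<^sup>+z. ennreal (chart_weight z) * ennreal ((chart z \<bullet> \<xi>) * norm (?H (chart z)) powr p) \<partial>lborel)
        = (\<integral>\<^sup>+x. ennreal ((x \<bullet> \<xi>) * norm (?H x) powr p) \<partial>sphere_measure)"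
      by (rule nn_integral_chart[symmetric]) (use half in auto)
    also have "\<dots> \<le> (\<integral>\<^sup>+x. ennreal (norm (?H x) powr p) \<partial>sphere_measure)"
    proof (intro nn_integral_mono ennreal_leI)
      fix x assume "x \<in> space (sphere_measure :: (real ^ 'k) measure)"
      then have "x \<bullet> \<xi> \<le> 1" using norm_cauchy_schwarz[of x \<xi>] norm_xi by simp
      then show "(x \<bullet> \<xi>) * norm (?H x) powr p \<le> norm (?H x) powr p"
        using mult_right_mono[of "x \<bullet> \<xi>" 1 "norm (?H x) powr p"] by simp
    qed
    also have "\<dots> = ennreal (\<integral>x. norm (?H x) powr p \<partial>sphere_measure)"
      by (rule nn_integral_eq_integral[OF H]) simp
    finally show ?thesis by (simp add: ennreal_mult mult_left_mono)
  qed
  then have gpi: "integrable lborel (\<lambda>z. norm (?g z) powr p)"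
    by (intro integrableI_bounded) (auto simp: le_less_trans ennreal_less_top)
  have Ng: "Lp_norm p lborel ?g \<le> (1 + 2 * r) * Lp_norm p sphere_measure ?H"
  proof -
    have "(\<integral>z. norm (?g z) powr p \<partial>lborel) \<le> (1 + 2 * r) powr p * (\<integral>x. norm (?H x) powr p \<partial>sphere_measure)"
      using gp by (subst (asm) nn_integral_eq_integral[OF gpi]) (auto simp: integral_nonneg_AE)
    then have "Lp_norm p lborel ?g \<le> ((1 + 2 * r) powr p * (\<integral>x. norm (?H x) powr p \<partial>sphere_measure)) powr (1 / p)"
      unfolding Lp_norm_def using p by (intro powr_mono2) (auto simp: integral_nonneg_AE)
    also have "\<dots> = (1 + 2 * r) * Lp_norm p sphere_measure ?H"
      using p r by (simp add: powr_mult powr_powr Lp_norm_def integral_nonneg_AE)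
    finally show ?thesis .
  qed
  have "(\<integral>\<^sup>+x. ennreal (\<bar>\<eta> x * u x\<bar> powr s) \<partial>sphere_measure)
      = (\<integral>\<^sup>+z. ennreal (chart_weight z) * ennreal (\<bar>\<eta> (chart z) * u (chart z)\<bar> powr s) \<partial>lborel)"
    by (rule nn_integral_chart) (use half s0 in auto)
  also have "\<dots> \<le> (\<integral>\<^sup>+z. ennreal (1 + r\<^sup>2) * ennreal (\<bar>?v z\<bar> powr s) \<partial>lborel)"
  proof (intro nn_integral_mono)
    fix z
    show "ennreal (chart_weight z) * ennreal (\<bar>\<eta> (chart z) * u (chart z)\<bar> powr s) \<le> ennreal (1 + r\<^sup>2) * ennreal (\<bar>?v z\<bar> powr s)"
    proof (cases "norm z < 1 \<and> height z \<ge> floor_height")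
      case True
      then have "chart_weight z \<le> 1 / floor_height"
        using floor_height(1) by (auto simp: chart_weight_def intro!: divide_left_mono)
      then have "chart_weight z \<le> 1 + r\<^sup>2" using floor_height(2) by linarith
      then have cw: "ennreal (chart_weight z) \<le> ennreal (1 + r\<^sup>2)" by (rule ennreal_leI)
      show ?thesis
        by (rule mult_mono[OF cw]) (use True in \<open>auto simp: chart_fun_def\<close>)
    next
      case False
      then have "norm z \<ge> 1 \<or> \<eta> (chart z) = 0"
        using outside_cap(1)[OF chart_in_sphere, of z] chart_inner_xi[of z] by force
      then show ?thesis using s0 by (auto simp: chart_weight_def)
    qed
  qed
  also have "\<dots> = ennreal (1 + r\<^sup>2) * (\<integral>\<^sup>+z. ennreal (\<bar>?v z\<bar> powr s) \<partial>lborel)"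
    by (rule nn_integral_cmult) measurable
  also have "(\<integral>\<^sup>+z. ennreal (\<bar>?v z\<bar> powr s) \<partial>lborel) \<le> ennreal ((?S * Lp_norm p lborel ?g) powr s)"
    unfolding s_def
    by (rule sobolev_inequality_weak[OF p chart_fun_integrable[OF uG] chart_gradient_integrable[OF uG] _ chart_weak_gradient[OF uG] gpi, of 1])
      (auto simp: chart_fun_def)
  also have "ennreal ((?S * Lp_norm p lborel ?g) powr s) \<le> ennreal ((?S * ((1 + 2 * r) * Lp_norm p sphere_measure ?H)) powr s)"
    using s0 S0 Ng by (intro ennreal_leI powr_mono2 mult_left_mono) (auto simp: Lp_norm_def)
  finally show ?thesis unfolding s_def by (simp add: ennreal_mult mult_left_mono)
qed

end

lemma Lp_space_integrable_powr: "f \<in> Lp_space p M \<Longrightarrow> integrable M (\<lambda>x. norm (f x) powr p)"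
  by (simp add: Lp_space_def)

lemma small_radius_exists:
  fixes K p \<epsilon> :: real
  assumes "K \<ge> 0" "\<epsilon> > 0"
  obtains r where "0 < r" "r < 1" "(1 + r\<^sup>2) * (K * ((1 + 2 * r) powr p * (1 + r))) \<le> K + \<epsilon>"
proof -
  have "((\<lambda>r. (1 + r\<^sup>2) * (K * ((1 + 2 * r) powr p * (1 + r)))) \<longlongrightarrow> (1 + 0\<^sup>2) * (K * ((1 + 2 * 0) powr p * (1 + 0)))) (at_right 0)"
    by (intro tendsto_intros) auto
  then have "eventually (\<lambda>r. (1 + r\<^sup>2) * (K * ((1 + 2 * r) powr p * (1 + r))) < K + \<epsilon>) (at_right 0)"
    by (rule order_tendstoD) (use assms in simp)
  moreover have "eventually (\<lambda>r::real. r < 1) (at_right 0)"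
    by (rule eventually_at_rightI[of 0 1]) auto
  moreover have "eventually (\<lambda>r::real. 0 < r) (at_right 0)"
    by (rule eventually_at_right_less)
  ultimately have "eventually (\<lambda>r. 0 < r \<and> r < 1 \<and> (1 + r\<^sup>2) * (K * ((1 + 2 * r) powr p * (1 + r))) \<le> K + \<epsilon>) (at_right 0)"
    by eventually_elim auto
  then obtain r where "0 < r \<and> r < 1 \<and> (1 + r\<^sup>2) * (K * ((1 + 2 * r) powr p * (1 + r))) \<le> K + \<epsilon>"
    using eventually_happens[of _ "at_right (0::real)"] trivial_limit_at_right_real by blast
  then show thesis using that by blast
qed

text \<open>The radius is chosen so small that the distortion of the chart and the loss in separating
  \<open>\<eta> \<nabla>u\<close> from \<open>u \<nabla>\<eta>\<close> together cost at most
  \<open>\<epsilon>\<close>. The radius serves all centres and all cut-off functions; only the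
  constant of the lower order term depends on the cut-off function.\<close>

theorem local_sobolev_inequality:
  fixes p \<epsilon> :: real
  defines "s \<equiv> sobolev_exponent CARD('n::finite) p"
  assumes card: "CARD('k::finite) = CARD('n) + 1"
    and p: "1 < p" "p < real CARD('n)" and \<epsilon>: "\<epsilon> > 0"
  obtains r where "0 < r" "r < 1"
    "\<And>\<xi> \<eta>. \<xi> \<in> sphere (0 :: real ^ 'k) 1 \<Longrightarrow> smooth \<eta> \<Longrightarrow> (\<And>x. 0 \<le> \<eta> x) \<Longrightarrow> (\<And>x. r \<le> norm (x - \<xi>) \<Longrightarrow> \<eta> x = 0) \<Longrightarrow>
      \<exists>C\<ge>0. \<forall>u G. u \<in> Lp_space p sphere_measure \<longrightarrow> G \<in> Lp_space p sphere_measure \<longrightarrow> has_weak_gradient u G \<longrightarrow>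
        integrable sphere_measure (\<lambda>x. \<bar>\<eta> x * u x\<bar> powr s) \<and>
        (\<integral>x. \<bar>\<eta> x * u x\<bar> powr s \<partial>sphere_measure) powr (p / s) \<le>
          (sobolev_const TYPE('n) p powr p + \<epsilon>) * (\<integral>x. \<eta> x powr p * norm (G x) powr p \<partial>sphere_measure)
          + C * (\<integral>x. \<bar>u x\<bar> powr p \<partial>sphere_measure)"
proof -
  let ?S = "sobolev_const TYPE('n) p"
  have S0: "?S \<ge> 0" by (rule sobolev_const_nonneg[OF p])
  have s0: "s > 0" and ps: "p < s"
    using p by (auto simp: s_def sobolev_exponent_def field_simps)
  obtain r where r: "0 < r" "r < 1" "(1 + r\<^sup>2) * (?S powr p * ((1 + 2 * r) powr p * (1 + r))) \<le> ?S powr p + \<epsilon>"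
    using small_radius_exists[of "?S powr p" \<epsilon> p] \<epsilon> by auto
  obtain C1 where C1: "C1 \<ge> 0" "\<And>a b. 0 \<le> a \<Longrightarrow> 0 \<le> b \<Longrightarrow> (a + b) powr p \<le> (1 + r) * a powr p + C1 * b powr p"
    using powr_add_le[of p r] p r by auto
  define A where "A = (1 + r\<^sup>2) * (?S powr p * (1 + 2 * r) powr p)"
  have A0: "A \<ge> 0" by (simp add: A_def)
  have A: "A * (1 + r) \<le> ?S powr p + \<epsilon>" using r(3) by (simp add: A_def mult.assoc)
  show thesis
  proof (rule that[OF r(1,2)])
    fix \<xi> :: "real ^ 'k" and \<eta> :: "real ^ 'k \<Rightarrow> real"
    assume \<xi>: "\<xi> \<in> sphere 0 1" and eta: "smooth \<eta>" "\<And>x. 0 \<le> \<eta> x" "\<And>x. r \<le> norm (x - \<xi>) \<Longrightarrow> \<eta> x = 0"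
    obtain T :: "real ^ 'n \<Rightarrow> real ^ 'k" where T: "sphere_chart \<xi> T"
      using sphere_chart_exists[OF card \<xi>] by blast
    interpret sphere_cap \<xi> T r \<eta>
      using T r(1,2) eta(1,3) by (simp add: sphere_cap_def sphere_cap_axioms_def)
    obtain M where M: "M \<ge> 0" "\<And>x. x \<in> sphere 0 1 \<Longrightarrow> norm (grad \<eta> x) \<le> M"
      using continuous_on_sphere_bounded[OF continuous_on_grad[OF eta(1)]] by blast
    obtain M' where M': "M' \<ge> 0" "\<And>x. x \<in> sphere 0 1 \<Longrightarrow> norm (\<eta> x) \<le> M'"
      using continuous_on_sphere_bounded[OF smooth_continuous_on[OF eta(1)]] by blast
    let ?C = "A * (C1 * M powr p)"
    have est: "integrable sphere_measure (\<lambda>x. \<bar>\<eta> x * u x\<bar> powr s) \<and>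
        (\<integral>x. \<bar>\<eta> x * u x\<bar> powr s \<partial>sphere_measure) powr (p / s) \<le>
          (?S powr p + \<epsilon>) * (\<integral>x. \<eta> x powr p * norm (G x) powr p \<partial>sphere_measure)
          + ?C * (\<integral>x. \<bar>u x\<bar> powr p \<partial>sphere_measure)"
      if u: "u \<in> Lp_space p sphere_measure" and G: "G \<in> Lp_space p sphere_measure" and uG: "has_weak_gradient u G" for u G
    proof -
      let ?H = "cut_gradient u G"
      have [measurable]: "?H \<in> borel_measurable sphere_measure" "u \<in> borel_measurable sphere_measure" "G \<in> borel_measurable sphere_measure"
        using cut_gradient_integrable[OF uG] weakly_differentiable_integrable[OF uG] weak_gradient_integrable[OF uG] by auto
      have [measurable]: "\<eta> \<in> borel_measurable sphere_measure"
        by (intro borel_measurable_sphere_measure smooth_borel_measurable eta(1))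
      have iu: "integrable sphere_measure (\<lambda>x. \<bar>u x\<bar> powr p)" using Lp_space_integrable_powr[OF u] by simp
      have iG: "integrable sphere_measure (\<lambda>x. norm (G x) powr p)" by (rule Lp_space_integrable_powr[OF G])
      have i\<eta>G: "integrable sphere_measure (\<lambda>x. \<eta> x powr p * norm (G x) powr p)"
      proof (rule Bochner_Integration.integrable_bound)
        show "integrable sphere_measure (\<lambda>x. M' powr p * norm (G x) powr p)" using iG by simp
        show "AE x in sphere_measure. norm (\<eta> x powr p * norm (G x) powr p) \<le> norm (M' powr p * norm (G x) powr p)"
          using M' eta(2) p by (intro AE_I2) (auto simp: abs_mult intro!: mult_right_mono powr_mono2)
      qed measurable
      have Hle: "norm (?H x) powr p \<le> (1 + r) * (\<eta> x powr p * norm (G x) powr p) + C1 * M powr p * \<bar>u x\<bar> powr p"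
        if x: "x \<in> sphere 0 1" for x
      proof -
        have "norm (?H x) \<le> \<eta> x * norm (G x) + \<bar>u x\<bar> * norm (grad \<eta> x)"
          unfolding cut_gradient_def using norm_triangle_ineq[of "\<eta> x *\<^sub>R G x" "u x *\<^sub>R grad \<eta> x"] eta(2)[of x] by simp
        also have "\<dots> \<le> \<eta> x * norm (G x) + \<bar>u x\<bar> * M"
          using M(2)[OF x] by (simp add: mult_left_mono)
        finally have "norm (?H x) powr p \<le> (\<eta> x * norm (G x) + \<bar>u x\<bar> * M) powr p"
          using p by (intro powr_mono2) auto
        also have "\<dots> \<le> (1 + r) * (\<eta> x * norm (G x)) powr p + C1 * (\<bar>u x\<bar> * M) powr p"
          using eta(2) M(1) by (intro C1(2)) auto
        finally show ?thesis using eta(2)[of x] M(1) by (simp add: powr_mult mult_ac)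
      qed
      have bd: "integrable sphere_measure (\<lambda>x. (1 + r) * (\<eta> x powr p * norm (G x) powr p) + C1 * M powr p * \<bar>u x\<bar> powr p)"
        using i\<eta>G iu by simp
      have iH: "integrable sphere_measure (\<lambda>x. norm (?H x) powr p)"
        by (rule Bochner_Integration.integrable_bound[OF bd], measurable)
          (use Hle in \<open>auto intro!: AE_I2 intro: order_trans[OF _ abs_ge_self]\<close>)
      have HI: "(\<integral>x. norm (?H x) powr p \<partial>sphere_measure) \<le>
          (1 + r) * (\<integral>x. \<eta> x powr p * norm (G x) powr p \<partial>sphere_measure) + C1 * M powr p * (\<integral>x. \<bar>u x\<bar> powr p \<partial>sphere_measure)"
      proof -
        have "(\<integral>x. norm (?H x) powr p \<partial>sphere_measure) \<le>
           (\<integral>x. (1 + r) * (\<eta> x powr p * norm (G x) powr p) + C1 * M powr p * \<bar>u x\<bar> powr p \<partial>sphere_measure)"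
          using Hle by (intro integral_mono iH bd) auto
        also have "\<dots> = (1 + r) * (\<integral>x. \<eta> x powr p * norm (G x) powr p \<partial>sphere_measure) + C1 * M powr p * (\<integral>x. \<bar>u x\<bar> powr p \<partial>sphere_measure)"
          using i\<eta>G iu by simp
        finally show ?thesis .
      qed
      define N where "N = Lp_norm p sphere_measure ?H"
      have N0: "N \<ge> 0" by (simp add: N_def Lp_norm_def)
      have Np: "N powr p = (\<integral>x. norm (?H x) powr p \<partial>sphere_measure)"
        using p by (simp add: N_def Lp_norm_def powr_powr integral_nonneg_AE)
      have nn: "(\<integral>\<^sup>+x. ennreal (\<bar>\<eta> x * u x\<bar> powr s) \<partial>sphere_measure) \<le> ennreal ((1 + r\<^sup>2) * (?S * ((1 + 2 * r) * N)) powr s)"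
        unfolding s_def N_def by (rule cap_sobolev_cut_gradient[OF p uG iH])
      have int_s: "integrable sphere_measure (\<lambda>x. \<bar>\<eta> x * u x\<bar> powr s)"
        by (rule integrableI_bounded, measurable) (use nn in \<open>auto simp: le_less_trans[OF _ ennreal_less_top]\<close>)
      have "(\<integral>x. \<bar>\<eta> x * u x\<bar> powr s \<partial>sphere_measure) \<le> (1 + r\<^sup>2) * (?S * ((1 + 2 * r) * N)) powr s"
        using nn by (subst (asm) nn_integral_eq_integral[OF int_s]) auto
      then have "(\<integral>x. \<bar>\<eta> x * u x\<bar> powr s \<partial>sphere_measure) powr (p / s) \<le> ((1 + r\<^sup>2) * (?S * ((1 + 2 * r) * N)) powr s) powr (p / s)"
        using p s0 by (intro powr_mono2) (auto simp: integral_nonneg_AE)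
      also have "\<dots> = (1 + r\<^sup>2) powr (p / s) * (?S * ((1 + 2 * r) * N)) powr p"
        using s0 S0 N0 r by (simp add: powr_mult powr_powr)
      also have "\<dots> \<le> (1 + r\<^sup>2) powr 1 * (?S * ((1 + 2 * r) * N)) powr p"
        using ps p s0 by (intro mult_right_mono powr_mono) auto
      also have "\<dots> = A * N powr p"
        using S0 N0 r by (simp add: A_def powr_mult)
      also have "\<dots> \<le> A * ((1 + r) * (\<integral>x. \<eta> x powr p * norm (G x) powr p \<partial>sphere_measure) + C1 * M powr p * (\<integral>x. \<bar>u x\<bar> powr p \<partial>sphere_measure))"
        unfolding Np by (intro mult_left_mono HI A0)
      also have "\<dots> = A * (1 + r) * (\<integral>x. \<eta> x powr p * norm (G x) powr p \<partial>sphere_measure) + ?C * (\<integral>x. \<bar>u x\<bar> powr p \<partial>sphere_measure)"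
        by (simp add: algebra_simps)
      also have "\<dots> \<le> (?S powr p + \<epsilon>) * (\<integral>x. \<eta> x powr p * norm (G x) powr p \<partial>sphere_measure) + ?C * (\<integral>x. \<bar>u x\<bar> powr p \<partial>sphere_measure)"
        by (intro add_right_mono mult_right_mono A integral_nonneg_AE) auto
      finally show ?thesis using int_s by blast
    qed
    show "\<exists>C\<ge>0. \<forall>u G. u \<in> Lp_space p sphere_measure \<longrightarrow> G \<in> Lp_space p sphere_measure \<longrightarrow> has_weak_gradient u G \<longrightarrow>
        integrable sphere_measure (\<lambda>x. \<bar>\<eta> x * u x\<bar> powr s) \<and>
        (\<integral>x. \<bar>\<eta> x * u x\<bar> powr s \<partial>sphere_measure) powr (p / s) \<le>
          (?S powr p + \<epsilon>) * (\<integral>x. \<eta> x powr p * norm (G x) powr p \<partial>sphere_measure)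
          + C * (\<integral>x. \<bar>u x\<bar> powr p \<partial>sphere_measure)"
    proof (intro exI[of _ ?C] conjI allI impI)
      show "0 \<le> ?C" using A0 C1(1) by simp
    qed (use est in blast)+
  qed
qed

section \<open>Uniqueness of weak gradients\<close>

text \<open>By the Stone-Weierstrass theorem orthogonality extends from polynomials to continuous
  functions, then to indicators of closed sets. Hence the positive and the negative part of
  \<open>d\<close> are densities of the same measure.\<close>

lemma AE_zero_if_orthogonal_to_smooth:
  fixes d :: "'a::euclidean_space \<Rightarrow> real"
  assumes d: "integrable sphere_measure d"
    and z: "\<And>\<psi>. smooth \<psi> \<Longrightarrow> (\<integral>x. \<psi> x * d x \<partial>sphere_measure) = 0"
  shows "AE x in sphere_measure. d x = 0"
proof -
  have [measurable]: "d \<in> borel_measurable sphere_measure" using d by auto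
  have dm: "integrable sphere_measure (\<lambda>x. f x * d x)" if "continuous_on UNIV f" for f :: "'a \<Rightarrow> real"
    using integrable_sphere_bounded_mult[OF bounded_bilinear_mult d that] by (simp add: mult.commute)
  have cont: "(\<integral>x. f x * d x \<partial>sphere_measure) = 0" if f: "continuous_on UNIV f" for f :: "'a \<Rightarrow> real"
  proof (rule ccontr)
    assume nz: "(\<integral>x. f x * d x \<partial>sphere_measure) \<noteq> 0"
    define I where "I = (\<integral>x. \<bar>d x\<bar> \<partial>sphere_measure)"
    have I0: "I \<ge> 0" by (simp add: I_def integral_nonneg_AE)
    \<comment> \<open>The denominator I + 1 avoids a case distinction on I = 0.\<close>
    define e where "e = \<bar>\<integral>x. f x * d x \<partial>sphere_measure\<bar> / (I + 1)"
    have e: "e > 0" using nz I0 by (simp add: e_def)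
    obtain g where g: "real_polynomial_function g" "\<And>x. x \<in> sphere 0 1 \<Longrightarrow> \<bar>f x - g x\<bar> < e"
      using Stone_Weierstrass_real_polynomial_function[OF compact_sphere continuous_on_subset[OF f] e, of 0 1] by auto
    have sg: "smooth g" by (rule smooth_real_polynomial_function[OF g(1)])
    have ig: "integrable sphere_measure (\<lambda>x. g x * d x)" by (rule dm[OF smooth_continuous_on[OF sg]])
    have "(\<integral>x. f x * d x \<partial>sphere_measure) = (\<integral>x. f x * d x - g x * d x \<partial>sphere_measure)"
      using dm[OF f] ig z[OF sg] by simp
    also have "\<bar>\<dots>\<bar> \<le> (\<integral>x. \<bar>f x * d x - g x * d x\<bar> \<partial>sphere_measure)"
      by (rule integral_abs_bound)
    also have "\<dots> \<le> (\<integral>x. e * \<bar>d x\<bar> \<partial>sphere_measure)"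
    proof (rule integral_mono)
      show "\<bar>f x * d x - g x * d x\<bar> \<le> e * \<bar>d x\<bar>" if "x \<in> space sphere_measure" for x
        using g(2)[of x] that by (simp add: left_diff_distrib[symmetric] abs_mult mult_right_mono)
    qed (use dm[OF f] ig d in auto)
    also have "\<dots> = e * I" by (simp add: I_def)
    also have "\<dots> < e * (I + 1)" using e by simp
    also have "\<dots> = \<bar>\<integral>x. f x * d x \<partial>sphere_measure\<bar>" using I0 by (simp add: e_def)
    finally show False by simp
  qed
  have closed: "(\<integral>x. indicator C x * d x \<partial>sphere_measure) = 0" if C: "closed C" for C :: "'a set"
  proof (cases "C = {}")
    case False
    \<comment> \<open>Continuous functions decreasing to the indicator of C.\<close>
    define h where "h n x = max 0 (1 - real n * infdist x C)" for n :: nat and x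
    have hc: "continuous_on UNIV (h n)" for n
      unfolding h_def by (intro continuous_intros)
    have [measurable]: "h n \<in> borel_measurable sphere_measure" for n
      by (intro borel_measurable_sphere_measure borel_measurable_continuous_onI hc)
    have [measurable]: "(indicator C :: _ \<Rightarrow> real) \<in> borel_measurable sphere_measure"
      by (intro borel_measurable_sphere_measure borel_measurable_indicator) (simp add: C)
    have "(\<lambda>n. \<integral>x. h n x * d x \<partial>sphere_measure) \<longlonglongrightarrow> (\<integral>x. indicator C x * d x \<partial>sphere_measure)"
    proof (rule integral_dominated_convergence)
      show "integrable sphere_measure (\<lambda>x. \<bar>d x\<bar>)" using d by simp
      show "AE x in sphere_measure. norm (h n x * d x) \<le> \<bar>d x\<bar>" for n
        by (intro AE_I2) (auto simp: abs_mult h_def infdist_nonneg intro!: mult_left_le_one_le)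
      have "(\<lambda>n. h n x) \<longlonglongrightarrow> indicator C x" for x
      proof (cases "x \<in> C")
        case True
        then show ?thesis by (simp add: h_def)
      next
        case False
        then have pos: "infdist x C > 0"
          using infdist_pos_not_in_closed[OF C \<open>C \<noteq> {}\<close>] by blast
        obtain N :: nat where N: "1 / infdist x C < real N" using reals_Archimedean2 by blast
        have "h n x = 0" if "n \<ge> N" for n
        proof -
          have "1 / infdist x C \<le> real n" using N that by linarith
          then have "1 \<le> real n * infdist x C" using pos by (simp add: divide_le_eq)
          then show ?thesis by (simp add: h_def)
        qed
        then have "eventually (\<lambda>n. 0 = h n x) sequentially"
          by (auto simp: eventually_sequentially intro!: exI[of _ N])
        then show ?thesis using False by (auto intro: Lim_transform_eventually[OF tendsto_const])
      qed
      then show "AE x in sphere_measure. (\<lambda>n. h n x * d x) \<longlonglongrightarrow> indicator C x * d x"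
        by (intro AE_I2 tendsto_mult tendsto_const)
    qed measurable
    moreover have "(\<lambda>n. \<integral>x. h n x * d x \<partial>sphere_measure) = (\<lambda>n. 0)"
      using cont[OF hc] by auto
    ultimately show ?thesis by (simp add: LIMSEQ_const_iff)
  qed simp
  define M1 where "M1 = density sphere_measure (\<lambda>x. ennreal (max 0 (d x)))"
  define M2 where "M2 = density sphere_measure (\<lambda>x. ennreal (max 0 (- d x)))"
  define N1 where "N1 = distr M1 borel (\<lambda>x. x)"
  define N2 where "N2 = distr M2 borel (\<lambda>x. x)"
  have idm: "(\<lambda>x. x) \<in> sphere_measure \<rightarrow>\<^sub>M (borel :: 'a measure)"
    by (rule borel_measurable_sphere_measure) simp
  have sb: "C \<inter> sphere 0 1 \<in> sets sphere_measure" if "C \<in> sets borel" for C :: "'a set"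
    unfolding sets_sphere_measure by (simp add: sets_restrict_space_iff borel_closed sets.Int[OF that])
  have dpos: "integrable sphere_measure (\<lambda>x. max 0 (d x) * indicator C x)" "integrable sphere_measure (\<lambda>x. max 0 (- d x) * indicator C x)"
    if C: "C \<in> sets borel" for C :: "'a set"
  proof -
    have [measurable]: "(indicator C :: _ \<Rightarrow> real) \<in> borel_measurable sphere_measure"
      by (intro borel_measurable_sphere_measure borel_measurable_indicator C)
    have *: "integrable sphere_measure (\<lambda>x. max 0 (f x) * indicator C x)"
      if f: "integrable sphere_measure f" for f :: "'a \<Rightarrow> real"
    proof (rule Bochner_Integration.integrable_bound[OF f])
      have [measurable]: "f \<in> borel_measurable sphere_measure" using f by auto
      show "(\<lambda>x. max 0 (f x) * indicator C x) \<in> borel_measurable sphere_measure" by measurable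
      show "AE x in sphere_measure. norm (max 0 (f x) * indicator C x) \<le> norm (f x)"
        by (rule AE_I2) (auto simp: indicator_def)
    qed
    show "integrable sphere_measure (\<lambda>x. max 0 (d x) * indicator C x)" "integrable sphere_measure (\<lambda>x. max 0 (- d x) * indicator C x)"
      using *[of d] *[of "\<lambda>x. - d x"] d by simp_all
  qed
  have N: "emeasure N1 C = ennreal (\<integral>x. max 0 (d x) * indicator C x \<partial>sphere_measure)"
      "emeasure N2 C = ennreal (\<integral>x. max 0 (- d x) * indicator C x \<partial>sphere_measure)"
    if C: "C \<in> sets borel" for C :: "'a set"
  proof -
    have *: "(\<integral>\<^sup>+x. ennreal (f x) * indicator (C \<inter> sphere 0 1) x \<partial>sphere_measure) = (\<integral>\<^sup>+x. ennreal (f x * indicator C x) \<partial>sphere_measure)"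
      for f :: "'a \<Rightarrow> real"
      by (intro nn_integral_cong) (auto simp: indicator_def)
    have 1: "emeasure N1 C = (\<integral>\<^sup>+x. ennreal (max 0 (d x)) * indicator (C \<inter> sphere 0 1) x \<partial>sphere_measure)"
      unfolding N1_def M1_def using C sb[OF C] idm
      by (subst emeasure_distr) (auto simp: emeasure_density)
    have 2: "emeasure N2 C = (\<integral>\<^sup>+x. ennreal (max 0 (- d x)) * indicator (C \<inter> sphere 0 1) x \<partial>sphere_measure)"
      unfolding N2_def M2_def using C sb[OF C] idm
      by (subst emeasure_distr) (auto simp: emeasure_density)
    show "emeasure N1 C = ennreal (\<integral>x. max 0 (d x) * indicator C x \<partial>sphere_measure)"
      unfolding 1 * by (rule nn_integral_eq_integral[OF dpos(1)[OF C]]) auto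
    show "emeasure N2 C = ennreal (\<integral>x. max 0 (- d x) * indicator C x \<partial>sphere_measure)"
      unfolding 2 * by (rule nn_integral_eq_integral[OF dpos(2)[OF C]]) auto
  qed
  have "N1 = N2"
  proof (rule measure_eqI_generator_eq[of "Collect closed" UNIV _ _ "\<lambda>_. UNIV"])
    show "Int_stable (Collect closed :: 'a set set)" by (auto simp: Int_stable_def)
    show "sets N1 = sigma_sets UNIV (Collect closed)" "sets N2 = sigma_sets UNIV (Collect closed)"
      by (simp_all add: N1_def N2_def borel_eq_closed)
    show "emeasure N1 C = emeasure N2 C" if "C \<in> Collect closed" for C
    proof -
      have C: "C \<in> sets borel" using that by simp
      have "(\<integral>x. max 0 (d x) * indicator C x \<partial>sphere_measure) - (\<integral>x. max 0 (- d x) * indicator C x \<partial>sphere_measure)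
         = (\<integral>x. max 0 (d x) * indicator C x - max 0 (- d x) * indicator C x \<partial>sphere_measure)"
        by (rule Bochner_Integration.integral_diff[symmetric]) (rule dpos[OF C])+
      also have "\<dots> = (\<integral>x. indicator C x * d x \<partial>sphere_measure)"
        by (intro Bochner_Integration.integral_cong) (auto simp: indicator_def max_def)
      finally show ?thesis using closed[of C] that by (simp add: N[OF C])
    qed
    show "emeasure N1 UNIV \<noteq> \<infinity>" by (simp add: N)
  qed auto
  have "M1 = M2"
  proof (rule measure_eqI)
    fix A assume "A \<in> sets M1"
    then have A: "A \<in> sets sphere_measure" by (simp add: M1_def)
    then have Ab: "A \<in> sets borel" "A \<subseteq> sphere 0 1"
      unfolding sets_sphere_measure by (subst (asm) sets_restrict_space_iff; auto)+
    have "emeasure N1 A = emeasure M1 A" "emeasure N2 A = emeasure M2 A"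
      unfolding N1_def N2_def using Ab idm
      by (subst emeasure_distr; auto simp: M1_def M2_def Int_absorb2)+
    then show "emeasure M1 A = emeasure M2 A" using \<open>N1 = N2\<close> by simp
  qed (simp add: M1_def M2_def)
  then have "AE x in sphere_measure. ennreal (max 0 (d x)) = ennreal (max 0 (- d x))"
    unfolding M1_def M2_def by (subst (asm) sphere.density_unique_iff) auto
  then show ?thesis
    by (rule AE_mp) (auto intro!: AE_I2 simp: max_def split: if_splits)
qed

text \<open>The tangential projection of an arbitrary smooth field is an admissible test field, and the
  difference of two weak gradients does not see the normal part.\<close>

lemma weak_gradient_unique:
  fixes u :: "'a::euclidean_space \<Rightarrow> real"
  assumes 1: "has_weak_gradient u G1" and 2: "has_weak_gradient u G2"
  shows "AE x in sphere_measure. G1 x = G2 x"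
proof -
  define D where "D x = G1 x - G2 x" for x
  have i: "integrable sphere_measure G1" "integrable sphere_measure G2"
    using 1 2 by (auto simp: has_weak_gradient_def)
  then have iD: "integrable sphere_measure D" by (simp add: D_def[abs_def])
  have tan: "AE x in sphere_measure. D x \<bullet> x = 0"
  proof -
    have "AE x in sphere_measure. G1 x \<bullet> x = 0" "AE x in sphere_measure. G2 x \<bullet> x = 0"
      using 1 2 by (auto simp: has_weak_gradient_def)
    then show ?thesis by eventually_elim (simp add: D_def inner_diff_left)
  qed
  have "AE x in sphere_measure. D x \<bullet> b = 0" for b
  proof (rule AE_zero_if_orthogonal_to_smooth)
    show "integrable sphere_measure (\<lambda>x. D x \<bullet> b)" using iD by simp
    fix \<psi> :: "'a \<Rightarrow> real" assume \<psi>: "smooth \<psi>"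
    define X where "X x = \<psi> x *\<^sub>R (b - (b \<bullet> x) *\<^sub>R x)" for x
    have smX: "smooth X" unfolding X_def
      by (intro smooth_scaleR \<psi> smooth_diff smooth_const smooth_inner smooth_ident)
    have tX: "smooth_tangent_field X"
      unfolding smooth_tangent_field_def using smX
      by (auto simp: X_def inner_diff_left norm_eq_1)
    have iX: "integrable sphere_measure (\<lambda>x. G1 x \<bullet> X x)" "integrable sphere_measure (\<lambda>x. G2 x \<bullet> X x)"
      using i by (auto intro!: integrable_sphere_bounded_mult[OF bounded_bilinear_inner] smooth_continuous_on smX)
    have "(\<integral>x. G1 x \<bullet> X x \<partial>sphere_measure) = (\<integral>x. G2 x \<bullet> X x \<partial>sphere_measure)"
    proof -
      have "(\<integral>x. u x * sphere_div X x \<partial>sphere_measure) = - (\<integral>x. G1 x \<bullet> X x \<partial>sphere_measure)"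
        "(\<integral>x. u x * sphere_div X x \<partial>sphere_measure) = - (\<integral>x. G2 x \<bullet> X x \<partial>sphere_measure)"
        using 1 2 tX by (simp_all add: has_weak_gradient_def)
      then show ?thesis by linarith
    qed
    then have "0 = (\<integral>x. G1 x \<bullet> X x - G2 x \<bullet> X x \<partial>sphere_measure)"
      using iX by simp
    also have "\<dots> = (\<integral>x. \<psi> x * (D x \<bullet> b) \<partial>sphere_measure)"
    proof (rule integral_cong_AE)
      show "AE x in sphere_measure. G1 x \<bullet> X x - G2 x \<bullet> X x = \<psi> x * (D x \<bullet> b)"
        using tan
      proof eventually_elim
        case (elim x)
        have "G1 x \<bullet> X x - G2 x \<bullet> X x = D x \<bullet> X x" by (simp add: D_def inner_diff_left)
        also have "\<dots> = \<psi> x * (D x \<bullet> b)" using elim by (simp add: X_def inner_diff_right)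
        finally show ?case .
      qed
      show "(\<lambda>x. G1 x \<bullet> X x - G2 x \<bullet> X x) \<in> borel_measurable sphere_measure" using iX by auto
      have [measurable]: "\<psi> \<in> borel_measurable sphere_measure" "D \<in> borel_measurable sphere_measure"
        using iD \<psi> by (auto intro!: borel_measurable_sphere_measure smooth_borel_measurable)
      show "(\<lambda>x. \<psi> x * (D x \<bullet> b)) \<in> borel_measurable sphere_measure" by measurable
    qed
    finally show "(\<integral>x. \<psi> x * (D x \<bullet> b) \<partial>sphere_measure) = 0" by simp
  qed
  then have "AE x in sphere_measure. \<forall>b\<in>Basis. D x \<bullet> b = 0"
    by (intro AE_finite_allI) auto
  then show ?thesis
    by eventually_elim (auto simp: D_def inner_diff_left euclidean_eq_iff[where 'a='a])
qed

lemma
  fixes u :: "'a::euclidean_space \<Rightarrow> real"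
  assumes "u \<in> sphere_W1 p"
  shows sphere_W1_has_weak_gradient: "has_weak_gradient u (weak_gradient u)"
    and sphere_W1_weak_gradient_Lp: "weak_gradient u \<in> Lp_space p sphere_measure"
proof -
  obtain G where G: "G \<in> Lp_space p sphere_measure" "has_weak_gradient u G"
    using assms by (auto simp: sphere_W1_def)
  show w: "has_weak_gradient u (weak_gradient u)"
    unfolding weak_gradient_def by (rule someI[of _ G]) (rule G(2))
  have m: "weak_gradient u \<in> borel_measurable sphere_measure" "G \<in> borel_measurable sphere_measure"
    using w G by (auto simp: has_weak_gradient_def)
  have "AE x in sphere_measure. norm (G x) powr p = norm (weak_gradient u x) powr p"
    using weak_gradient_unique[OF G(2) w] by eventually_elim simp
  then have "integrable sphere_measure (\<lambda>x. norm (G x) powr p) \<longleftrightarrow> integrable sphere_measure (\<lambda>x. norm (weak_gradient u x) powr p)"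
    by (intro integrable_cong_AE) (use m in measurable)
  then show "weak_gradient u \<in> Lp_space p sphere_measure"
    using G(1) m by (simp add: Lp_space_def)
qed

section \<open>Orthonormal polynomials on the sphere\<close>

text \<open>The surface measure charges every nonempty open set: the cone over such a set is open.\<close>

lemma sphere_continuous_AE_zero_imp_zero:
  fixes f :: "'a::euclidean_space \<Rightarrow> real"
  assumes f: "continuous_on UNIV f" and ae: "AE x in sphere_measure. f x = 0" and x: "x \<in> sphere 0 1"
  shows "f x = 0"
proof (rule ccontr)
  assume nz: "f x \<noteq> 0"
  let ?B = "ball (0::'a) 1 - {0}"
  let ?U = "{y \<in> ?B. f (sgn y) \<noteq> 0}"
  have cs: "continuous_on ?B (\<lambda>y::'a. sgn y)"
    unfolding sgn_div_norm by (intro continuous_intros) auto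
  have cf: "continuous_on ?B (\<lambda>y. f (sgn y))"
    by (rule continuous_on_compose2[OF f cs]) auto
  have U: "open ?U"
  proof -
    have "open ((\<lambda>y. f (sgn y)) -` (- {0}) \<inter> ?B)"
      using continuous_on_open_vimage[of ?B "\<lambda>y. f (sgn y)"] cf by (auto simp: open_Diff)
    moreover have "(\<lambda>y. f (sgn y)) -` (- {0}) \<inter> ?B = ?U" by auto
    ultimately show ?thesis by simp
  qed
  have [measurable]: "f \<in> borel_measurable sphere_measure"
    by (intro borel_measurable_sphere_measure borel_measurable_continuous_onI f)
  let ?g = "\<lambda>x. indicator (- {0}) (f x) :: ennreal"
  have gm: "?g \<in> borel_measurable sphere_measure"
  proof (rule measurable_compose[of f _ borel])
    show "(indicator (- {0}) :: real \<Rightarrow> ennreal) \<in> borel_measurable borel"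
      by (rule borel_measurable_indicator) simp
  qed measurable
  have "(\<integral>\<^sup>+x. ?g x \<partial>sphere_measure) = 0"
  proof (subst nn_integral_0_iff_AE[OF gm])
    show "AE x in sphere_measure. ?g x = 0" using ae by eventually_elim simp
  qed
  then have int0: "(\<integral>\<^sup>+y. ?g (sgn y) * indicator ?B y \<partial>lborel) = 0"
    using nn_integral_sphere_measure[OF gm] by simp
  have "(\<lambda>y. ?g (sgn y) * indicator ?B y) = indicator ?U"
    by (auto simp: indicator_def fun_eq_iff)
  with int0 have "emeasure lborel ?U = 0"
    using U by (simp add: borel_open)
  then have "negligible ?U"
    using U by (simp add: negligible_iff_null_sets null_sets_def)
  moreover have "(1/2) *\<^sub>R x \<in> ?U"
  proof -
    have "sgn ((1/2) *\<^sub>R x) = x" using x by (simp add: sgn_div_norm)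
    then show ?thesis using x nz by auto
  qed
  then have "?U \<noteq> {}" by blast
  ultimately show False using open_not_negligible[OF U] by blast
qed

lemma integrable_sphere_continuous:
  fixes f :: "'a::euclidean_space \<Rightarrow> 'b::euclidean_space"
  assumes "continuous_on UNIV f"
  shows "integrable sphere_measure f"
  using integrable_sphere_bounded_mult[OF bounded_bilinear_scaleR, of "\<lambda>_. 1" f] assms by simp

text \<open>Gram-Schmidt for functions on the sphere. A function is dropped if its remainder has norm
  zero, since a continuous remainder then vanishes at every point of the sphere. Expansions are
  therefore valid pointwise, which is what integrals against atomic measures require.\<close>

lemma orthonormal_family_exists:
  fixes V :: "('a::euclidean_space \<Rightarrow> real) set"
  assumes B: "finite B" "B \<subseteq> V"
    and cont: "\<And>f. f \<in> V \<Longrightarrow> continuous_on UNIV f"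
    and lin: "\<And>f g c. f \<in> V \<Longrightarrow> g \<in> V \<Longrightarrow> (\<lambda>x. f x + c * g x) \<in> V"
  shows "\<exists>E. finite E \<and> E \<subseteq> V \<and>
    (\<forall>e\<in>E. \<forall>e'\<in>E. (\<integral>x. e x * e' x \<partial>sphere_measure) = (if e = e' then 1 else 0)) \<and>
    (\<forall>b\<in>B. \<forall>x\<in>sphere 0 1. b x = (\<Sum>e\<in>E. (\<integral>x. b x * e x \<partial>sphere_measure) * e x))"
  using B
proof (induction B rule: finite_induct)
  case empty
  show ?case by (intro exI[of _ "{}"]) simp
next
  case (insert b B)
  have "B \<subseteq> V" using insert.prems by simp
  from insert.IH[OF this] obtain E where E12: "finite E" "E \<subseteq> V"
    and E3: "\<forall>e\<in>E. \<forall>e'\<in>E. (\<integral>x. e x * e' x \<partial>sphere_measure) = (if e = e' then 1 else 0)"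
    and E4: "\<forall>b\<in>B. \<forall>x\<in>sphere 0 1. b x = (\<Sum>e\<in>E. (\<integral>x. b x * e x \<partial>sphere_measure) * e x)"
    by blast
  have E3': "(\<integral>x. e x * e' x \<partial>sphere_measure) = (if e = e' then 1 else 0)" if "e \<in> E" "e' \<in> E" for e e'
    using E3 that by blast
  have E4': "b x = (\<Sum>e\<in>E. (\<integral>x. b x * e x \<partial>sphere_measure) * e x)" if "b \<in> B" "x \<in> sphere 0 1" for b x
    using E4 that by blast
  note E = E12 E3' E4'
  have bV: "b \<in> V" using insert.prems by simp
  have int: "integrable sphere_measure (\<lambda>x. f x * g x)" if "f \<in> V" "g \<in> V" for f g
    using that by (intro integrable_sphere_continuous continuous_on_mult cont)
  define ip where "ip f g = (\<integral>x. f x * g x \<partial>sphere_measure)" for f g :: "'a \<Rightarrow> real"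
  define b' where "b' x = b x - (\<Sum>e\<in>E. ip b e * e x)" for x
  have sumV: "(\<lambda>x. b x - (\<Sum>e\<in>F. c e * e x)) \<in> V" if "finite F" "F \<subseteq> V" for F and c :: "('a \<Rightarrow> real) \<Rightarrow> real"
    using that
  proof (induction F rule: finite_induct)
    case empty then show ?case using bV by simp
  next
    case (insert e F)
    then have "(\<lambda>x. (b x - (\<Sum>e\<in>F. c e * e x)) + (- c e) * e x) \<in> V" by (intro lin) auto
    then show ?case using insert by (simp add: algebra_simps)
  qed
  have b'V: "b' \<in> V" unfolding b'_def[abs_def] using E by (intro sumV) auto
  have ipb': "ip b' e = 0" if e: "e \<in> E" for e
  proof -
    have eV: "e \<in> V" using e E(2) by auto
    have i2: "integrable sphere_measure (\<lambda>x. (ip b e' * e' x) * e x)" if "e' \<in> E" for e'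
      using int[of e' e] that E(2) eV by (simp add: mult.assoc subset_iff)
    have "ip b' e = (\<integral>x. b x * e x - (\<Sum>e'\<in>E. (ip b e' * e' x) * e x) \<partial>sphere_measure)"
      by (simp add: ip_def b'_def left_diff_distrib sum_distrib_right)
    also have "\<dots> = ip b e - (\<Sum>e'\<in>E. (\<integral>x. (ip b e' * e' x) * e x \<partial>sphere_measure))"
      unfolding ip_def[of b e] using i2
      by (subst Bochner_Integration.integral_diff) (auto intro!: int bV eV simp: Bochner_Integration.integral_sum)
    also have "(\<Sum>e'\<in>E. (\<integral>x. (ip b e' * e' x) * e x \<partial>sphere_measure)) = (\<Sum>e'\<in>E. if e' = e then ip b e else 0)"
      using E(3)[OF _ e] by (intro sum.cong) (auto simp: mult.assoc)
    also have "\<dots> = ip b e" using E(1) e by simp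
    finally show ?thesis by simp
  qed
  define n where "n = ip b' b'"
  have n0: "n \<ge> 0" unfolding n_def ip_def by (intro integral_nonneg_AE) auto
  show ?case
  proof (cases "n = 0")
    case True
    have "AE x in sphere_measure. b' x * b' x = 0"
      using True integral_nonneg_eq_0_iff_AE[OF int[OF b'V b'V]] by (auto simp: n_def ip_def)
    then have ae: "AE x in sphere_measure. b' x = 0" by (rule eventually_mono) auto
    have "b x = (\<Sum>e\<in>E. ip b e * e x)" if "x \<in> sphere 0 1" for x
      using sphere_continuous_AE_zero_imp_zero[OF cont[OF b'V] ae that] by (simp add: b'_def)
    then show ?thesis
      using E by (intro exI[of _ E]) (auto simp: ip_def)
  next
    case False
    then have n: "n > 0" using n0 by simp
    define e0 where "e0 x = (1 / sqrt n) * b' x" for x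
    have e0V: "e0 \<in> V"
    proof -
      have "(\<lambda>x. b' x + (1 / sqrt n - 1) * b' x) \<in> V" by (rule lin[OF b'V b'V])
      then show ?thesis by (simp add: e0_def[abs_def] algebra_simps)
    qed
    have ip_e0: "ip e0 f = (1 / sqrt n) * ip b' f" for f
      by (simp add: ip_def e0_def mult.assoc)
    have comm: "ip f g = ip g f" for f g by (simp add: ip_def mult.commute)
    have e0e: "ip e0 e = 0" "ip e e0 = 0" if "e \<in> E" for e
    proof -
      show *: "ip e0 e = 0" by (simp only: ip_e0 ipb'[OF that] mult_zero_right)
      show "ip e e0 = 0" using * comm[of e e0] by simp
    qed
    have "ip e0 e0 = (1 / sqrt n) * ((1 / sqrt n) * ip b' b')"
    proof -
      have "ip e0 e0 = (1 / sqrt n) * ip b' e0" by (rule ip_e0)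
      also have "ip b' e0 = ip e0 b'" by (rule comm)
      also have "\<dots> = (1 / sqrt n) * ip b' b'" by (rule ip_e0)
      finally show ?thesis .
    qed
    then have e0e0: "ip e0 e0 = 1" using n by (simp add: n_def[symmetric])
    have e0E: "e0 \<notin> E" using e0e e0e0 by force
    have b_eq: "b x = (\<Sum>e\<in>E. ip b e * e x) + sqrt n * e0 x" for x
      using n by (simp add: e0_def b'_def)
    have ipbe0: "ip b e0 = sqrt n"
    proof -
      have i1: "integrable sphere_measure (\<lambda>x. (ip b e * e x) * e0 x)" if "e \<in> E" for e
        using int[of e e0] that E(2) e0V by (simp add: mult.assoc subset_iff)
      have "ip b e0 = (\<integral>x. (\<Sum>e\<in>E. (ip b e * e x) * e0 x) + sqrt n * (e0 x * e0 x) \<partial>sphere_measure)"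
        unfolding ip_def[of b e0] by (subst b_eq) (simp add: distrib_right sum_distrib_right mult.assoc)
      also have "\<dots> = (\<Sum>e\<in>E. (\<integral>x. (ip b e * e x) * e0 x \<partial>sphere_measure)) + sqrt n * ip e0 e0"
        using i1 int[OF e0V e0V]
        by (subst Bochner_Integration.integral_add) (auto simp: Bochner_Integration.integral_sum ip_def)
      also have "(\<Sum>e\<in>E. (\<integral>x. (ip b e * e x) * e0 x \<partial>sphere_measure)) = (\<Sum>e\<in>E. ip b e * ip e e0)"
        by (intro sum.cong) (auto simp: ip_def mult.assoc)
      finally show ?thesis by (simp add: e0e0 e0e)
    qed
    have old: "ip b1 e0 = 0" if "b1 \<in> B" for b1
    proof -
      have i1: "integrable sphere_measure (\<lambda>x. (ip b1 e * e x) * e0 x)" if "e \<in> E" for e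
        using int[of e e0] that E(2) e0V by (simp add: mult.assoc subset_iff)
      have "ip b1 e0 = (\<integral>x. (\<Sum>e\<in>E. (ip b1 e * e x) * e0 x) \<partial>sphere_measure)"
        unfolding ip_def[of b1 e0]
      proof (intro Bochner_Integration.integral_cong refl)
        fix x :: 'a assume "x \<in> space sphere_measure"
        then show "b1 x * e0 x = (\<Sum>e\<in>E. (ip b1 e * e x) * e0 x)"
          using E(4)[OF that, of x] by (simp add: ip_def sum_distrib_right)
      qed
      also have "\<dots> = (\<Sum>e\<in>E. (\<integral>x. (ip b1 e * e x) * e0 x \<partial>sphere_measure))"
        using i1 by (rule Bochner_Integration.integral_sum)
      also have "\<dots> = (\<Sum>e\<in>E. ip b1 e * ip e e0)"
        by (intro sum.cong) (auto simp: ip_def mult.assoc)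
      finally show ?thesis by (simp add: e0e)
    qed
    show ?thesis
    proof (intro exI[of _ "insert e0 E"] conjI ballI)
      show "finite (insert e0 E)" "insert e0 E \<subseteq> V" using E e0V by auto
      show "(\<integral>x. e x * e' x \<partial>sphere_measure) = (if e = e' then 1 else 0)"
        if "e \<in> insert e0 E" "e' \<in> insert e0 E" for e e'
        using that E(3) e0e e0e0 e0E by (auto simp: ip_def)
      show "b1 x = (\<Sum>e\<in>insert e0 E. (\<integral>x. b1 x * e x \<partial>sphere_measure) * e x)"
        if "b1 \<in> insert b B" "x \<in> sphere 0 1" for b1 x
      proof -
        have "(\<Sum>e\<in>insert e0 E. ip b1 e * e x) = ip b1 e0 * e0 x + (\<Sum>e\<in>E. ip b1 e * e x)"
          using E(1) e0E by simp
        also have "\<dots> = b1 x"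
          using that b_eq[of x] ipbe0 old[of b1] E(4)[of b1 x] by (auto simp: ip_def)
        finally show ?thesis by (simp add: ip_def)
      qed
    qed
  qed
qed

lemma finite_multi_indices: "finite {\<alpha> :: 'k::finite \<Rightarrow> nat. (\<Sum>i\<in>UNIV. \<alpha> i) \<le> m}"
proof (rule finite_subset)
  show "{\<alpha> :: 'k \<Rightarrow> nat. (\<Sum>i\<in>UNIV. \<alpha> i) \<le> m} \<subseteq> {\<alpha>. \<forall>i. (i \<in> UNIV \<longrightarrow> \<alpha> i \<in> {..m}) \<and> (i \<notin> UNIV \<longrightarrow> \<alpha> i = 0)}"
    using member_le_sum[of _ UNIV] by (auto intro: order_trans[of _ "sum _ _"]) (meson UNIV_I finite le_trans member_le_sum zero_le)
  show "finite {\<alpha> :: 'k \<Rightarrow> nat. \<forall>i. (i \<in> UNIV \<longrightarrow> \<alpha> i \<in> {..m}) \<and> (i \<notin> UNIV \<longrightarrow> \<alpha> i = 0)}"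
    by (rule finite_set_of_finite_funs) auto
qed

definition monomial :: "('k::finite \<Rightarrow> nat) \<Rightarrow> real ^ 'k \<Rightarrow> real" where
  "monomial \<alpha> x = (\<Prod>i\<in>UNIV. (x $ i) ^ \<alpha> i)"

lemma monomial_0 [simp]: "monomial (\<lambda>_. 0) x = 1"
  by (simp add: monomial_def)

lemma continuous_on_monomial: "continuous_on A (monomial \<alpha>)"
  unfolding monomial_def[abs_def] by (intro continuous_intros)

lemma polys_iff: "f \<in> polys m \<longleftrightarrow>
    (\<exists>c. f = (\<lambda>x. \<Sum>\<alpha> | (\<Sum>i\<in>UNIV. \<alpha> i) \<le> m. c \<alpha> * monomial \<alpha> x))"
  by (auto simp: polys_def monomial_def fun_eq_iff)

lemma polys_continuous_on: "f \<in> polys m \<Longrightarrow> continuous_on A f"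
  unfolding polys_iff by (auto intro!: continuous_intros continuous_on_monomial)

lemma polys_linear: "f \<in> polys m \<Longrightarrow> g \<in> polys m \<Longrightarrow> (\<lambda>x. f x + c * g x) \<in> polys m"
  unfolding polys_iff
proof (elim exE)
  fix a b
  assume "f = (\<lambda>x. \<Sum>\<alpha> | (\<Sum>i\<in>UNIV. \<alpha> i) \<le> m. a \<alpha> * monomial \<alpha> x)"
    "g = (\<lambda>x. \<Sum>\<alpha> | (\<Sum>i\<in>UNIV. \<alpha> i) \<le> m. b \<alpha> * monomial \<alpha> x)"
  then show "\<exists>c'. (\<lambda>x. f x + c * g x) = (\<lambda>x. \<Sum>\<alpha> | (\<Sum>i\<in>UNIV. \<alpha> i) \<le> m. c' \<alpha> * monomial \<alpha> x)"
    by (intro exI[of _ "\<lambda>\<alpha>. a \<alpha> + c * b \<alpha>"])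
       (simp add: distrib_right sum.distrib sum_distrib_left mult.assoc)
qed

lemma monomial_in_polys:
  assumes "(\<Sum>i\<in>UNIV. \<alpha> i) \<le> m" shows "monomial \<alpha> \<in> polys m"
  unfolding polys_iff
proof (intro exI ext)
  fix x
  let ?A = "{\<alpha>. (\<Sum>i\<in>UNIV. \<alpha> i) \<le> m}"
  have "(\<Sum>\<beta>\<in>?A. (if \<beta> = \<alpha> then 1 else 0) * monomial \<beta> x) = (\<Sum>\<beta>\<in>?A. if \<beta> = \<alpha> then monomial \<beta> x else 0)"
    by (intro sum.cong) auto
  also have "\<dots> = monomial \<alpha> x"
    using assms by (simp only: sum.delta[OF finite_multi_indices] mem_Collect_eq if_True)
  finally show "monomial \<alpha> x = (\<Sum>\<beta>\<in>?A. (if \<beta> = \<alpha> then 1 else 0) * monomial \<beta> x)" by simp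
qed

lemma const_in_polys: "(\<lambda>x. c) \<in> polys m"
proof -
  have 1: "monomial (\<lambda>_. 0) \<in> polys m" by (rule monomial_in_polys) simp
  show ?thesis using polys_linear[OF 1 1, of "c - 1"] by (simp add: algebra_simps)
qed

lemma polys_integrable: "f \<in> polys m \<Longrightarrow> integrable sphere_measure f"
  by (intro integrable_sphere_continuous polys_continuous_on)

lemma mean_zero_polys_linear:
  "f \<in> mean_zero_polys m \<Longrightarrow> g \<in> mean_zero_polys m \<Longrightarrow> (\<lambda>x. f x + c * g x) \<in> mean_zero_polys m"
  by (auto simp: mean_zero_polys_def polys_linear polys_integrable)

lemma measure_sphere_pos: "measure sphere_measure (sphere (0::'a::euclidean_space) 1) > 0"
proof (rule ccontr)
  assume "\<not> ?thesis"
  then have "measure sphere_measure (sphere (0::'a) 1) = 0" using measure_nonneg[of sphere_measure "sphere (0::'a) 1"] by linarith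
  then have "emeasure sphere_measure (space (sphere_measure :: 'a measure)) = 0"
    by (simp add: sphere.emeasure_eq_measure)
  then have ae: "AE x in (sphere_measure :: 'a measure). (1::real) = 0"
    by (rule emeasure_0_AE)
  obtain b :: 'a where "b \<in> Basis" using nonempty_Basis by blast
  then have "b \<in> sphere 0 1" by simp
  from sphere_continuous_AE_zero_imp_zero[OF _ ae this] show False by simp
qed

lemma mean_zero_polys_orthonormal_basis:
  "\<exists>E. finite E \<and> E \<subseteq> mean_zero_polys m \<and>
    (\<forall>e\<in>E. \<forall>e'\<in>E. (\<integral>x. e x * e' x \<partial>sphere_measure) = (if e = e' then 1 else 0)) \<and>
    (\<forall>f\<in>mean_zero_polys m. \<exists>c. \<forall>x\<in>sphere (0 :: real ^ 'k) 1. f x = (\<Sum>e\<in>E. c e * e x))"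
proof -
  let ?A = "{\<alpha> :: 'k \<Rightarrow> nat. (\<Sum>i\<in>UNIV. \<alpha> i) \<le> m}"
  define vol where "vol = measure sphere_measure (sphere (0 :: real ^ 'k) 1)"
  have vol: "vol > 0" unfolding vol_def by (rule measure_sphere_pos)
  define mean where "mean f = (\<integral>x. f x \<partial>sphere_measure) / vol" for f :: "real ^ 'k \<Rightarrow> real"
  define b where "b \<alpha> x = monomial \<alpha> x - mean (monomial \<alpha>)" for \<alpha> and x :: "real ^ 'k"
  have bm: "b \<alpha> \<in> mean_zero_polys m" if "\<alpha> \<in> ?A" for \<alpha>
  proof -
    have mon: "monomial \<alpha> \<in> polys m" using that by (intro monomial_in_polys) simp
    have "b \<alpha> \<in> polys m"
      using polys_linear[OF mon const_in_polys[of "mean (monomial \<alpha>)"], of "-1"] by (simp add: b_def[abs_def])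
    moreover have "(\<integral>x. b \<alpha> x \<partial>sphere_measure) = 0"
      using polys_integrable[OF mon] vol by (simp add: b_def mean_def vol_def)
    ultimately show ?thesis by (simp add: mean_zero_polys_def)
  qed
  have cont: "continuous_on UNIV f" if "f \<in> mean_zero_polys m" for f :: "real ^ 'k \<Rightarrow> real"
    using that by (auto simp: mean_zero_polys_def intro: polys_continuous_on)
  have "finite (b ` ?A)" "b ` ?A \<subseteq> mean_zero_polys m"
    using bm finite_multi_indices by auto
  from orthonormal_family_exists[OF this cont mean_zero_polys_linear]
  obtain E where E: "finite E" "E \<subseteq> mean_zero_polys m"
    "\<forall>e\<in>E. \<forall>e'\<in>E. (\<integral>x. e x * e' x \<partial>sphere_measure) = (if e = e' then 1 else 0)"
    "\<forall>b\<in>b ` ?A. \<forall>x\<in>sphere 0 1. b x = (\<Sum>e\<in>E. (\<integral>x. b x * e x \<partial>sphere_measure) * e x)"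
    by blast
  have "\<exists>c. \<forall>x\<in>sphere 0 1. f x = (\<Sum>e\<in>E. c e * e x)" if f: "f \<in> mean_zero_polys m" for f
  proof -
    obtain a where a: "f = (\<lambda>x. \<Sum>\<alpha>\<in>?A. a \<alpha> * monomial \<alpha> x)"
      using f by (auto simp: mean_zero_polys_def polys_iff)
    have "0 = (\<integral>x. f x \<partial>sphere_measure) / vol" using f by (simp add: mean_zero_polys_def)
    also have "\<dots> = (\<Sum>\<alpha>\<in>?A. a \<alpha> * mean (monomial \<alpha>))"
    proof -
      have "integrable sphere_measure (\<lambda>x. a \<alpha> * monomial \<alpha> x)" for \<alpha> :: "'k \<Rightarrow> nat"
        by (intro integrable_sphere_continuous continuous_intros continuous_on_monomial)
      then have "(\<integral>x. f x \<partial>sphere_measure) = (\<Sum>\<alpha>\<in>?A. a \<alpha> * (\<integral>x. monomial \<alpha> x \<partial>sphere_measure))"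
        unfolding a by (subst Bochner_Integration.integral_sum) auto
      then show ?thesis by (simp add: mean_def sum_divide_distrib)
    qed
    finally have z: "(\<Sum>\<alpha>\<in>?A. a \<alpha> * mean (monomial \<alpha>)) = 0" by simp
    have "f x = (\<Sum>e\<in>E. (\<Sum>\<alpha>\<in>?A. a \<alpha> * (\<integral>x. b \<alpha> x * e x \<partial>sphere_measure)) * e x)" if x: "x \<in> sphere 0 1" for x
    proof -
      have "f x = (\<Sum>\<alpha>\<in>?A. a \<alpha> * b \<alpha> x)"
        using z by (simp add: a b_def right_diff_distrib sum_subtractf)
      also have "\<dots> = (\<Sum>\<alpha>\<in>?A. a \<alpha> * (\<Sum>e\<in>E. (\<integral>x. b \<alpha> x * e x \<partial>sphere_measure) * e x))"
      proof (rule sum.cong[OF refl])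
        fix \<alpha> assume "\<alpha> \<in> ?A"
        then have "b \<alpha> x = (\<Sum>e\<in>E. (\<integral>x. b \<alpha> x * e x \<partial>sphere_measure) * e x)" using E(4) x by blast
        then show "a \<alpha> * b \<alpha> x = a \<alpha> * (\<Sum>e\<in>E. (\<integral>x. b \<alpha> x * e x \<partial>sphere_measure) * e x)" by simp
      qed
      also have "\<dots> = (\<Sum>e\<in>E. (\<Sum>\<alpha>\<in>?A. a \<alpha> * (\<integral>x. b \<alpha> x * e x \<partial>sphere_measure)) * e x)"
        unfolding sum_distrib_left sum_distrib_right by (subst sum.swap) (simp add: mult.assoc)
      finally show ?thesis .
    qed
    then show ?thesis
      by (intro exI[of _ "\<lambda>e. \<Sum>\<alpha>\<in>?A. a \<alpha> * (\<integral>x. b \<alpha> x * e x \<partial>sphere_measure)"] ballI)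
  qed
  then show ?thesis by (intro exI[of _ E] conjI ballI E(1,2) E(3)[rule_format])
qed

section \<open>Partitions of unity and finitely supported measures\<close>

text \<open>The usual way to turn cut-off functions \<open>\<phi> y\<close> into a partition of unity: the
  function of an entry is its cut-off function times the product of \<open>1 - \<phi> y\<close>
  over the entries \<open>y\<close> before it.\<close>

fun partition_fun :: "('a \<Rightarrow> 'b \<Rightarrow> real) \<Rightarrow> 'a list \<Rightarrow> 'a \<Rightarrow> 'b \<Rightarrow> real" where
  "partition_fun \<phi> [] z x = 0"
| "partition_fun \<phi> (y # ys) z x = (if z = y then \<phi> y x else (1 - \<phi> y x) * partition_fun \<phi> ys z x)"

lemma sum_partition_fun: "distinct ys \<Longrightarrow> (\<Sum>z\<in>set ys. partition_fun \<phi> ys z x) = 1 - (\<Prod>y\<in>set ys. 1 - \<phi> y x)"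
proof (induction ys)
  case (Cons y ys)
  have "(\<Sum>z\<in>set ys. partition_fun \<phi> (y # ys) z x) = (\<Sum>z\<in>set ys. (1 - \<phi> y x) * partition_fun \<phi> ys z x)"
    using Cons.prems by (intro sum.cong) auto
  then have "(\<Sum>z\<in>set (y # ys). partition_fun \<phi> (y # ys) z x) = \<phi> y x + (1 - \<phi> y x) * (1 - (\<Prod>y\<in>set ys. 1 - \<phi> y x))"
    using Cons by (simp add: sum_distrib_left[symmetric])
  then show ?case using Cons.prems by (simp add: algebra_simps)
qed simp

lemma partition_fun_bounds:
  assumes "\<And>y. 0 \<le> \<phi> y x \<and> \<phi> y x \<le> 1"
  shows "0 \<le> partition_fun \<phi> ys z x \<and> partition_fun \<phi> ys z x \<le> 1"
proof (induction ys)
  case (Cons y ys)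
  have "0 \<le> 1 - \<phi> y x" "1 - \<phi> y x \<le> 1" using assms[of y] by auto
  then show ?case using Cons assms[of y] by (auto intro: mult_le_one)
qed simp

lemma partition_fun_eq_0: "\<phi> z x = 0 \<Longrightarrow> partition_fun \<phi> ys z x = 0"
  by (induction ys) auto

lemma partition_fun_01: "(\<And>y. y \<in> set ys \<Longrightarrow> \<phi> y x = 0 \<or> \<phi> y x = 1) \<Longrightarrow> partition_fun \<phi> ys z x = 0 \<or> partition_fun \<phi> ys z x = 1"
proof (induction ys)
  case (Cons y ys)
  have "\<phi> y x = 0 \<or> \<phi> y x = 1" using Cons.prems[of y] by simp
  moreover have "partition_fun \<phi> ys z x = 0 \<or> partition_fun \<phi> ys z x = 1" using Cons by simp
  ultimately show ?case by auto
qed simp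

lemma smooth_partition_fun:
  fixes \<phi> :: "'a \<Rightarrow> 'b::real_normed_vector \<Rightarrow> real"
  assumes "\<And>y. smooth (\<phi> y)"
  shows "smooth (partition_fun \<phi> ys z)"
proof (induction ys)
  case Nil
  show ?case by simp
next
  case (Cons y ys)
  show ?case
  proof (cases "z = y")
    case False
    have "smooth (\<lambda>x. (1 - \<phi> y x) * partition_fun \<phi> ys z x)"
      by (intro smooth_mult smooth_diff smooth_const assms Cons)
    then show ?thesis using False by simp
  qed (simp add: assms)
qed

text \<open>Equal to \<open>1\<close> where the squared distance to \<open>y\<close> is at most
  \<open>a\<close>, and to \<open>0\<close> where it is at least \<open>b\<close>.\<close>

definition cutoff :: "real \<Rightarrow> real \<Rightarrow> 'a::euclidean_space \<Rightarrow> 'a \<Rightarrow> real" where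
  "cutoff a b y x = smooth_step (((x - y) \<bullet> (x - y) - a) * inverse (b - a))"

lemma smooth_cutoff: "smooth (cutoff a b y)"
  unfolding cutoff_def[abs_def]
  by (intro smooth_compose_real[OF smooth_smooth_step] smooth_mult smooth_diff smooth_inner smooth_ident smooth_const)

lemma cutoff_bounds: "0 \<le> cutoff a b y x \<and> cutoff a b y x \<le> 1"
  by (simp add: cutoff_def smooth_step_nonneg smooth_step_le_1)

lemma cutoff_eq_1: "a < b \<Longrightarrow> (norm (x - y))\<^sup>2 \<le> a \<Longrightarrow> cutoff a b y x = 1"
  unfolding cutoff_def by (intro smooth_step_eq_1) (simp add: power2_norm_eq_inner mult_le_0_iff)

lemma cutoff_eq_0: "a < b \<Longrightarrow> b \<le> (norm (x - y))\<^sup>2 \<Longrightarrow> cutoff a b y x = 0"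
  unfolding cutoff_def by (intro smooth_step_eq_0) (simp add: power2_norm_eq_inner divide_inverse[symmetric])

lemma sphere_finite_cover:
  assumes "\<delta> > 0"
  obtains zs where "distinct zs" "set zs \<subseteq> sphere (0::'a::euclidean_space) 1"
    "\<And>x. x \<in> sphere 0 1 \<Longrightarrow> \<exists>z\<in>set zs. norm (x - z) < \<delta>"
proof -
  have "sphere (0::'a) 1 \<subseteq> (\<Union>z\<in>sphere 0 1. ball z \<delta>)" using assms by auto
  then obtain Z where Z: "Z \<subseteq> sphere (0::'a) 1" "finite Z" "sphere 0 1 \<subseteq> (\<Union>z\<in>Z. ball z \<delta>)"
    by (rule compactE_image[OF compact_sphere open_ball])
  obtain zs where zs: "set zs = Z" "distinct zs" using finite_distinct_list[OF Z(2)] by blast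
  show thesis
  proof (rule that[of zs])
    show "\<exists>z\<in>set zs. norm (x - z) < \<delta>" if "x \<in> sphere 0 1" for x
      using that Z(3) zs by (force simp: dist_norm norm_minus_commute)
  qed (use Z zs in auto)
qed

lemma sum_partition_fun_sphere:
  assumes "distinct zs" "\<And>x. x \<in> sphere 0 1 \<Longrightarrow> \<exists>z\<in>set zs. norm (x - z) < \<delta>"
    and "\<delta>\<^sup>2 \<le> a" "a < b" and x: "x \<in> sphere (0::'a::euclidean_space) 1"
  shows "(\<Sum>z\<in>set zs. partition_fun (cutoff a b) zs z x) = 1"
proof -
  obtain z where z: "z \<in> set zs" "norm (x - z) < \<delta>" using assms(2)[OF x] by blast
  then have "(norm (x - z))\<^sup>2 \<le> \<delta>\<^sup>2" by (intro power_mono) auto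
  then have "cutoff a b z x = 1" using assms(3,4) by (intro cutoff_eq_1) auto
  then have "(\<Prod>y\<in>set zs. 1 - cutoff a b y x) = 0" using z(1) by (intro prod_zero) auto
  with sum_partition_fun[OF assms(1), of "cutoff a b" x] show ?thesis by linarith
qed

lemma equi_uniformly_continuous:
  fixes E :: "('a::euclidean_space \<Rightarrow> real) set"
  assumes "finite E" "\<And>e. e \<in> E \<Longrightarrow> continuous_on UNIV e" "\<kappa> > 0"
  shows "\<exists>\<delta>>0. \<forall>e\<in>E. \<forall>x\<in>sphere 0 1. \<forall>y\<in>sphere 0 1. norm (x - y) < \<delta> \<longrightarrow> \<bar>e x - e y\<bar> < \<kappa>"
  using assms(1,2)
proof (induction E rule: finite_induct)
  case empty
  then show ?case by (intro exI[of _ 1]) simp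
next
  case (insert e E)
  have "uniformly_continuous_on (sphere 0 1) e"
  proof (rule compact_uniformly_continuous[OF _ compact_sphere])
    show "continuous_on (sphere 0 1) e"
      by (rule continuous_on_subset[OF insert.prems]) auto
  qed
  then obtain d1 where d1: "d1 > 0"
    "\<And>x y. y \<in> sphere 0 1 \<Longrightarrow> x \<in> sphere 0 1 \<Longrightarrow> dist x y < d1 \<Longrightarrow> dist (e x) (e y) < \<kappa>"
    by (rule uniformly_continuous_onE[OF _ assms(3)]) blast
  have "continuous_on UNIV e'" if "e' \<in> E" for e' using insert.prems that by simp
  note IH = insert.IH[OF this]
  obtain d2 where d2: "d2 > 0" "\<forall>e\<in>E. \<forall>x\<in>sphere 0 1. \<forall>y\<in>sphere 0 1. norm (x - y) < d2 \<longrightarrow> \<bar>e x - e y\<bar> < \<kappa>"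
    using IH by blast
  show ?case
    by (rule exI[of _ "min d1 d2"]) (use d1 d2 in \<open>auto simp: dist_norm\<close>)
qed

text \<open>The coordinates are made exact one after the other. To hit \<open>v\<close> exactly in a
  further coordinate, take elements whose earlier coordinates are exact and which approximate
  \<open>v\<close> shifted slightly up and down in the new coordinate; a convex combination of
  the two is exact there and stays close elsewhere.\<close>

lemma convex_dense_in_cube_contains_cube:
  fixes K :: "('e \<Rightarrow> real) set"
  assumes fin: "finite E"
    and conv: "\<And>k1 k2 t. k1 \<in> K \<Longrightarrow> k2 \<in> K \<Longrightarrow> 0 \<le> t \<Longrightarrow> t \<le> 1 \<Longrightarrow> (\<lambda>e. (1 - t) * k1 e + t * k2 e) \<in> K"
    and dense: "\<And>v \<kappa>. (\<And>e. e \<in> E \<Longrightarrow> \<bar>v e\<bar> < r) \<Longrightarrow> \<kappa> > 0 \<Longrightarrow> \<exists>k\<in>K. \<forall>e\<in>E. \<bar>k e - v e\<bar> < \<kappa>"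
    and v: "\<And>e. e \<in> E \<Longrightarrow> \<bar>v e\<bar> < r"
  shows "\<exists>k\<in>K. \<forall>e\<in>E. k e = v e"
proof -
  have main: "\<exists>k\<in>K. (\<forall>e\<in>J. k e = v e) \<and> (\<forall>e\<in>E. \<bar>k e - v e\<bar> < \<kappa>)"
    if "finite J" "J \<subseteq> E" "\<And>e. e \<in> E \<Longrightarrow> \<bar>v e\<bar> < r" "\<kappa> > 0" for J v \<kappa>
    using that
  proof (induction J arbitrary: v \<kappa> rule: finite_induct)
    case empty
    then show ?case using dense by simp
  next
    case (insert j J)
    have jE: "j \<in> E" using insert.prems by auto
    \<comment> \<open>Shifting by 2 q keeps the targets in the cube, and an error below q keeps them on either
        side of v j.\<close>
    define q where "q = min (\<kappa> / 4) ((r - \<bar>v j\<bar>) / 4)"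
    have q: "q > 0" "4 * q \<le> \<kappa>" "4 * q \<le> r - \<bar>v j\<bar>"
      using insert.prems(2)[OF jE] insert.prems(3) by (auto simp: q_def min_def)
    define v1 where "v1 = v(j := v j - 2 * q)"
    define v2 where "v2 = v(j := v j + 2 * q)"
    have "\<bar>v1 e\<bar> < r" "\<bar>v2 e\<bar> < r" if "e \<in> E" for e
      using insert.prems(2)[OF that] q by (auto simp: v1_def v2_def)
    then obtain k1 k2 where k1: "k1 \<in> K" "\<And>e. e \<in> J \<Longrightarrow> k1 e = v1 e" "\<And>e. e \<in> E \<Longrightarrow> \<bar>k1 e - v1 e\<bar> < q"
      and k2: "k2 \<in> K" "\<And>e. e \<in> J \<Longrightarrow> k2 e = v2 e" "\<And>e. e \<in> E \<Longrightarrow> \<bar>k2 e - v2 e\<bar> < q"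
      using insert.IH[of v1 q] insert.IH[of v2 q] insert.prems(1) q(1) by (metis insert_subset)
    have a: "k1 j < v j - q" "k2 j > v j + q"
      using k1(3)[OF jE] k2(3)[OF jE] by (auto simp: v1_def v2_def)
    define t where "t = (v j - k1 j) / (k2 j - k1 j)"
    have t: "0 \<le> t" "t \<le> 1" using a q(1) by (auto simp: t_def divide_simps)
    define k where "k e = (1 - t) * k1 e + t * k2 e" for e
    have kK: "k \<in> K" unfolding k_def by (rule conv[OF k1(1) k2(1) t])
    have kj: "k j = v j"
    proof -
      have "k j = k1 j + t * (k2 j - k1 j)" by (simp add: k_def algebra_simps)
      then show ?thesis using a q(1) by (simp add: t_def)
    qed
    have vJ: "v1 e = v e" "v2 e = v e" if "e \<noteq> j" for e using that by (auto simp: v1_def v2_def)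
    have kJ: "k e = v e" if "e \<in> J" for e
    proof -
      have "e \<noteq> j" using that insert.hyps by auto
      then show ?thesis using that k1(2) k2(2) vJ by (simp add: k_def algebra_simps)
    qed
    have kE: "\<bar>k e - v e\<bar> < \<kappa>" if e: "e \<in> E" for e
    proof (cases "e = j")
      case True
      then show ?thesis using kj insert.prems(3) by simp
    next
      case False
      have "k e - v e = (1 - t) * (k1 e - v e) + t * (k2 e - v e)" by (simp add: k_def algebra_simps)
      also have "\<bar>\<dots>\<bar> \<le> (1 - t) * \<bar>k1 e - v e\<bar> + t * \<bar>k2 e - v e\<bar>"
        using t by (intro order_trans[OF abs_triangle_ineq]) (simp add: abs_mult)
      also have "\<dots> \<le> (1 - t) * q + t * q"
        using k1(3)[OF e] k2(3)[OF e] vJ[OF False] t by (intro add_mono mult_left_mono) auto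
      also have "\<dots> = q" by (simp add: algebra_simps)
      finally show ?thesis using q by linarith
    qed
    show ?case using kK kj kJ kE by (intro bexI[of _ k]) auto
  qed
  have "\<exists>k\<in>K. (\<forall>e\<in>E. k e = v e) \<and> (\<forall>e\<in>E. \<bar>k e - v e\<bar> < 1)"
    by (rule main[OF fin subset_refl _ zero_less_one]) (rule v)
  then show ?thesis by blast
qed

text \<open>The finitely supported probability measures on the sphere, as mass functions.\<close>

definition weights :: "('a::euclidean_space \<Rightarrow> real) set" where
  "weights = {w. finite {x. w x \<noteq> 0} \<and> {x. w x \<noteq> 0} \<subseteq> sphere 0 1 \<and> (\<forall>x. 0 \<le> w x) \<and> (\<Sum>x | w x \<noteq> 0. w x) = 1}"

definition moment :: "('a \<Rightarrow> real) \<Rightarrow> ('a \<Rightarrow> real) \<Rightarrow> real" where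
  "moment w f = (\<Sum>x | w x \<noteq> 0. w x * f x)"

lemma moment_eq: "finite A \<Longrightarrow> {x. w x \<noteq> 0} \<subseteq> A \<Longrightarrow> moment w f = (\<Sum>x\<in>A. w x * f x)"
  unfolding moment_def by (rule sum.mono_neutral_left) auto

lemma weightsI:
  assumes "finite A" "A \<subseteq> sphere 0 1" "\<And>x. x \<notin> A \<Longrightarrow> w x = 0" "\<And>x. 0 \<le> w x" "(\<Sum>x\<in>A. w x) = 1"
  shows "w \<in> weights"
proof -
  have sub: "{x. w x \<noteq> 0} \<subseteq> A" using assms(3) by auto
  then have "(\<Sum>x | w x \<noteq> 0. w x) = (\<Sum>x\<in>A. w x)"
    by (intro sum.mono_neutral_left assms(1)) auto
  then show ?thesis using assms sub finite_subset[OF sub assms(1)] by (auto simp: weights_def)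
qed

lemma weightsD:
  assumes "w \<in> weights"
  shows "finite {x. w x \<noteq> 0}" "{x. w x \<noteq> 0} \<subseteq> sphere 0 1" "\<And>x. 0 \<le> w x" "moment w (\<lambda>_. 1) = 1"
  using assms by (auto simp: weights_def moment_def)

lemma weights_le_1: "w \<in> weights \<Longrightarrow> w x \<le> 1"
proof -
  assume w: "w \<in> weights"
  show "w x \<le> 1"
  proof (cases "w x = 0")
    case False
    then have "w x \<le> (\<Sum>x | w x \<noteq> 0. w x)"
      using weightsD[OF w] by (intro member_le_sum) auto
    then show ?thesis using weightsD(4)[OF w] by (simp add: moment_def)
  qed simp
qed

lemma weights_convex:
  assumes "w1 \<in> weights" "w2 \<in> weights" "0 \<le> t" "t \<le> 1"
  shows "(\<lambda>x. (1 - t) * w1 x + t * w2 x) \<in> weights"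
    and "moment (\<lambda>x. (1 - t) * w1 x + t * w2 x) f = (1 - t) * moment w1 f + t * moment w2 f"
proof -
  let ?A = "{x. w1 x \<noteq> 0} \<union> {x. w2 x \<noteq> 0}"
  have A: "finite ?A" "?A \<subseteq> sphere 0 1" using weightsD assms(1,2) by auto
  have m: "moment (\<lambda>x. (1 - t) * w1 x + t * w2 x) f = (1 - t) * moment w1 f + t * moment w2 f" for f
  proof -
    have "moment (\<lambda>x. (1 - t) * w1 x + t * w2 x) f = (\<Sum>x\<in>?A. ((1 - t) * w1 x + t * w2 x) * f x)"
      by (rule moment_eq[OF A(1)]) auto
    also have "\<dots> = (1 - t) * (\<Sum>x\<in>?A. w1 x * f x) + t * (\<Sum>x\<in>?A. w2 x * f x)"
      by (simp add: distrib_right sum.distrib sum_distrib_left mult.assoc)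
    also have "(\<Sum>x\<in>?A. w1 x * f x) = moment w1 f" by (rule moment_eq[OF A(1), symmetric]) auto
    also have "(\<Sum>x\<in>?A. w2 x * f x) = moment w2 f" by (rule moment_eq[OF A(1), symmetric]) auto
    finally show ?thesis .
  qed
  then show "moment (\<lambda>x. (1 - t) * w1 x + t * w2 x) f = (1 - t) * moment w1 f + t * moment w2 f" .
  show "(\<lambda>x. (1 - t) * w1 x + t * w2 x) \<in> weights"
  proof (rule weightsI[OF A])
    have "(\<Sum>x\<in>?A. ((1 - t) * w1 x + t * w2 x)) = moment (\<lambda>x. (1 - t) * w1 x + t * w2 x) (\<lambda>_. 1)"
      by (subst moment_eq[OF A(1)]) auto
    then show "(\<Sum>x\<in>?A. ((1 - t) * w1 x + t * w2 x)) = 1"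
      using m[of "\<lambda>_. 1"] weightsD(4)[OF assms(1)] weightsD(4)[OF assms(2)] by simp
  qed (use weightsD(3)[OF assms(1)] weightsD(3)[OF assms(2)] assms(3,4) in auto)
qed

text \<open>Each cell of a fine partition of unity contributes an atom at its centre that carries the mass
  of the cell.\<close>

lemma density_approx_by_weights:
  fixes E :: "('a::euclidean_space \<Rightarrow> real) set"
  assumes E: "finite E" "\<And>e. e \<in> E \<Longrightarrow> continuous_on UNIV e" and \<kappa>: "\<kappa> > 0"
    and q: "continuous_on UNIV q" "\<And>x. x \<in> sphere 0 1 \<Longrightarrow> 0 \<le> q x" "(\<integral>x. q x \<partial>sphere_measure) = 1"
  shows "\<exists>w\<in>weights. \<forall>e\<in>E. \<bar>moment w e - (\<integral>x. q x * e x \<partial>sphere_measure)\<bar> < \<kappa>"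
proof -
  have k2: "\<kappa> / 2 > 0" using \<kappa> by simp
  from equi_uniformly_continuous[OF E k2]
  obtain \<delta> where \<delta>: "\<delta> > 0" "\<And>e x y. e \<in> E \<Longrightarrow> x \<in> sphere 0 1 \<Longrightarrow> y \<in> sphere 0 1 \<Longrightarrow> norm (x - y) < \<delta> \<Longrightarrow> \<bar>e x - e y\<bar> < \<kappa> / 2"
    by blast
  obtain zs where zs: "distinct zs" "set zs \<subseteq> sphere (0::'a) 1" "\<And>x. x \<in> sphere 0 1 \<Longrightarrow> \<exists>z\<in>set zs. norm (x - z) < \<delta> / 2"
    using sphere_finite_cover[of "\<delta> / 2"] \<delta>(1) by (metis half_gt_zero)
  define a where "a = (\<delta> / 2)\<^sup>2"
  define b where "b = \<delta>\<^sup>2"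
  have ab: "a < b" using \<delta>(1) by (simp add: a_def b_def power2_eq_square)
  define \<eta> where "\<eta> = partition_fun (cutoff a b) zs"
  have \<eta>c: "continuous_on UNIV (\<eta> z)" for z
    unfolding \<eta>_def by (intro smooth_continuous_on smooth_partition_fun smooth_cutoff)
  have \<eta>b: "0 \<le> \<eta> z x" for z x
    unfolding \<eta>_def using partition_fun_bounds[of "cutoff a b", OF cutoff_bounds] by blast
  have \<eta>1: "(\<Sum>z\<in>set zs. \<eta> z x) = 1" if "x \<in> sphere 0 1" for x
    unfolding \<eta>_def by (rule sum_partition_fun_sphere[OF zs(1,3) _ ab that]) (auto simp: a_def)
  have \<eta>0: "\<eta> z x = 0" if "\<delta> \<le> norm (x - z)" for z x
    unfolding \<eta>_def using that \<delta>(1) by (intro partition_fun_eq_0 cutoff_eq_0[OF ab]) (auto simp: b_def intro!: power_mono)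
  have int: "integrable sphere_measure (\<lambda>x. \<eta> z x * q x)" for z
    by (intro integrable_sphere_continuous continuous_on_mult \<eta>c q)
  have inte: "integrable sphere_measure (\<lambda>x. \<eta> z x * q x * e x)" if "e \<in> E" for e z
    by (intro integrable_sphere_continuous continuous_on_mult \<eta>c q E that)
  define w where "w z = (if z \<in> set zs then (\<integral>x. \<eta> z x * q x \<partial>sphere_measure) else 0)" for z
  have "w \<in> weights"
  proof (rule weightsI[of "set zs"])
    show "0 \<le> w z" for z
      unfolding w_def using \<eta>b q(2) by (auto intro!: integral_nonneg_AE AE_I2)
    have "(\<Sum>z\<in>set zs. w z) = (\<integral>x. (\<Sum>z\<in>set zs. \<eta> z x * q x) \<partial>sphere_measure)"
      using int by (simp add: w_def Bochner_Integration.integral_sum)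
    also have "\<dots> = (\<integral>x. q x \<partial>sphere_measure)"
      by (intro Bochner_Integration.integral_cong) (auto simp: sum_distrib_right[symmetric] \<eta>1)
    finally show "(\<Sum>z\<in>set zs. w z) = 1" using q(3) by simp
  qed (use zs in \<open>auto simp: w_def\<close>)
  moreover have "\<bar>moment w e - (\<integral>x. q x * e x \<partial>sphere_measure)\<bar> < \<kappa>" if e: "e \<in> E" for e
  proof -
    have "moment w e = (\<Sum>z\<in>set zs. w z * e z)"
      by (rule moment_eq) (auto simp: w_def)
    also have "\<dots> = (\<Sum>z\<in>set zs. (\<integral>x. \<eta> z x * q x * e z \<partial>sphere_measure))"
      by (simp add: w_def)
    finally have m: "moment w e = (\<Sum>z\<in>set zs. (\<integral>x. \<eta> z x * q x * e z \<partial>sphere_measure))" .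
    have "(\<integral>x. q x * e x \<partial>sphere_measure) = (\<integral>x. (\<Sum>z\<in>set zs. \<eta> z x * q x * e x) \<partial>sphere_measure)"
      by (intro Bochner_Integration.integral_cong) (auto simp: sum_distrib_right[symmetric] \<eta>1)
    also have "\<dots> = (\<Sum>z\<in>set zs. (\<integral>x. \<eta> z x * q x * e x \<partial>sphere_measure))"
      using inte[OF e] by (rule Bochner_Integration.integral_sum)
    finally have "moment w e - (\<integral>x. q x * e x \<partial>sphere_measure) = (\<Sum>z\<in>set zs. (\<integral>x. \<eta> z x * q x * e z - \<eta> z x * q x * e x \<partial>sphere_measure))"
      unfolding m using inte[OF e] int by (simp add: sum_subtractf)
    also have "\<bar>\<dots>\<bar> \<le> (\<Sum>z\<in>set zs. (\<integral>x. \<eta> z x * q x * (\<kappa> / 2) \<partial>sphere_measure))"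
    proof (rule order_trans[OF sum_abs], rule sum_mono)
      fix z assume z: "z \<in> set zs"
      have "\<bar>\<integral>x. \<eta> z x * q x * e z - \<eta> z x * q x * e x \<partial>sphere_measure\<bar> \<le> (\<integral>x. \<bar>\<eta> z x * q x * e z - \<eta> z x * q x * e x\<bar> \<partial>sphere_measure)"
        by (rule integral_abs_bound)
      also have "\<dots> \<le> (\<integral>x. \<eta> z x * q x * (\<kappa> / 2) \<partial>sphere_measure)"
      proof (rule integral_mono)
        show "integrable sphere_measure (\<lambda>x. \<bar>\<eta> z x * q x * e z - \<eta> z x * q x * e x\<bar>)" using int inte[OF e] by auto
        show "integrable sphere_measure (\<lambda>x. \<eta> z x * q x * (\<kappa> / 2))" using int by auto
        fix x :: 'a assume "x \<in> space sphere_measure"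
        then have x: "x \<in> sphere 0 1" by simp
        show "\<bar>\<eta> z x * q x * e z - \<eta> z x * q x * e x\<bar> \<le> \<eta> z x * q x * (\<kappa> / 2)"
        proof (cases "\<delta> \<le> norm (x - z)")
          case False
          then have "\<bar>e x - e z\<bar> < \<kappa> / 2" using \<delta>(2)[OF e x] z zs(2) by auto
          then have "\<bar>e z - e x\<bar> \<le> \<kappa> / 2" by linarith
          then have "\<eta> z x * q x * \<bar>e z - e x\<bar> \<le> \<eta> z x * q x * (\<kappa> / 2)"
            using \<eta>b[of z x] q(2)[OF x] by (intro mult_left_mono mult_nonneg_nonneg)
          then show ?thesis
            using \<eta>b[of z x] q(2)[OF x] by (simp add: right_diff_distrib[symmetric] abs_mult)
        qed (simp add: \<eta>0)
      qed
      finally show "\<bar>\<integral>x. \<eta> z x * q x * e z - \<eta> z x * q x * e x \<partial>sphere_measure\<bar> \<le> (\<integral>x. \<eta> z x * q x * (\<kappa> / 2) \<partial>sphere_measure)" .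
    qed
    also have "\<dots> = (\<Sum>z\<in>set zs. w z) * (\<kappa> / 2)" by (simp add: w_def sum_distrib_right sum_divide_distrib)
    also have "(\<Sum>z\<in>set zs. w z) = 1"
    proof -
      have "{x. w x \<noteq> 0} \<subseteq> set zs" by (auto simp: w_def)
      from moment_eq[OF finite_set this, of "\<lambda>_. 1"] show ?thesis
        using weightsD(4)[OF \<open>w \<in> weights\<close>] by simp
    qed
    finally show ?thesis using \<kappa> by simp
  qed
  ultimately show ?thesis by blast
qed

section \<open>Stability of Theta\<close>

text \<open>Every small vector \<open>v\<close> consists of the moments of the positive density \<open>1 /
  vol + (\<Sum>e. v e \<cdot> e)\<close>, by orthonormality. So the moment vectors of finitely
  supported measures, which form a convex set, are dense in a cube around \<open>0\<close>.\<close>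

lemma weights_with_prescribed_moments:
  fixes E :: "(real ^ 'k \<Rightarrow> real) set"
  assumes E: "finite E" "E \<subseteq> mean_zero_polys m"
    "\<And>e e'. e \<in> E \<Longrightarrow> e' \<in> E \<Longrightarrow> (\<integral>x. e x * e' x \<partial>sphere_measure) = (if e = e' then 1 else 0)"
  obtains r where "r > 0" "\<And>v. (\<And>e. e \<in> E \<Longrightarrow> \<bar>v e\<bar> < r) \<Longrightarrow> \<exists>w\<in>weights. \<forall>e\<in>E. moment w e = v e"
proof -
  define vol where "vol = measure sphere_measure (sphere (0 :: real ^ 'k) 1)"
  have vol: "vol > 0" unfolding vol_def by (rule measure_sphere_pos)
  have cont: "continuous_on UNIV e" if "e \<in> E" for e
    using that E(2) by (auto simp: mean_zero_polys_def intro: polys_continuous_on)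
  have mean0: "(\<integral>x. e x \<partial>sphere_measure) = 0" if "e \<in> E" for e
    using that E(2) by (auto simp: mean_zero_polys_def)
  have "\<exists>M\<ge>0. \<forall>x\<in>sphere 0 1. \<bar>e x\<bar> \<le> M" if "e \<in> E" for e
    using continuous_on_sphere_bounded[OF cont[OF that]] by (metis real_norm_def)
  then obtain M where M: "\<And>e. e \<in> E \<Longrightarrow> 0 \<le> M e" "\<And>e x. e \<in> E \<Longrightarrow> x \<in> sphere 0 1 \<Longrightarrow> \<bar>e x\<bar> \<le> M e"
    by metis
  define S where "S = (\<Sum>e\<in>E. M e) + 1"
  have S: "S > 0" unfolding S_def using sum_nonneg[of E M] M(1) by (simp add: add_nonneg_pos)
  \<comment> \<open>With coefficients below r the perturbation of the constant density 1 / vol is at most 1 /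
      vol.\<close>
  define r where "r = 1 / (vol * S)"
  have r: "r > 0" using vol S by (simp add: r_def)
  let ?K = "(\<lambda>w e. moment w e) ` (weights :: (real ^ 'k \<Rightarrow> real) set)"
  show thesis
  proof (rule that[OF r])
    fix v :: "(real ^ 'k \<Rightarrow> real) \<Rightarrow> real" assume v: "\<And>e. e \<in> E \<Longrightarrow> \<bar>v e\<bar> < r"
    have "\<exists>k\<in>?K. \<forall>e\<in>E. k e = v e"
    proof (rule convex_dense_in_cube_contains_cube[OF E(1) _ _ v])
      show "(\<lambda>e. (1 - t) * k1 e + t * k2 e) \<in> ?K" if k: "k1 \<in> ?K" "k2 \<in> ?K" and t: "0 \<le> t" "t \<le> 1" for k1 k2 t
      proof -
        obtain w1 w2 where w: "w1 \<in> weights" "k1 = moment w1" "w2 \<in> weights" "k2 = moment w2" using k by auto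
        show ?thesis
          unfolding w(2,4) weights_convex(2)[OF w(1,3) t, symmetric]
          by (rule image_eqI[OF _ weights_convex(1)[OF w(1,3) t]]) simp
      qed
    next
      fix v :: "(real ^ 'k \<Rightarrow> real) \<Rightarrow> real" and \<kappa> :: real
      assume v: "\<And>e. e \<in> E \<Longrightarrow> \<bar>v e\<bar> < r" and \<kappa>: "\<kappa> > 0"
      define q where "q x = 1 / vol + (\<Sum>e\<in>E. v e * e x)" for x
      have qc: "continuous_on UNIV q"
        unfolding q_def[abs_def] by (intro continuous_intros cont)
      have q0: "0 \<le> q x" if x: "x \<in> sphere 0 1" for x
      proof -
        have "\<bar>\<Sum>e\<in>E. v e * e x\<bar> \<le> (\<Sum>e\<in>E. r * M e)"
          by (rule order_trans[OF sum_abs], rule sum_mono)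
            (auto simp: abs_mult intro!: mult_mono less_imp_le[OF v] M(2)[OF _ x] less_imp_le[OF r])
        also have "\<dots> \<le> r * S" using r by (simp add: S_def sum_distrib_left distrib_left)
        also have "\<dots> = 1 / vol" using S by (simp add: r_def)
        finally show ?thesis unfolding q_def by linarith
      qed
      have ie: "integrable sphere_measure e" if "e \<in> E" for e
        by (intro integrable_sphere_continuous cont that)
      have iee: "integrable sphere_measure (\<lambda>x. e x * e' x)" if "e \<in> E" "e' \<in> E" for e e'
        by (intro integrable_sphere_continuous continuous_on_mult cont that)
      have q1: "(\<integral>x. q x \<partial>sphere_measure) = 1"
      proof -
        have "(\<integral>x. q x \<partial>sphere_measure) = 1 / vol * vol + (\<Sum>e\<in>E. v e * (\<integral>x. e x \<partial>sphere_measure))"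
          unfolding q_def using ie
          by (subst Bochner_Integration.integral_add) (auto simp: Bochner_Integration.integral_sum vol_def)
        then show ?thesis using vol by (simp add: mean0)
      qed
      have qe: "(\<integral>x. q x * e' x \<partial>sphere_measure) = v e'" if e': "e' \<in> E" for e'
      proof -
        have "(\<integral>x. q x * e' x \<partial>sphere_measure) = (\<integral>x. (1 / vol) * e' x + (\<Sum>e\<in>E. v e * (e x * e' x)) \<partial>sphere_measure)"
          by (intro Bochner_Integration.integral_cong) (simp_all add: q_def distrib_right sum_distrib_right mult.assoc)
        also have "\<dots> = (1 / vol) * (\<integral>x. e' x \<partial>sphere_measure) + (\<Sum>e\<in>E. v e * (\<integral>x. e x * e' x \<partial>sphere_measure))"
          using ie[OF e'] iee[OF _ e']
          by (subst Bochner_Integration.integral_add) (auto simp: Bochner_Integration.integral_sum)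
        also have "(\<Sum>e\<in>E. v e * (\<integral>x. e x * e' x \<partial>sphere_measure)) = (\<Sum>e\<in>E. if e = e' then v e else 0)"
          by (intro sum.cong) (auto simp: E(3)[OF _ e'])
        also have "\<dots> = v e'" using E(1) e' by simp
        finally show ?thesis by (simp add: mean0[OF e'])
      qed
      obtain w where w: "w \<in> weights" "\<And>e. e \<in> E \<Longrightarrow> \<bar>moment w e - (\<integral>x. q x * e x \<partial>sphere_measure)\<bar> < \<kappa>"
        using density_approx_by_weights[OF E(1) cont \<kappa> qc q0 q1] by blast
      show "\<exists>k\<in>?K. \<forall>e\<in>E. \<bar>k e - v e\<bar> < \<kappa>"
      proof (rule bexI[of _ "moment w"])
        show "\<forall>e\<in>E. \<bar>moment w e - v e\<bar> < \<kappa>" using w(2) qe by simp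
      qed (use w(1) in auto)
    qed
    then show "\<exists>w\<in>weights. \<forall>e\<in>E. moment w e = v e" by auto
  qed
qed

lemma Theta_le_weights:
  fixes w :: "real ^ 'k \<Rightarrow> real"
  assumes w: "w \<in> weights" and mom: "\<And>f. f \<in> mean_zero_polys m \<Longrightarrow> moment w f = 0"
  shows "(INF \<nu> \<in> (Mc m :: (real ^ 'k) pmf set). \<Sum>\<^sub>\<infinity>\<xi>\<in>set_pmf \<nu>. ennreal (pmf \<nu> \<xi> powr \<theta>))
    \<le> ennreal (\<Sum>x | w x \<noteq> 0. w x powr \<theta>)"
proof -
  let ?A = "{x. w x \<noteq> 0}"
  note wD = weightsD[OF w]
  define \<nu> where "\<nu> = embed_pmf w"
  have pos: "{x \<in> UNIV. 0 < ennreal (w x)} = ?A"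
    using wD(3) by (auto simp: order_less_le)
  have one: "(\<integral>\<^sup>+x. ennreal (w x) \<partial>count_space UNIV) = 1"
  proof -
    have "(\<integral>\<^sup>+x. ennreal (w x) \<partial>count_space UNIV) = (\<Sum>x | x \<in> UNIV \<and> 0 < ennreal (w x). ennreal (w x))"
      by (rule nn_integral_count_space) (use pos wD(1) in simp)
    also have "\<dots> = ennreal (\<Sum>x\<in>?A. w x)"
      using pos wD(3) by (simp add: sum_ennreal)
    also have "\<dots> = 1" using wD(4) by (simp add: moment_def)
    finally show ?thesis .
  qed
  have pmf: "pmf \<nu> x = w x" for x unfolding \<nu>_def using wD(3) one by (rule pmf_embed_pmf)
  have set: "set_pmf \<nu> = ?A" unfolding \<nu>_def using wD(3) one by (rule set_embed_pmf)
  have "\<nu> \<in> Mc m"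
  proof -
    have "(\<integral>x. f x \<partial>measure_pmf \<nu>) = moment w f" for f
    proof -
      have "(\<integral>x. f x \<partial>measure_pmf \<nu>) = (\<Sum>a\<in>?A. f a * pmf \<nu> a)"
        by (rule integral_measure_pmf_real[OF wD(1)]) (simp add: set)
      then show ?thesis by (simp add: moment_def pmf mult.commute)
    qed
    then show ?thesis using wD(2) mom by (simp add: Mc_def set)
  qed
  then have "(INF \<nu> \<in> (Mc m :: (real ^ 'k) pmf set). \<Sum>\<^sub>\<infinity>\<xi>\<in>set_pmf \<nu>. ennreal (pmf \<nu> \<xi> powr \<theta>))
      \<le> (\<Sum>\<^sub>\<infinity>\<xi>\<in>set_pmf \<nu>. ennreal (pmf \<nu> \<xi> powr \<theta>))"
    by (rule INF_lower)
  also have "\<dots> = (\<Sum>x\<in>?A. ennreal (w x powr \<theta>))"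
    unfolding set pmf using wD(1) by (rule infsum_finite)
  also have "\<dots> = ennreal (\<Sum>x\<in>?A. w x powr \<theta>)" by (rule sum_ennreal) simp
  finally show ?thesis .
qed

text \<open>Masses are at most \<open>1\<close>, so raising them to a power at most \<open>1\<close> does
  not decrease them.\<close>

lemma pmf_power_sum_ge_1:
  assumes \<theta>: "\<theta> \<le> 1"
  shows "1 \<le> (\<Sum>\<^sub>\<infinity>\<xi>\<in>set_pmf \<nu>. ennreal (pmf \<nu> \<xi> powr \<theta>))"
proof -
  have abs: "Infinite_Set_Sum.abs_summable_on (pmf \<nu>) (set_pmf \<nu>)" by (rule pmf_abs_summable)
  then have "infsum (pmf \<nu>) (set_pmf \<nu>) = 1"
    using infsetsum_infsum[OF abs] infsetsum_pmf_eq_1[of \<nu> "set_pmf \<nu>"] by simp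
  moreover have "pmf \<nu> summable_on set_pmf \<nu>"
    using abs abs_summable_equivalent[of "pmf \<nu>" "set_pmf \<nu>"] by (simp add: abs_summable_summable)
  ultimately have "1 = (SUP F\<in>{F. finite F \<and> F \<subseteq> set_pmf \<nu>}. ennreal (sum (pmf \<nu>) F))"
    using infsum_nonneg_is_SUPREMUM_ennreal[of "pmf \<nu>" "set_pmf \<nu>"] by simp
  also have "\<dots> \<le> (SUP F\<in>{F. finite F \<and> F \<subseteq> set_pmf \<nu>}. (\<Sum>\<xi>\<in>F. ennreal (pmf \<nu> \<xi> powr \<theta>)))"
  proof (rule SUP_mono, intro bexI)
    fix F assume F: "F \<in> {F. finite F \<and> F \<subseteq> set_pmf \<nu>}"
    have "ennreal (sum (pmf \<nu>) F) = (\<Sum>\<xi>\<in>F. ennreal (pmf \<nu> \<xi>))" by (rule sum_ennreal[symmetric]) simp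
    also have "\<dots> \<le> (\<Sum>\<xi>\<in>F. ennreal (pmf \<nu> \<xi> powr \<theta>))"
    proof (intro sum_mono ennreal_leI)
      fix \<xi> assume "\<xi> \<in> F"
      then have "pmf \<nu> \<xi> > 0" using F by (auto simp: pmf_positive)
      then show "pmf \<nu> \<xi> \<le> pmf \<nu> \<xi> powr \<theta>"
        using powr_mono'[of \<theta> 1 "pmf \<nu> \<xi>"] \<theta> pmf_le_1[of \<nu> \<xi>] by simp
    qed
    finally show "ennreal (sum (pmf \<nu>) F) \<le> (\<Sum>\<xi>\<in>F. ennreal (pmf \<nu> \<xi> powr \<theta>))" .
  qed
  also have "\<dots> = (\<Sum>\<^sub>\<infinity>\<xi>\<in>set_pmf \<nu>. ennreal (pmf \<nu> \<xi> powr \<theta>))"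
    by (rule nonneg_infsum_complete[symmetric]) simp
  finally show ?thesis .
qed

text \<open>Divide by \<open>(a + b)\<^sup>\<theta>\<close> and use \<open>t \<le>
  t\<^sup>\<theta>\<close> for \<open>t\<close> in the unit interval.\<close>

lemma powr_add_subadditive:
  fixes a b \<theta> :: real
  assumes "0 \<le> a" "0 \<le> b" "0 < \<theta>" "\<theta> \<le> 1"
  shows "(a + b) powr \<theta> \<le> a powr \<theta> + b powr \<theta>"
proof (cases "a + b = 0")
  case False
  then have s: "a + b > 0" using assms by simp
  have le: "x / (a + b) \<le> (x / (a + b)) powr \<theta>" if "0 \<le> x" "x \<le> a + b" for x
  proof (cases "x = 0")
    case False
    then show ?thesis
      using powr_mono'[of \<theta> 1 "x / (a + b)"] that s assms(3,4) by (simp add: divide_le_eq_1)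
  qed simp
  have "1 = a / (a + b) + b / (a + b)" using s by (simp add: add_divide_distrib[symmetric])
  also have "\<dots> \<le> (a / (a + b)) powr \<theta> + (b / (a + b)) powr \<theta>"
    using assms by (intro add_mono le) auto
  also have "\<dots> = (a powr \<theta> + b powr \<theta>) / (a + b) powr \<theta>"
    using assms s by (simp add: powr_divide add_divide_distrib)
  finally show ?thesis using s by (simp add: le_divide_eq)
qed (use assms in auto)

text \<open>Almost admissible weights \<open>w\<close> are repaired by the combination \<open>(1 - t) w +
  (\<Sum>e. c e \<cdot> W e (s e)) + c1 \<cdot> w0\<close>. Here \<open>W e 1\<close> and
  \<open>W e (- 1)\<close> are fixed weights whose only nonzero moment against the orthonormal
  basis is \<open>\<plusminus>\<rho>\<close> at \<open>e\<close>; the sign \<open>s e\<close> is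
  opposite to the moment of \<open>w\<close> and \<open>c e\<close> cancels it. The weights
  \<open>w0\<close>, all of whose moments vanish, supply the missing mass. The added part lives
  on a fixed finite set and has mass at most \<open>2 t\<close>, so it adds little to the sum of
  the powers.\<close>

theorem Theta_stability:
  fixes m :: nat and \<theta> \<tau> :: real
  assumes \<theta>: "0 < \<theta>" "\<theta> \<le> 1" and \<tau>: "\<tau> > 0"
  obtains \<delta> F where "0 < \<delta>" "\<delta> \<le> \<tau>" "finite F" "F \<subseteq> (mean_zero_polys m :: (real ^ 'k \<Rightarrow> real) set)"
    "\<And>Z w. finite Z \<Longrightarrow> Z \<subseteq> sphere 0 1 \<Longrightarrow> (\<And>z. z \<in> Z \<Longrightarrow> 0 \<le> w z) \<Longrightarrow> 1 - \<delta> \<le> (\<Sum>z\<in>Z. w z) \<Longrightarrow> (\<Sum>z\<in>Z. w z) \<le> 1 \<Longrightarrow>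
      (\<And>f. f \<in> F \<Longrightarrow> \<bar>\<Sum>z\<in>Z. w z * f z\<bar> \<le> \<delta>) \<Longrightarrow>
      Theta TYPE('k) m \<theta> \<le> (\<Sum>z\<in>Z. w z powr \<theta>) + \<tau>"
    and "1 \<le> Theta TYPE('k) m \<theta>"
proof -
  obtain E :: "(real ^ 'k \<Rightarrow> real) set" where E: "finite E" "E \<subseteq> mean_zero_polys m"
    and on: "\<forall>e\<in>E. \<forall>e'\<in>E. (\<integral>x. e x * e' x \<partial>sphere_measure) = (if e = e' then 1 else 0)"
    and span: "\<forall>f\<in>mean_zero_polys m. \<exists>c. \<forall>x\<in>sphere 0 1. f x = (\<Sum>e\<in>E. c e * e x)"
    using mean_zero_polys_orthonormal_basis[where 'k='k and m=m] by blast
  obtain r where r: "r > 0" "\<And>v. (\<And>e. e \<in> E \<Longrightarrow> \<bar>v e\<bar> < r) \<Longrightarrow> \<exists>w\<in>weights. \<forall>e\<in>E. moment w e = v e"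
    using weights_with_prescribed_moments[OF E on[rule_format]] by blast
  have moment0: "moment w f = 0" if w: "w \<in> weights" and m0: "\<forall>e\<in>E. moment w e = 0" and f: "f \<in> mean_zero_polys m" for w f
  proof -
    obtain c where c: "\<forall>x\<in>sphere 0 1. f x = (\<Sum>e\<in>E. c e * e x)" using span f by blast
    have "moment w f = (\<Sum>x | w x \<noteq> 0. w x * (\<Sum>e\<in>E. c e * e x))"
      unfolding moment_def using c weightsD(2)[OF w] by (intro sum.cong) auto
    also have "\<dots> = (\<Sum>e\<in>E. c e * moment w e)"
      unfolding moment_def sum_distrib_left by (subst sum.swap) (simp add: mult.left_commute)
    finally show ?thesis using m0 by simp
  qed
  have Theta_le: "Theta TYPE('k) m \<theta> \<le> (\<Sum>x\<in>A. w x powr \<theta>)"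
    if w: "w \<in> weights" and m0: "\<forall>e\<in>E. moment w e = 0" and A: "finite A" "{x. w x \<noteq> 0} \<subseteq> A" for w A
  proof -
    have "Theta TYPE('k) m \<theta> \<le> enn2real (ennreal (\<Sum>x | w x \<noteq> 0. w x powr \<theta>))"
      unfolding Theta_def by (intro enn2real_mono Theta_le_weights[OF w] moment0[OF w m0]) auto
    also have "\<dots> = (\<Sum>x | w x \<noteq> 0. w x powr \<theta>)" by (simp add: sum_nonneg)
    also have "\<dots> = (\<Sum>x\<in>A. w x powr \<theta>)" using A by (intro sum.mono_neutral_left) auto
    finally show ?thesis .
  qed
  obtain w0 where w0: "w0 \<in> weights" "\<forall>e\<in>E. moment w0 e = 0"
    using r(2)[of "\<lambda>_. 0"] r(1) by auto
  have Theta1: "1 \<le> Theta TYPE('k) m \<theta>"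
  proof -
    let ?I = "INF \<nu> \<in> (Mc m :: (real ^ 'k) pmf set). \<Sum>\<^sub>\<infinity>\<xi>\<in>set_pmf \<nu>. ennreal (pmf \<nu> \<xi> powr \<theta>)"
    have "?I \<le> ennreal (\<Sum>x | w0 x \<noteq> 0. w0 x powr \<theta>)"
      by (rule Theta_le_weights[OF w0(1) moment0[OF w0]])
    then have "?I < \<top>" by (rule le_less_trans) simp
    moreover have "1 \<le> ?I" by (intro INF_greatest pmf_power_sum_ge_1 \<theta>)
    ultimately have "enn2real 1 \<le> enn2real ?I" by (intro enn2real_mono)
    then show ?thesis by (simp add: Theta_def)
  qed
  define \<rho> where "\<rho> = r / 2"
  have \<rho>: "\<rho> > 0" "\<rho> < r" using r(1) by (auto simp: \<rho>_def)
  have "\<exists>w\<in>weights. \<forall>e'\<in>E. moment w e' = (if e' = e then s * \<rho> else 0)" if "\<bar>s\<bar> = 1" for e s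
    using that \<rho> r(1) by (intro r(2)) (auto simp: abs_mult)
  then have "\<forall>e s. \<exists>w. \<bar>s\<bar> = 1 \<longrightarrow> w \<in> weights \<and> (\<forall>e'\<in>E. moment w e' = (if e' = e then s * \<rho> else 0))"
    by blast
  then obtain W where W: "\<And>e s. \<bar>s\<bar> = 1 \<Longrightarrow> W e s \<in> weights"
    "\<And>e s e'. \<bar>s\<bar> = 1 \<Longrightarrow> e' \<in> E \<Longrightarrow> moment (W e s) e' = (if e' = e then s * \<rho> else 0)"
    by metis
  define A0 where "A0 = {x. w0 x \<noteq> 0} \<union> (\<Union>e\<in>E. {x. W e 1 x \<noteq> 0} \<union> {x. W e (-1) x \<noteq> 0})"
  have Wsph: "x \<in> sphere 0 1" if "W e s x \<noteq> 0" "\<bar>s\<bar> = 1" for e s x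
    using weightsD(2)[OF W(1)[OF that(2)]] that(1) by blast
  have A0: "finite A0" "A0 \<subseteq> sphere 0 1"
  proof -
    show "finite A0"
      using weightsD(1)[OF w0(1)] weightsD(1)[OF W(1)] E(1) by (simp add: A0_def)
    show "A0 \<subseteq> sphere 0 1"
      using weightsD(2)[OF w0(1)] Wsph[of _ 1] Wsph[of _ "-1"] unfolding A0_def by fastforce
  qed
  have W0: "W e s x = 0" if "x \<notin> A0" "e \<in> E" "s = 1 \<or> s = - 1" for e s x
    using that by (auto simp: A0_def)
  have w00: "w0 x = 0" if "x \<notin> A0" for x using that by (auto simp: A0_def)
  \<comment> \<open>The share t of the correction: card A0 atoms of mass at most 2 t contribute at most
      \<tau>.\<close>
  define t where "t = min (1/2) ((\<tau> / (real (card A0) + 1)) powr (1 / \<theta>) / 2)"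
  have t: "0 < t" "t \<le> 1 / 2" "real (card A0) * (2 * t) powr \<theta> \<le> \<tau>"
  proof -
    have "(\<tau> / (real (card A0) + 1)) powr (1 / \<theta>) > 0" using \<tau> by simp
    then show "0 < t" by (simp add: t_def)
    have "(2 * t) powr \<theta> \<le> ((\<tau> / (real (card A0) + 1)) powr (1 / \<theta>)) powr \<theta>"
      using \<theta> \<open>0 < t\<close> by (intro powr_mono2) (auto simp: t_def)
    also have "\<dots> = \<tau> / (real (card A0) + 1)" using \<theta> \<tau> by (simp add: powr_powr)
    finally have "real (card A0) * (2 * t) powr \<theta> \<le> real (card A0) * (\<tau> / (real (card A0) + 1))"
      by (intro mult_left_mono) auto
    also have "\<dots> \<le> \<tau>" using \<tau> by (simp add: divide_le_eq add_nonneg_pos)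
    finally show "real (card A0) * (2 * t) powr \<theta> \<le> \<tau>" .
  qed (simp add: t_def)
  \<comment> \<open>The moment errors must be small enough to be cancelled with total mass at most t.\<close>
  define \<delta> where "\<delta> = min \<tau> (min t (t * \<rho> / (real (card E) + 1)))"
  have \<delta>: "0 < \<delta>" "\<delta> \<le> \<tau>" "\<delta> \<le> t" "real (card E) * \<delta> / \<rho> \<le> t"
  proof -
    show "0 < \<delta>" using t \<tau> \<rho> by (simp add: \<delta>_def add_nonneg_pos)
    have "\<delta> \<le> t * \<rho> / (real (card E) + 1)" by (simp add: \<delta>_def)
    then have "\<delta> * (real (card E) + 1) \<le> t * \<rho>" by (simp add: pos_le_divide_eq add_nonneg_pos)
    moreover have "real (card E) * \<delta> \<le> \<delta> * (real (card E) + 1)" using \<open>0 < \<delta>\<close> by (simp add: algebra_simps)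
    ultimately show "real (card E) * \<delta> / \<rho> \<le> t" using \<rho> by (simp add: divide_le_eq)
  qed (auto simp: \<delta>_def)
  show thesis
  proof (rule that[OF \<delta>(1,2) E _ Theta1])
    fix Z :: "(real ^ 'k) set" and w :: "real ^ 'k \<Rightarrow> real"
    assume Z: "finite Z" "Z \<subseteq> sphere 0 1" and w: "\<And>z. z \<in> Z \<Longrightarrow> 0 \<le> w z"
      and mass: "1 - \<delta> \<le> (\<Sum>z\<in>Z. w z)" "(\<Sum>z\<in>Z. w z) \<le> 1"
      and mom: "\<And>f. f \<in> E \<Longrightarrow> \<bar>\<Sum>z\<in>Z. w z * f z\<bar> \<le> \<delta>"
    define w' where "w' x = (if x \<in> Z then w x else 0)" for x
    define err where "err e = (\<Sum>z\<in>Z. w z * e z)" for e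
    define s where "s e = (if err e > 0 then - 1 else 1 :: real)" for e
    have s: "\<bar>s e\<bar> = 1" "s e = 1 \<or> s e = - 1" "s e * \<bar>err e\<bar> = - err e" for e
      by (auto simp: s_def)
    define c where "c e = (1 - t) * \<bar>err e\<bar> / \<rho>" for e
    have c0: "c e \<ge> 0" for e using t \<rho> by (simp add: c_def)
    have csum: "(\<Sum>e\<in>E. c e) \<le> t"
    proof -
      have "(\<Sum>e\<in>E. c e) \<le> (\<Sum>e\<in>E. \<delta> / \<rho>)"
      proof (rule sum_mono)
        fix e assume e: "e \<in> E"
        have "(1 - t) * \<bar>err e\<bar> \<le> 1 * \<delta>"
          using t mom[OF e] by (intro mult_mono) (auto simp: err_def)
        then show "c e \<le> \<delta> / \<rho>" using \<rho> by (simp add: c_def divide_right_mono)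
      qed
      also have "\<dots> \<le> t" using \<delta>(4) by simp
      finally show ?thesis .
    qed
    define mass0 where "mass0 = (\<Sum>z\<in>Z. w z)"
    define tot where "tot = 1 - (1 - t) * mass0"
    have tot: "t \<le> tot" "tot \<le> 2 * t"
    proof -
      have "(1 - t) * mass0 \<le> (1 - t) * 1" using t mass by (intro mult_left_mono) (auto simp: mass0_def)
      then show "t \<le> tot" by (simp add: tot_def)
      have "(1 - t) * (1 - \<delta>) \<le> (1 - t) * mass0" using t mass by (intro mult_left_mono) (auto simp: mass0_def)
      moreover have "(1 - t) * (1 - \<delta>) \<ge> 1 - t - \<delta>" using t \<delta>(1) by (simp add: algebra_simps)
      ultimately show "tot \<le> 2 * t" using \<delta>(3) by (simp add: tot_def)
    qed
    define c1 where "c1 = tot - (\<Sum>e\<in>E. c e)"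
    have c1: "c1 \<ge> 0" using tot csum by (simp add: c1_def)
    define rest where "rest x = (\<Sum>e\<in>E. c e * W e (s e) x) + c1 * w0 x" for x
    have rest0: "0 \<le> rest x" for x
      unfolding rest_def using c0 c1 weightsD(3)[OF W(1)[OF s(1)]] weightsD(3)[OF w0(1)]
      by (intro add_nonneg_nonneg sum_nonneg mult_nonneg_nonneg)
    have rest1: "rest x \<le> tot" for x
    proof -
      have "rest x \<le> (\<Sum>e\<in>E. c e * 1) + c1 * 1"
        unfolding rest_def using c0 c1 weights_le_1[OF W(1)[OF s(1)]] weights_le_1[OF w0(1)]
        by (intro add_mono sum_mono mult_left_mono) auto
      then show ?thesis by (simp add: c1_def)
    qed
    have restA: "rest x = 0" if "x \<notin> A0" for x
      using that W0[OF that _ s(2)] w00[OF that] by (simp add: rest_def)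
    define \<pi> where "\<pi> x = (1 - t) * w' x + rest x" for x
    let ?A = "Z \<union> A0"
    have A: "finite ?A" using Z A0 by simp
    have mom\<pi>: "(\<Sum>x\<in>?A. \<pi> x * f x) = (1 - t) * (\<Sum>z\<in>Z. w z * f z) + (\<Sum>e\<in>E. c e * moment (W e (s e)) f) + c1 * moment w0 f" for f
    proof -
      have W': "moment (W e (s e)) f = (\<Sum>x\<in>?A. W e (s e) x * f x)" if "e \<in> E" for e
        using W0[OF _ that s(2)] by (intro moment_eq[OF A]) blast
      have w0': "moment w0 f = (\<Sum>x\<in>?A. w0 x * f x)"
        using w00 by (intro moment_eq[OF A]) blast
      have Z': "(\<Sum>z\<in>Z. w z * f z) = (\<Sum>x\<in>?A. w' x * f x)"
        using A0(1) Z(1) by (intro sum.mono_neutral_cong_left) (auto simp: w'_def)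
      have "(\<Sum>x\<in>?A. (\<Sum>e\<in>E. c e * W e (s e) x) * f x) = (\<Sum>e\<in>E. c e * (\<Sum>x\<in>?A. W e (s e) x * f x))"
        unfolding sum_distrib_left sum_distrib_right by (subst sum.swap) (simp add: mult.assoc)
      moreover have "(\<Sum>e\<in>E. c e * moment (W e (s e)) f) = (\<Sum>e\<in>E. c e * (\<Sum>x\<in>?A. W e (s e) x * f x))"
        using W' by (intro sum.cong) auto
      ultimately show ?thesis
        unfolding w0' Z' by (simp add: \<pi>_def rest_def distrib_right sum.distrib sum_distrib_left mult.assoc)
    qed
    have \<pi>w: "\<pi> \<in> weights"
    proof (rule weightsI[OF A])
      show "0 \<le> \<pi> x" for x using t w rest0 by (auto simp: \<pi>_def w'_def)
      have "(\<Sum>x\<in>?A. \<pi> x) = (1 - t) * mass0 + (\<Sum>e\<in>E. c e) + c1"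
        using mom\<pi>[of "\<lambda>_. 1"] weightsD(4)[OF W(1)[OF s(1)]] weightsD(4)[OF w0(1)] by (simp add: mass0_def)
      then show "(\<Sum>x\<in>?A. \<pi> x) = 1" by (simp add: c1_def tot_def)
    qed (use Z A0 restA in \<open>auto simp: \<pi>_def w'_def\<close>)
    have sub: "{x. \<pi> x \<noteq> 0} \<subseteq> ?A" using restA by (auto simp: \<pi>_def w'_def)
    have \<pi>0: "\<forall>e\<in>E. moment \<pi> e = 0"
    proof
      fix e assume e: "e \<in> E"
      have "moment \<pi> e = (1 - t) * err e + (\<Sum>e'\<in>E. c e' * moment (W e' (s e')) e) + c1 * moment w0 e"
        using moment_eq[OF A sub] mom\<pi> by (simp add: err_def)
      also have "(\<Sum>e'\<in>E. c e' * moment (W e' (s e')) e) = (\<Sum>e'\<in>E. if e' = e then c e * (s e * \<rho>) else 0)"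
        using W(2)[OF s(1) e] by (intro sum.cong) auto
      also have "\<dots> = c e * (s e * \<rho>)" using E(1) e by simp
      also have "\<dots> = (1 - t) * (s e * \<bar>err e\<bar>)" using \<rho> by (simp add: c_def)
      also have "\<dots> = - ((1 - t) * err e)" by (simp add: s(3))
      finally show "moment \<pi> e = 0" using w0(2) e by simp
    qed
    have "Theta TYPE('k) m \<theta> \<le> (\<Sum>x\<in>?A. \<pi> x powr \<theta>)" by (rule Theta_le[OF \<pi>w \<pi>0 A sub])
    also have "\<dots> \<le> (\<Sum>x\<in>?A. w' x powr \<theta> + rest x powr \<theta>)"
    proof (rule sum_mono)
      fix x
      have w'0: "0 \<le> w' x" using w by (simp add: w'_def)
      have "\<pi> x powr \<theta> \<le> ((1 - t) * w' x) powr \<theta> + rest x powr \<theta>"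
        unfolding \<pi>_def using t w'0 rest0 \<theta> by (intro powr_add_subadditive) auto
      also have "((1 - t) * w' x) powr \<theta> \<le> w' x powr \<theta>"
        using t w'0 \<theta> by (intro powr_mono2) (auto intro: mult_left_le_one_le)
      finally show "\<pi> x powr \<theta> \<le> w' x powr \<theta> + rest x powr \<theta>" by simp
    qed
    also have "\<dots> = (\<Sum>z\<in>Z. w z powr \<theta>) + (\<Sum>x\<in>A0. rest x powr \<theta>)"
    proof -
      have "(\<Sum>x\<in>?A. w' x powr \<theta>) = (\<Sum>z\<in>Z. w z powr \<theta>)"
        using A0(1) Z(1) by (intro sum.mono_neutral_cong_right) (auto simp: w'_def)
      moreover have "(\<Sum>x\<in>?A. rest x powr \<theta>) = (\<Sum>x\<in>A0. rest x powr \<theta>)"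
        using A0(1) Z(1) restA by (intro sum.mono_neutral_right) auto
      ultimately show ?thesis by (simp add: sum.distrib)
    qed
    also have "(\<Sum>x\<in>A0. rest x powr \<theta>) \<le> (\<Sum>x\<in>A0. (2 * t) powr \<theta>)"
      using rest0 rest1 tot(2) \<theta> by (intro sum_mono powr_mono2) (auto intro: order_trans)
    also have "\<dots> \<le> \<tau>" using t(3) by simp
    finally show "Theta TYPE('k) m \<theta> \<le> (\<Sum>z\<in>Z. w z powr \<theta>) + \<tau>" by simp
  qed
qed

section \<open>The constrained Sobolev inequality\<close>

text \<open>For each \<open>i\<close> the sets \<open>A k i\<close> are disjoint, so the unions over
  \<open>i\<close> cover no point more than \<open>card I\<close> times; one of the
  \<open>K\<close> unions carries at most the average.\<close>

lemma shells_pigeonhole: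
  fixes M :: "'a measure" and h :: "'a \<Rightarrow> real" and A :: "nat \<Rightarrow> 'i \<Rightarrow> 'a set"
  assumes h: "integrable M h" "\<And>x. 0 \<le> h x" and K: "K > 0" and fin: "finite I"
    and A: "\<And>k i. A k i \<in> sets M"
    and disj: "\<And>i. disjoint_family_on (\<lambda>k. A k i) {..<K}"
  shows "\<exists>k<K. (\<integral>x. indicator (\<Union>i\<in>I. A k i) x * h x \<partial>M) \<le> real (card I) / real K * (\<integral>x. h x \<partial>M)"
proof (rule ccontr)
  assume contra: "\<not> ?thesis"
  have meas: "(\<Union>i\<in>I. A k i) \<in> sets M" for k using A fin by auto
  have int: "integrable M (\<lambda>x. indicator (\<Union>i\<in>I. A k i) x * h x)" for k
    using integrable_mult_indicator[OF meas h(1)] by simp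
  have pt: "(\<Sum>k<K. indicator (\<Union>i\<in>I. A k i) x * h x) \<le> real (card I) * h x" for x
  proof -
    have "(\<Sum>k<K. indicator (\<Union>i\<in>I. A k i) x :: real) \<le> (\<Sum>k<K. \<Sum>i\<in>I. indicator (A k i) x)"
    proof (rule sum_mono)
      fix k
      show "(indicator (\<Union>i\<in>I. A k i) x :: real) \<le> (\<Sum>i\<in>I. indicator (A k i) x)"
      proof (cases "x \<in> (\<Union>i\<in>I. A k i)")
        case True
        then obtain i where i: "i \<in> I" "x \<in> A k i" by auto
        have "(indicator (A k i) x :: real) \<le> (\<Sum>i\<in>I. indicator (A k i) x)"
          using i(1) fin by (intro member_le_sum) auto
        then show ?thesis using True i by simp
      qed (simp add: sum_nonneg)
    qed
    also have "\<dots> = (\<Sum>i\<in>I. \<Sum>k<K. indicator (A k i) x)" by (rule sum.swap)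
    also have "\<dots> \<le> (\<Sum>i\<in>I. 1)"
    proof (rule sum_mono)
      fix i
      have "(\<Sum>k<K. indicator (A k i) x :: real) = indicator (\<Union>k<K. A k i) x"
        by (rule indicator_UN_disjoint[symmetric]) (auto intro: disj)
      then show "(\<Sum>k<K. indicator (A k i) x :: real) \<le> 1" by (simp add: indicator_def)
    qed
    finally have "(\<Sum>k<K. indicator (\<Union>i\<in>I. A k i) x :: real) \<le> real (card I)" by simp
    then show ?thesis using h(2)[of x] by (simp add: sum_distrib_right[symmetric] mult_right_mono)
  qed
  have "real (card I) * (\<integral>x. h x \<partial>M) = (\<Sum>k<K. real (card I) / real K * (\<integral>x. h x \<partial>M))"
    using K by simp
  also have "\<dots> < (\<Sum>k<K. (\<integral>x. indicator (\<Union>i\<in>I. A k i) x * h x \<partial>M))"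
    using contra K by (intro sum_strict_mono) (auto simp: not_le)
  also have "\<dots> = (\<integral>x. (\<Sum>k<K. indicator (\<Union>i\<in>I. A k i) x * h x) \<partial>M)"
    using int by (rule Bochner_Integration.integral_sum[symmetric])
  also have "\<dots> \<le> (\<integral>x. real (card I) * h x \<partial>M)"
  proof (rule integral_mono[OF _ _ pt])
    show "integrable M (\<lambda>x. \<Sum>k<K. indicator (\<Union>i\<in>I. A k i) x * h x)"
      by (rule Bochner_Integration.integrable_sum[OF int])
    show "integrable M (\<lambda>x. real (card I) * h x)" using h(1) by simp
  qed
  finally show False by simp
qed

lemma close_quotient_exists:
  fixes S \<Theta> \<epsilon> :: real
  assumes "0 \<le> S" "1 \<le> \<Theta>" "0 < \<epsilon>"
  obtains \<tau> where "0 < \<tau>" "\<tau> < 1 / 2" "(S + \<tau>) / (\<Theta> - \<tau>) \<le> S / \<Theta> + \<epsilon>"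
proof -
  have "((\<lambda>\<tau>. (S + \<tau>) / (\<Theta> - \<tau>)) \<longlongrightarrow> (S + 0) / (\<Theta> - 0)) (at_right 0)"
    using assms(2) by (intro tendsto_intros) auto
  then have "eventually (\<lambda>\<tau>. (S + \<tau>) / (\<Theta> - \<tau>) < S / \<Theta> + \<epsilon>) (at_right 0)"
    by (rule order_tendstoD) (use assms in simp)
  moreover have "eventually (\<lambda>\<tau>::real. \<tau> < 1 / 2) (at_right 0)"
    by (rule eventually_at_rightI[of 0 "1/2"]) auto
  moreover have "eventually (\<lambda>\<tau>::real. 0 < \<tau>) (at_right 0)" by (rule eventually_at_right_less)
  ultimately have "eventually (\<lambda>\<tau>. 0 < \<tau> \<and> \<tau> < 1 / 2 \<and> (S + \<tau>) / (\<Theta> - \<tau>) \<le> S / \<Theta> + \<epsilon>) (at_right 0)"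
    by eventually_elim auto
  then show thesis
    using eventually_happens[of _ "at_right (0::real)"] trivial_limit_at_right_real that by blast
qed

theorem theorem1p1:
  fixes m :: nat and p \<epsilon> :: real
  assumes "CARD('k::finite) = CARD('n::finite) + 1"
    and "1 < p" and "p < real CARD('n)"
    and "\<epsilon> > 0"
  shows "\<exists>c::real. \<forall>u \<in> (sphere_W1 p :: (real ^ 'k \<Rightarrow> real) set).
    (\<forall>f \<in> mean_zero_polys m.
       (LINT x|sphere_measure. f x * \<bar>u x\<bar> powr sobolev_exponent CARD('n) p) = 0) \<longrightarrow>
    u \<in> Lp_space (sobolev_exponent CARD('n) p) sphere_measure \<and>
    Lp_norm (sobolev_exponent CARD('n) p) sphere_measure u powr p \<le>
      (sobolev_const TYPE('n) p powr p
         / Theta TYPE('k) m ((real CARD('n) - p) / real CARD('n)) + \<epsilon>)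
        * Lp_norm p sphere_measure (weak_gradient u) powr p
      + c * Lp_norm p sphere_measure u powr p"
proof -
  note card = assms(1) and p = assms(2,3)
  define n where "n = real CARD('n)"
  define s where "s = sobolev_exponent CARD('n) p"
  define \<theta> where "\<theta> = (n - p) / n"
  define \<Theta> where "\<Theta> = Theta TYPE('k) m \<theta>"
  define S where "S = sobolev_const TYPE('n) p powr p"
  have np: "1 < p" "p < n" "n > 0" using p by (auto simp: n_def)
  have s: "s > p" "s > 0" "p / s = \<theta>" "\<theta> * s = p"
    using np by (auto simp: s_def sobolev_exponent_def \<theta>_def n_def[symmetric] field_simps)
  have \<theta>: "0 < \<theta>" "\<theta> \<le> 1" using np by (auto simp: \<theta>_def)
  have S0: "S \<ge> 0" by (simp add: S_def)
  have \<Theta>1: "1 \<le> \<Theta>"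
    unfolding \<Theta>_def by (rule Theta_stability[OF \<theta> zero_less_one, where m=m and 'k='k]) blast
  obtain \<tau> where \<tau>: "0 < \<tau>" "\<tau> < 1 / 2" "(S + \<tau>) / (\<Theta> - \<tau>) \<le> S / \<Theta> + \<epsilon>"
    using close_quotient_exists[OF S0 \<Theta>1 assms(4)] by blast
  obtain \<delta> F where \<delta>: "0 < \<delta>" and F: "finite F" "F \<subseteq> (mean_zero_polys m :: (real ^ 'k \<Rightarrow> real) set)"
    and stab: "\<And>Z w. finite Z \<Longrightarrow> Z \<subseteq> sphere 0 1 \<Longrightarrow> (\<And>z. z \<in> Z \<Longrightarrow> 0 \<le> w z) \<Longrightarrow> 1 - \<delta> \<le> (\<Sum>z\<in>Z. w z) \<Longrightarrow> (\<Sum>z\<in>Z. w z) \<le> 1 \<Longrightarrow>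
      (\<And>f. f \<in> F \<Longrightarrow> \<bar>\<Sum>z\<in>Z. w z * f z\<bar> \<le> \<delta>) \<Longrightarrow> \<Theta> \<le> (\<Sum>z\<in>Z. w z powr \<theta>) + \<tau>"
    unfolding \<Theta>_def by (rule Theta_stability[OF \<theta> \<tau>(1), where m=m and 'k='k]) blast
  obtain r where r: "0 < r" "r < 1" and loc:
    "\<And>\<xi> \<eta>. \<xi> \<in> sphere (0 :: real ^ 'k) 1 \<Longrightarrow> smooth \<eta> \<Longrightarrow> (\<And>x. 0 \<le> \<eta> x) \<Longrightarrow> (\<And>x. r \<le> norm (x - \<xi>) \<Longrightarrow> \<eta> x = 0) \<Longrightarrow>
      \<exists>C\<ge>0. \<forall>u G. u \<in> Lp_space p sphere_measure \<longrightarrow> G \<in> Lp_space p sphere_measure \<longrightarrow> has_weak_gradient u G \<longrightarrow>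
        integrable sphere_measure (\<lambda>x. \<bar>\<eta> x * u x\<bar> powr s) \<and>
        (\<integral>x. \<bar>\<eta> x * u x\<bar> powr s \<partial>sphere_measure) powr (p / s) \<le>
          (S + \<tau>) * (\<integral>x. \<eta> x powr p * norm (G x) powr p \<partial>sphere_measure)
          + C * (\<integral>x. \<bar>u x\<bar> powr p \<partial>sphere_measure)"
    unfolding S_def s_def by (rule local_sobolev_inequality[OF card p \<tau>(1)]) blast
  have Fcont: "continuous_on UNIV f" if "f \<in> F" for f
    using that F(2) by (auto simp: mean_zero_polys_def intro: polys_continuous_on)
  have \<delta>2: "\<delta> / 2 > 0" using \<delta> by simp
  obtain d where d: "d > 0" "\<And>f x y. f \<in> F \<Longrightarrow> x \<in> sphere 0 1 \<Longrightarrow> y \<in> sphere 0 1 \<Longrightarrow> norm (x - y) < d \<Longrightarrow> \<bar>f x - f y\<bar> < \<delta> / 2"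
    using equi_uniformly_continuous[OF F(1) Fcont \<delta>2] by blast
  have "\<exists>M\<ge>0. \<forall>x\<in>sphere 0 1. \<bar>f x\<bar> \<le> M" if "f \<in> F" for f
    using continuous_on_sphere_bounded[OF Fcont[OF that]] by (metis real_norm_def)
  then obtain B where B: "\<And>f. f \<in> F \<Longrightarrow> 0 \<le> B f" "\<And>f x. f \<in> F \<Longrightarrow> x \<in> sphere 0 1 \<Longrightarrow> \<bar>f x\<bar> \<le> B f"
    by metis
  define M where "M = 1 + (\<Sum>f\<in>F. B f)"
  have M: "M \<ge> 1" "\<And>f x. f \<in> F \<Longrightarrow> x \<in> sphere 0 1 \<Longrightarrow> \<bar>f x\<bar> \<le> M"
  proof -
    show "M \<ge> 1" using sum_nonneg[of F B] B(1) by (simp add: M_def)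
    show "\<bar>f x\<bar> \<le> M" if "f \<in> F" "x \<in> sphere 0 1" for f x
      using B(2)[OF that] member_le_sum[OF that(1), of B] B(1) F(1) by (force simp: M_def)
  qed
  \<comment> \<open>Cells have radius at most 2 l: small enough for the local inequality and for the
      oscillation of the functions in F.\<close>
  define l where "l = min r d / 2"
  have l: "l > 0" "2 * l \<le> r" "2 * l \<le> d" using r d by (auto simp: l_def)
  obtain zs where zs: "distinct zs" "set zs \<subseteq> sphere (0 :: real ^ 'k) 1" "\<And>x. x \<in> sphere 0 1 \<Longrightarrow> \<exists>z\<in>set zs. norm (x - z) < l"
    using sphere_finite_cover[OF l(1)] by blast
  let ?Z = "set zs"
  define N where "N = real (card ?Z)"
  \<comment> \<open>With K disjoint choices of the shells, one of them carries at most the share N / K of the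
      mass.\<close>
  obtain K :: nat where K: "2 * M * N / \<delta> < real K" using reals_Archimedean2 by blast
  have K0: "K > 0"
  proof -
    have "0 \<le> 2 * M * N / \<delta>" using M(1) \<delta> by (simp add: N_def)
    then show ?thesis using K by linarith
  qed
  have NK: "M * (N / real K) \<le> \<delta> / 2"
  proof -
    have "2 * M * N \<le> real K * \<delta>" using K \<delta> by (simp add: divide_less_eq)
    then show ?thesis using K0 by (simp add: divide_le_eq mult_ac)
  qed
  \<comment> \<open>Thresholds for the squared distance, increasing from the square of l to the square of 2 l;
      the k-th partition makes its transitions between thr k and thr (k + 1).\<close>
  define thr where "thr j = l\<^sup>2 * (1 + 3 * real j / real K)" for j :: nat
  have thr_less: "thr j < thr (Suc j)" for j
    using l(1) K0 by (simp add: thr_def divide_strict_right_mono)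
  have thr_mono: "thr i \<le> thr j" if "i \<le> j" for i j
    using that l(1) K0 by (simp add: thr_def divide_right_mono)
  have thr_lo: "l\<^sup>2 \<le> thr j" for j
    using mult_left_mono[of 1 "1 + 3 * real j / real K" "l\<^sup>2"] by (simp add: thr_def)
  have thr_hi: "thr j \<le> (2 * l)\<^sup>2" if "j \<le> K" for j
  proof -
    have "real j / real K \<le> 1" using that K0 by simp
    then have "l\<^sup>2 * (1 + 3 * (real j / real K)) \<le> l\<^sup>2 * 4" by (intro mult_left_mono) auto
    then show ?thesis by (simp add: thr_def power_mult_distrib mult.commute)
  qed
  define \<eta> where "\<eta> k z x = partition_fun (cutoff (thr k) (thr (Suc k))) zs z x" for k z x
  have \<eta>sm: "smooth (\<eta> k z)" for k z
    unfolding \<eta>_def by (intro smooth_partition_fun smooth_cutoff)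
  have \<eta>b: "0 \<le> \<eta> k z x" "\<eta> k z x \<le> 1" for k z x
    unfolding \<eta>_def using partition_fun_bounds[of "cutoff (thr k) (thr (Suc k))", OF cutoff_bounds] by blast+
  have \<eta>1: "(\<Sum>z\<in>?Z. \<eta> k z x) = 1" if "x \<in> sphere 0 1" for k x
    unfolding \<eta>_def by (rule sum_partition_fun_sphere[OF zs(1,3) thr_lo thr_less that])
  have \<eta>0: "\<eta> k z x = 0" if "2 * l \<le> norm (x - z)" "k < K" for k z x
  proof -
    have "thr (Suc k) \<le> (2 * l)\<^sup>2" using that by (intro thr_hi) simp
    also have "\<dots> \<le> (norm (x - z))\<^sup>2" using that l(1) by (intro power_mono) auto
    finally show ?thesis unfolding \<eta>_def by (intro partition_fun_eq_0 cutoff_eq_0 thr_less)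
  qed
  define A where "A k z = {x \<in> sphere 0 1. thr k < (norm (x - z))\<^sup>2 \<and> (norm (x - z))\<^sup>2 < thr (Suc k)}" for k and z :: "real ^ 'k"
  have Am: "A k z \<in> sets sphere_measure" for k z
  proof -
    have "{x. thr k < (norm (x - z))\<^sup>2 \<and> (norm (x - z))\<^sup>2 < thr (Suc k)} \<in> sets borel" by measurable
    then have "sphere 0 1 \<inter> {x. thr k < (norm (x - z))\<^sup>2 \<and> (norm (x - z))\<^sup>2 < thr (Suc k)} \<in> sets sphere_measure"
      unfolding sets_sphere_measure sets_restrict_space by (rule imageI)
    moreover have "sphere 0 1 \<inter> {x. thr k < (norm (x - z))\<^sup>2 \<and> (norm (x - z))\<^sup>2 < thr (Suc k)} = A k z"
      by (auto simp: A_def)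
    ultimately show ?thesis by simp
  qed
  have Adisj: "disjoint_family_on (\<lambda>k. A k z) {..<K}" for z
    unfolding disjoint_family_on_def
  proof (intro ballI impI)
    fix i j :: nat assume "i \<noteq> j"
    then consider "Suc i \<le> j" | "Suc j \<le> i" by linarith
    then show "A i z \<inter> A j z = {}"
    proof cases
      case 1 then show ?thesis using thr_mono[OF 1] by (auto simp: A_def)
    next
      case 2 then show ?thesis using thr_mono[OF 2] by (auto simp: A_def)
    qed
  qed
  have \<eta>01: "\<eta> k z x = 0 \<or> \<eta> k z x = 1" if x: "x \<in> sphere 0 1" "x \<notin> (\<Union>z\<in>?Z. A k z)" for k z x
    unfolding \<eta>_def
  proof (rule partition_fun_01)
    fix y assume y: "y \<in> set zs"
    then have "(norm (x - y))\<^sup>2 \<le> thr k \<or> thr (Suc k) \<le> (norm (x - y))\<^sup>2" using x by (auto simp: A_def)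
    then show "cutoff (thr k) (thr (Suc k)) y x = 0 \<or> cutoff (thr k) (thr (Suc k)) y x = 1"
      using cutoff_eq_0[OF thr_less] cutoff_eq_1[OF thr_less] by blast
  qed
  define Q where "Q k z c \<longleftrightarrow> (\<forall>u G. u \<in> Lp_space p sphere_measure \<longrightarrow> G \<in> Lp_space p sphere_measure \<longrightarrow> has_weak_gradient u G \<longrightarrow>
        integrable sphere_measure (\<lambda>x. \<bar>\<eta> k z x * u x\<bar> powr s) \<and>
        (\<integral>x. \<bar>\<eta> k z x * u x\<bar> powr s \<partial>sphere_measure) powr (p / s) \<le>
          (S + \<tau>) * (\<integral>x. \<eta> k z x powr p * norm (G x) powr p \<partial>sphere_measure)
          + c * (\<integral>x. \<bar>u x\<bar> powr p \<partial>sphere_measure))" for k z c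
  have Qex: "\<exists>c\<ge>0. Q k z c" if z: "z \<in> ?Z" and k: "k < K" for z k
    unfolding Q_def
  proof (rule loc[OF _ \<eta>sm \<eta>b(1)])
    show "z \<in> sphere 0 1" using z zs(2) by blast
    show "\<eta> k z x = 0" if "r \<le> norm (x - z)" for x
      by (rule \<eta>0[OF order_trans[OF l(2) that] k])
  qed
  define C where "C k z = (SOME c. 0 \<le> c \<and> Q k z c)" for k z
  have CQ: "0 \<le> C k z \<and> Q k z (C k z)" if "z \<in> ?Z" "k < K" for k z
    unfolding C_def using Qex[OF that] by (rule someI_ex)
  have C: "0 \<le> C k z" if "z \<in> ?Z" "k < K" for k z
    using CQ[OF that] by (rule conjunct1)
  have locC: "integrable sphere_measure (\<lambda>x. \<bar>\<eta> k z x * u x\<bar> powr s) \<and>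
        (\<integral>x. \<bar>\<eta> k z x * u x\<bar> powr s \<partial>sphere_measure) powr \<theta> \<le>
          (S + \<tau>) * (\<integral>x. \<eta> k z x powr p * norm (G x) powr p \<partial>sphere_measure)
          + C k z * (\<integral>x. \<bar>u x\<bar> powr p \<partial>sphere_measure)"
    if "z \<in> ?Z" "k < K" "u \<in> Lp_space p sphere_measure" "G \<in> Lp_space p sphere_measure" "has_weak_gradient u G"
    for k z u G
    using CQ[OF that(1,2)] that(3-5) unfolding Q_def s(3) by blast
  define C' where "C' = (\<Sum>k<K. \<Sum>z\<in>?Z. C k z)"
  have C'0: "C' \<ge> 0" unfolding C'_def using C by (intro sum_nonneg) auto
  have C'k: "(\<Sum>z\<in>?Z. C k z) \<le> C'" if "k < K" for k
    unfolding C'_def using that C by (intro member_le_sum) (auto intro!: sum_nonneg)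
  have \<Theta>\<tau>: "\<Theta> - \<tau> > 0" using \<Theta>1 \<tau> by linarith
  show ?thesis
    unfolding s_def[symmetric] n_def[symmetric] \<theta>_def[symmetric] \<Theta>_def[symmetric] S_def[symmetric]
  proof (intro exI[of _ "C' / (\<Theta> - \<tau>)"] ballI impI)
    fix u :: "real ^ 'k \<Rightarrow> real"
    assume uW: "u \<in> sphere_W1 p"
      and constraint: "\<forall>f\<in>mean_zero_polys m. (LINT x|sphere_measure. f x * \<bar>u x\<bar> powr s) = 0"
    let ?G = "weak_gradient u"
    have u: "u \<in> Lp_space p sphere_measure" using uW by (simp add: sphere_W1_def)
    have G: "?G \<in> Lp_space p sphere_measure" "has_weak_gradient u ?G"
      using sphere_W1_weak_gradient_Lp[OF uW] sphere_W1_has_weak_gradient[OF uW] by auto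
    have [measurable]: "u \<in> borel_measurable sphere_measure" "?G \<in> borel_measurable sphere_measure"
      using u G(1) by (auto simp: Lp_space_def)
    have \<eta>m [measurable]: "\<eta> k z \<in> borel_measurable sphere_measure" for k z
      by (intro borel_measurable_sphere_measure smooth_borel_measurable \<eta>sm)
    note loc' = locC[OF _ _ u G]
    have iG: "integrable sphere_measure (\<lambda>x. norm (?G x) powr p)" by (rule Lp_space_integrable_powr[OF G(1)])
    define h where "h x = \<bar>u x\<bar> powr s" for x
    have h0: "0 \<le> h x" for x by (simp add: h_def)
    have [measurable]: "h \<in> borel_measurable sphere_measure" unfolding h_def by measurable
    have i\<eta>h: "integrable sphere_measure (\<lambda>x. \<eta> k z x powr s * h x)" if "z \<in> ?Z" "k < K" for k z
      using loc'[OF that] \<eta>b(1) by (simp add: h_def abs_mult powr_mult)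
    \<comment> \<open>The critical power of u is integrable because at every point some cell function is at
        least 1 / N.\<close>
    have i_h: "integrable sphere_measure h"
    proof (rule Bochner_Integration.integrable_bound)
      have 1: "integrable sphere_measure (\<lambda>x. N powr s * (\<Sum>z\<in>?Z. \<eta> 0 z x powr s * h x))"
        using i\<eta>h K0 by auto
      show "integrable sphere_measure (\<lambda>x. N powr s * (\<Sum>z\<in>?Z. \<eta> 0 z x powr s * h x))" by (rule 1)
      show "AE x in sphere_measure. norm (h x) \<le> norm (N powr s * (\<Sum>z\<in>?Z. \<eta> 0 z x powr s * h x))"
      proof (intro AE_I2)
        fix x :: "real ^ 'k" assume "x \<in> space sphere_measure"
        then have x: "x \<in> sphere 0 1" by simp
        have "\<exists>z\<in>?Z. 1 / N \<le> \<eta> 0 z x"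
        proof (rule ccontr)
          assume "\<not> ?thesis"
          then have lt: "\<And>z. z \<in> ?Z \<Longrightarrow> \<eta> 0 z x < 1 / N" by force
          have ne: "?Z \<noteq> {}" using \<eta>1[OF x, of 0] by force
          then have "(\<Sum>z\<in>?Z. \<eta> 0 z x) < (\<Sum>z\<in>?Z. 1 / N)" using lt by (intro sum_strict_mono) auto
          also have "\<dots> = 1" using ne by (simp add: N_def)
          finally show False using \<eta>1[OF x, of 0] by simp
        qed
        then obtain z where z: "z \<in> ?Z" "1 / N \<le> \<eta> 0 z x" by blast
        have N0: "N > 0" using z(1) by (auto simp: N_def card_gt_0_iff)
        have "1 \<le> N * \<eta> 0 z x" using z(2) N0 by (simp add: divide_le_eq mult.commute)
        then have "1 powr s \<le> (N * \<eta> 0 z x) powr s" using s by (intro powr_mono2) auto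
        then have "1 * h x \<le> (N * \<eta> 0 z x) powr s * h x" using h0 by (intro mult_right_mono) auto
        also have "\<dots> = N powr s * (\<eta> 0 z x powr s * h x)" using N0 \<eta>b by (simp add: powr_mult mult.assoc)
        also have "\<dots> \<le> N powr s * (\<Sum>z\<in>?Z. \<eta> 0 z x powr s * h x)"
          using z(1) h0 by (intro mult_left_mono member_le_sum) auto
        finally show "norm (h x) \<le> norm (N powr s * (\<Sum>z\<in>?Z. \<eta> 0 z x powr s * h x))" using h0 by simp
      qed
    qed measurable
    define I where "I = (\<integral>x. h x \<partial>sphere_measure)"
    have I0: "I \<ge> 0" unfolding I_def by (intro integral_nonneg_AE) (simp add: h0)
    define a where "a = (\<integral>x. norm (?G x) powr p \<partial>sphere_measure)"
    define b where "b = (\<integral>x. \<bar>u x\<bar> powr p \<partial>sphere_measure)"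
    have a0: "a \<ge> 0" and b0: "b \<ge> 0" by (auto simp: a_def b_def integral_nonneg_AE)
    have Lu: "u \<in> Lp_space s sphere_measure" using i_h by (simp add: Lp_space_def h_def[abs_def])
    have main: "I powr \<theta> \<le> (S / \<Theta> + \<epsilon>) * a + C' / (\<Theta> - \<tau>) * b"
    proof (cases "I = 0")
      case True
      then show ?thesis using a0 b0 C'0 \<Theta>\<tau> S0 \<Theta>1 assms(4) by simp
    next
      case False
      then have I: "I > 0" using I0 by simp
      obtain k where k: "k < K" "(\<integral>x. indicator (\<Union>z\<in>?Z. A k z) x * h x \<partial>sphere_measure) \<le> N / real K * I"
        using shells_pigeonhole[where I="set zs" and A=A, OF i_h h0 K0 finite_set Am Adisj] unfolding N_def I_def by blast
      define O' where "O' = (\<Union>z\<in>?Z. A k z)"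
      have Om [measurable]: "O' \<in> sets sphere_measure" unfolding O'_def using Am by auto
      have iO: "integrable sphere_measure (\<lambda>x. indicator O' x * h x)"
        using integrable_mult_indicator[OF Om i_h] by simp
      define w where "w z = (\<integral>x. \<eta> k z x powr s * h x \<partial>sphere_measure) / I" for z
      have w0: "0 \<le> w z" for z using I h0 by (auto simp: w_def intro!: divide_nonneg_pos integral_nonneg_AE)
      have \<eta>s1: "(\<Sum>z\<in>?Z. \<eta> k z x powr s) \<le> 1" if x: "x \<in> sphere 0 1" for x
      proof -
        have "(\<Sum>z\<in>?Z. \<eta> k z x powr s) \<le> (\<Sum>z\<in>?Z. \<eta> k z x)"
        proof (rule sum_mono)
          fix z
          show "\<eta> k z x powr s \<le> \<eta> k z x"
            using powr_mono'[of 1 s "\<eta> k z x"] \<eta>b[of k z x] s np by simp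
        qed
        then show ?thesis using \<eta>1[OF x] by simp
      qed
      \<comment> \<open>Outside the shells all cut-off functions are 0 or 1, so raising the cell functions to
          a power changes nothing there.\<close>
      have \<eta>s2: "1 - indicator O' x \<le> (\<Sum>z\<in>?Z. \<eta> k z x powr s)" if x: "x \<in> sphere 0 1" for x
      proof (cases "x \<in> O'")
        case True then show ?thesis by (simp add: sum_nonneg)
      next
        case False
        have "\<eta> k z x powr s = \<eta> k z x" for z using \<eta>01[of x k z] x False s by (auto simp: O'_def)
        then show ?thesis using \<eta>1[OF x] False by simp
      qed
      have i\<Sigma>: "integrable sphere_measure (\<lambda>x. \<Sum>z\<in>?Z. \<eta> k z x powr s * h x)"
        using i\<eta>h k(1) by auto
      have wsum: "(\<Sum>z\<in>?Z. w z) = (\<integral>x. (\<Sum>z\<in>?Z. \<eta> k z x powr s * h x) \<partial>sphere_measure) / I"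
        using i\<eta>h k(1) by (simp add: w_def sum_divide_distrib Bochner_Integration.integral_sum)
      have up: "(\<Sum>z\<in>?Z. w z) \<le> 1"
      proof -
        have "(\<integral>x. (\<Sum>z\<in>?Z. \<eta> k z x powr s * h x) \<partial>sphere_measure) \<le> I"
          unfolding I_def
        proof (rule integral_mono[OF i\<Sigma> i_h])
          fix x :: "real ^ 'k" assume "x \<in> space sphere_measure"
          then show "(\<Sum>z\<in>?Z. \<eta> k z x powr s * h x) \<le> h x"
            using mult_right_mono[OF \<eta>s1 h0, of x x] by (simp add: sum_distrib_right)
        qed
        then show ?thesis unfolding wsum using I by simp
      qed
      have NKd: "N / real K \<le> \<delta> / 2"
      proof -
        have "1 * (N / real K) \<le> M * (N / real K)"
          by (intro mult_right_mono M(1)) (simp add: N_def)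
        then show ?thesis unfolding mult_1 using NK by (rule order_trans)
      qed
      have lo: "1 - \<delta> \<le> (\<Sum>z\<in>?Z. w z)"
      proof -
        have "I - N / real K * I \<le> (\<integral>x. h x - indicator O' x * h x \<partial>sphere_measure)"
          using k(2) i_h iO by (simp add: I_def O'_def)
        also have "\<dots> \<le> (\<integral>x. (\<Sum>z\<in>?Z. \<eta> k z x powr s * h x) \<partial>sphere_measure)"
        proof (rule integral_mono[OF _ i\<Sigma>])
          show "integrable sphere_measure (\<lambda>x. h x - indicator O' x * h x)" using i_h iO by simp
          fix x :: "real ^ 'k" assume "x \<in> space sphere_measure"
          then show "h x - indicator O' x * h x \<le> (\<Sum>z\<in>?Z. \<eta> k z x powr s * h x)"
            using mult_right_mono[OF \<eta>s2 h0, of x x] by (simp add: sum_distrib_right left_diff_distrib)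
        qed
        finally have "(1 - N / real K) * I \<le> (\<integral>x. (\<Sum>z\<in>?Z. \<eta> k z x powr s * h x) \<partial>sphere_measure)"
          by (simp add: left_diff_distrib)
        then have "1 - N / real K \<le> (\<Sum>z\<in>?Z. w z)" unfolding wsum using I by (simp add: pos_le_divide_eq)
        then show ?thesis using NKd \<delta> by linarith
      qed
      have momf: "\<bar>\<Sum>z\<in>?Z. w z * f z\<bar> \<le> \<delta>" if f: "f \<in> F" for f
      proof -
        have fm [measurable]: "f \<in> borel_measurable sphere_measure"
          by (intro borel_measurable_sphere_measure borel_measurable_continuous_onI Fcont f)
        have ifh: "integrable sphere_measure (\<lambda>x. f x * h x)"
          using integrable_sphere_bounded_mult[OF bounded_bilinear_mult i_h Fcont[OF f]] by (simp add: mult.commute)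
        have "(\<integral>x. f x * h x \<partial>sphere_measure) = 0" using constraint f F(2) by (auto simp: h_def)
        moreover have i1: "integrable sphere_measure (\<lambda>x. \<Sum>z\<in>?Z. \<eta> k z x powr s * h x * f z)"
          using i\<eta>h k(1) by auto
        moreover have "(\<Sum>z\<in>?Z. w z * f z) * I = (\<integral>x. (\<Sum>z\<in>?Z. \<eta> k z x powr s * h x * f z) \<partial>sphere_measure)"
          using i\<eta>h k(1) I by (simp add: w_def Bochner_Integration.integral_sum sum_distrib_right)
        ultimately have "(\<Sum>z\<in>?Z. w z * f z) * I = (\<integral>x. (\<Sum>z\<in>?Z. \<eta> k z x powr s * h x * f z) - f x * h x \<partial>sphere_measure)"
          using ifh by simp
        also have "\<bar>\<dots>\<bar> \<le> (\<integral>x. \<bar>(\<Sum>z\<in>?Z. \<eta> k z x powr s * h x * f z) - f x * h x\<bar> \<partial>sphere_measure)"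
          by (rule integral_abs_bound)
        also have "\<dots> \<le> (\<integral>x. \<delta> / 2 * h x + M * (indicator O' x * h x) \<partial>sphere_measure)"
        proof (rule integral_mono)
          show "integrable sphere_measure (\<lambda>x. \<bar>(\<Sum>z\<in>?Z. \<eta> k z x powr s * h x * f z) - f x * h x\<bar>)" using i1 ifh by auto
          show "integrable sphere_measure (\<lambda>x. \<delta> / 2 * h x + M * (indicator O' x * h x))" using i_h iO by auto
          fix x :: "real ^ 'k" assume "x \<in> space sphere_measure"
          then have x: "x \<in> sphere 0 1" by simp
          let ?T = "\<Sum>z\<in>?Z. \<eta> k z x powr s"
          have "(\<Sum>z\<in>?Z. \<eta> k z x powr s * f z) - f x = (\<Sum>z\<in>?Z. \<eta> k z x powr s * (f z - f x)) - (1 - ?T) * f x"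
            by (simp add: right_diff_distrib sum_subtractf left_diff_distrib sum_distrib_right)
          also have "\<bar>\<dots>\<bar> \<le> \<bar>\<Sum>z\<in>?Z. \<eta> k z x powr s * (f z - f x)\<bar> + \<bar>(1 - ?T) * f x\<bar>"
            by (rule abs_triangle_ineq4)
          also have "\<bar>\<Sum>z\<in>?Z. \<eta> k z x powr s * (f z - f x)\<bar> \<le> (\<Sum>z\<in>?Z. \<eta> k z x powr s * (\<delta> / 2))"
          proof (rule order_trans[OF sum_abs], rule sum_mono)
            fix z assume z: "z \<in> ?Z"
            show "\<bar>\<eta> k z x powr s * (f z - f x)\<bar> \<le> \<eta> k z x powr s * (\<delta> / 2)"
            proof (cases "2 * l \<le> norm (x - z)")
              case True
              then show ?thesis using \<eta>0[OF True k(1)] by simp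
            next
              case False
              then have "norm (x - z) < d" using l(3) by linarith
              then have "\<bar>f x - f z\<bar> < \<delta> / 2" using d(2)[OF f x] z zs(2) by auto
              then have "\<bar>f z - f x\<bar> \<le> \<delta> / 2" by linarith
              then have "\<eta> k z x powr s * \<bar>f z - f x\<bar> \<le> \<eta> k z x powr s * (\<delta> / 2)"
                by (rule mult_left_mono) simp
              then show ?thesis by (simp add: abs_mult)
            qed
          qed
          also have "(\<Sum>z\<in>?Z. \<eta> k z x powr s * (\<delta> / 2)) = ?T * (\<delta> / 2)"
            by (simp only: sum_distrib_right)
          also have "\<dots> \<le> 1 * (\<delta> / 2)" using \<eta>s1[OF x] \<delta> by (intro mult_right_mono) auto
          also have "\<bar>(1 - ?T) * f x\<bar> \<le> indicator O' x * M"
          proof -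
            have "0 \<le> 1 - ?T" "1 - ?T \<le> indicator O' x" using \<eta>s1[OF x] \<eta>s2[OF x] by auto
            then show ?thesis using M(2)[OF f x] by (auto simp: abs_mult intro!: mult_mono)
          qed
          finally have le: "\<bar>(\<Sum>z\<in>?Z. \<eta> k z x powr s * f z) - f x\<bar> \<le> \<delta> / 2 + indicator O' x * M" by simp
          have "(\<Sum>z\<in>?Z. \<eta> k z x powr s * h x * f z) - f x * h x = ((\<Sum>z\<in>?Z. \<eta> k z x powr s * f z) - f x) * h x"
            unfolding left_diff_distrib sum_distrib_right by (simp add: mult_ac)
          then have "\<bar>(\<Sum>z\<in>?Z. \<eta> k z x powr s * h x * f z) - f x * h x\<bar> = \<bar>(\<Sum>z\<in>?Z. \<eta> k z x powr s * f z) - f x\<bar> * h x"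
            using h0[of x] by (simp add: abs_mult)
          also have "\<dots> \<le> (\<delta> / 2 + indicator O' x * M) * h x" by (intro mult_right_mono le h0)
          also have "(\<delta> / 2 + indicator O' x * M) * h x = \<delta> / 2 * h x + M * (indicator O' x * h x)"
            by (simp add: algebra_simps)
          finally show "\<bar>(\<Sum>z\<in>?Z. \<eta> k z x powr s * h x * f z) - f x * h x\<bar> \<le> \<delta> / 2 * h x + M * (indicator O' x * h x)" .
        qed
        also have "\<dots> = \<delta> / 2 * I + M * (\<integral>x. indicator O' x * h x \<partial>sphere_measure)"
          using i_h iO by (simp add: I_def)
        also have "\<dots> \<le> \<delta> / 2 * I + M * (N / real K * I)"
          using k(2) M(1) by (intro add_left_mono mult_left_mono) (auto simp: O'_def)
        also have "\<dots> = (\<delta> / 2 + M * (N / real K)) * I" by (simp add: distrib_right)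
        also have "\<dots> \<le> \<delta> * I"
        proof (rule mult_right_mono)
          show "\<delta> / 2 + M * (N / real K) \<le> \<delta>" using NK by linarith
        qed (use I in simp)
        finally have "\<bar>\<Sum>z\<in>?Z. w z * f z\<bar> * I \<le> \<delta> * I" using I by (simp add: abs_mult)
        then show ?thesis using I by simp
      qed
      have "\<Theta> \<le> (\<Sum>z\<in>?Z. w z powr \<theta>) + \<tau>"
        by (rule stab[OF finite_set zs(2) w0 lo up momf])
      then have "(\<Theta> - \<tau>) * I powr \<theta> \<le> (\<Sum>z\<in>?Z. w z powr \<theta>) * I powr \<theta>"
        by (intro mult_right_mono) auto
      also have "\<dots> = (\<Sum>z\<in>?Z. (\<integral>x. \<eta> k z x powr s * h x \<partial>sphere_measure) powr \<theta>)"
        unfolding sum_distrib_right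
      proof (rule sum.cong[OF refl])
        fix z
        have "(w z * I) powr \<theta> = w z powr \<theta> * I powr \<theta>" using w0 I by (simp add: powr_mult)
        then show "w z powr \<theta> * I powr \<theta> = (\<integral>x. \<eta> k z x powr s * h x \<partial>sphere_measure) powr \<theta>"
          using I by (simp add: w_def)
      qed
      also have "\<dots> \<le> (\<Sum>z\<in>?Z. (S + \<tau>) * (\<integral>x. \<eta> k z x powr p * norm (?G x) powr p \<partial>sphere_measure) + C k z * b)"
      proof (rule sum_mono)
        fix z assume z: "z \<in> ?Z"
        have "(\<integral>x. \<eta> k z x powr s * h x \<partial>sphere_measure) = (\<integral>x. \<bar>\<eta> k z x * u x\<bar> powr s \<partial>sphere_measure)"
          using \<eta>b(1) by (simp add: h_def abs_mult powr_mult)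
        then show "(\<integral>x. \<eta> k z x powr s * h x \<partial>sphere_measure) powr \<theta> \<le> (S + \<tau>) * (\<integral>x. \<eta> k z x powr p * norm (?G x) powr p \<partial>sphere_measure) + C k z * b"
          using loc'[OF z k(1)] by (simp add: b_def)
      qed
      also have "\<dots> = (S + \<tau>) * (\<Sum>z\<in>?Z. (\<integral>x. \<eta> k z x powr p * norm (?G x) powr p \<partial>sphere_measure)) + (\<Sum>z\<in>?Z. C k z) * b"
        by (simp add: sum.distrib sum_distrib_left sum_distrib_right)
      also have "\<dots> \<le> (S + \<tau>) * a + C' * b"
      proof (intro add_mono mult_left_mono mult_right_mono b0 C'k k(1))
        have i\<eta>G: "integrable sphere_measure (\<lambda>x. \<eta> k z x powr p * norm (?G x) powr p)" for z
        proof (rule Bochner_Integration.integrable_bound[OF iG])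
          show "AE x in sphere_measure. norm (\<eta> k z x powr p * norm (?G x) powr p) \<le> norm (norm (?G x) powr p)"
            using \<eta>b np by (intro AE_I2) (auto simp: abs_mult intro!: mult_left_le_one_le powr_le1)
        qed measurable
        have "(\<Sum>z\<in>?Z. (\<integral>x. \<eta> k z x powr p * norm (?G x) powr p \<partial>sphere_measure)) = (\<integral>x. (\<Sum>z\<in>?Z. \<eta> k z x powr p * norm (?G x) powr p) \<partial>sphere_measure)"
          using i\<eta>G by (intro Bochner_Integration.integral_sum[symmetric])
        also have "\<dots> \<le> a"
          unfolding a_def
        proof (rule integral_mono)
          show "integrable sphere_measure (\<lambda>x. \<Sum>z\<in>?Z. \<eta> k z x powr p * norm (?G x) powr p)" using i\<eta>G by auto
          fix x :: "real ^ 'k" assume "x \<in> space sphere_measure"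
          then have x: "x \<in> sphere 0 1" by simp
          have "(\<Sum>z\<in>?Z. \<eta> k z x powr p) \<le> (\<Sum>z\<in>?Z. \<eta> k z x)"
          proof (rule sum_mono)
            fix z
            show "\<eta> k z x powr p \<le> \<eta> k z x"
              using powr_mono'[of 1 p "\<eta> k z x"] \<eta>b[of k z x] np by simp
          qed
          then have "(\<Sum>z\<in>?Z. \<eta> k z x powr p) \<le> 1" using \<eta>1[OF x] by simp
          from mult_right_mono[OF this, of "norm (?G x) powr p"]
          show "(\<Sum>z\<in>?Z. \<eta> k z x powr p * norm (?G x) powr p) \<le> norm (?G x) powr p"
            by (simp add: sum_distrib_right)
        qed (rule iG)
        finally show "(\<Sum>z\<in>?Z. (\<integral>x. \<eta> k z x powr p * norm (?G x) powr p \<partial>sphere_measure)) \<le> a" .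
      qed (use S0 \<tau> in auto)
      finally have "I powr \<theta> \<le> ((S + \<tau>) * a + C' * b) / (\<Theta> - \<tau>)"
        using \<Theta>\<tau> by (simp add: pos_le_divide_eq mult.commute)
      also have "\<dots> = (S + \<tau>) / (\<Theta> - \<tau>) * a + C' / (\<Theta> - \<tau>) * b"
        unfolding add_divide_distrib[of "(S + \<tau>) * a"] by simp
      also have "\<dots> \<le> (S / \<Theta> + \<epsilon>) * a + C' / (\<Theta> - \<tau>) * b"
        by (intro add_right_mono mult_right_mono \<tau>(3) a0)
      finally show ?thesis .
    qed
    have Ns: "Lp_norm s sphere_measure u powr p = I powr \<theta>"
      using s I0 by (simp add: Lp_norm_def I_def h_def powr_powr)
    have Na: "Lp_norm p sphere_measure ?G powr p = a" "Lp_norm p sphere_measure u powr p = b"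
      using np a0 b0 by (simp_all add: Lp_norm_def a_def b_def powr_powr)
    show "u \<in> Lp_space s sphere_measure \<and> Lp_norm s sphere_measure u powr p \<le>
        (S / \<Theta> + \<epsilon>) * Lp_norm p sphere_measure ?G powr p + C' / (\<Theta> - \<tau>) * Lp_norm p sphere_measure u powr p"
      unfolding Ns Na using Lu main by blast
  qed
qed

end
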